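(* Let $n\ge 2$, let $\Sigma$ be a simply connected $n$-dimensional manifold, and let $W:\Sigma\to G_{2,2}(\mathbb{R}^{n+2,2})$ be a regular smooth map such that $\mathcal{D}^{W}|_{W}$ is flat. Let $\{f_{\alpha}\}_{\alpha\in\mathbb{R}P^{1}}$ and $\{\hat{f}_{\beta}\}_{\beta\in\mathbb{R}P^{1}}$ be the Demoulin families of $W$. Then $W$ is a curved flat if and only if the Demoulin families of $W$ consist of Lie applicable Legendre maps $f_{\alpha},\hat{f}_{\beta}$ such that for some $m\in\mathbb{R}\setminus\{0\}$, $(f_{\alpha},\hat{f}_{\beta})$ is an $m$-Darboux pair for all $\alpha,\beta\in\mathbb{R}P^{1}$. (Here each $f_\alpha$ and each $\hat f_\beta$ is taken with one fixed gauge equivalence class of gauge potentials.)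
   Context: $\mathbb{R}^{n+2,2}$ is an $(n+4)$-dimensional real vector space with a non-degenerate symmetric bilinear form $(\cdot,\cdot)$ of signature $(n+2,2)$. $\wedge^{2}\mathbb{R}^{n+2,2}$ is identified with the skew-symmetric endomorphisms $\mathfrak{o}(n+2,2)$ via $(a\wedge b)c=(a,c)b-(b,c)a$. The trivial bundle over $\Sigma$ is $\underline{\mathbb{R}}^{n+2,2}=\Sigma\times\mathbb{R}^{n+2,2}$, with trivial flat connection $d$. For $\mathfrak{o}(n+2,2)$-valued 1-forms $\eta$, $[\eta\wedge\eta](X,Y)=2[\eta(X),\eta(Y)]$. All maps and bundles are smooth. Curved flats. $G_{2,2}(\mathbb{R}^{n+2,2})$ is the Grassmannian of 4-dimensional linear subspaces of signature $(2,2)$. A map $W:\Sigma\to G_{2,2}(\mathbb{R}^{n+2,2})$ is viewed as a rank 4 subbundle of $\underline{\mathbb{R}}^{n+2,2}=W\oplus W^{\perp}$, and $d=\mathcal{D}^{W}+\mathcal{N}^{W}$, where $\mathcal{D}^{W}$ is the sum of the connections induced on $W$ and $W^{\perp}$ by orthogonal projection of $d$, and $\mathcal{N}^{W}\in\Omega^{1}(W\wedge W^{\perp})$. $W$ is regular if the symmetric bilinear form $(X,Y)\mapsto\mathrm{tr}(\mathcal{N}^{W}(X)\circ\mathcal{N}^{W}(Y)|_{W})$ is non-zero on a dense open set. $W$ is a curved flat if $\mathcal{D}^{W}$ is flat (on both $W$ and $W^{\perp}$). Legendre maps. $\mathcal{Z}$ is the set of 2-dimensional null (totally isotropic) subspaces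 of $\mathbb{R}^{n+2,2}$. A map $f:\Sigma\to\mathcal{Z}$ is viewed as a rank 2 null subbundle of $\underline{\mathbb{R}}^{n+2,2}$; it is a Legendre map if $d_X\sigma\in\Gamma f^{\perp}$ for all $\sigma\in\Gamma f$ and all vector fields $X$ (no immersion condition is required). Demoulin families. If $\mathcal{D}^{W}|_{W}$ is flat and $\Sigma$ is simply connected, the $\mathcal{D}^{W}$-parallel null rank 2 subbundles of $W$ form two families $\{f_{\alpha}\}$, $\{\hat{f}_{\beta}\}$, each parametrised by $\mathbb{R}P^{1}$; these are the Demoulin families of $W$. Distinct members of the same family are complementary in $W$, and members of opposite families intersect in a rank 1 null subbundle. It is known that all $f_{\alpha},\hat{f}_{\beta}$ are Legendre maps. Lie applicability. A Legendre map $f$ is Lie applicable if there is $\eta\in\Omega^{1}(f\wedge f^{\perp})$ (where $f\wedge f^{\perp}$ is the span of all $a\wedge b$ with $a\in f$, $b\in f^{\perp}$) with $d\eta=[\eta\wedge\eta]=0$ such that the quadratic differential $q(X,Y)=\mathrm{tr}(f\to f:\sigma\mapsto\eta(X)d_{Y}\sigma)$ is non-zero on a dense open set. Such an $\eta$ is a gauge potential of $f$. For $\tau\in\Gamma(\wedge^{2}f)$, $\eta-d\tau$ is again a gauge potential, said to be gauge equivalent to $\eta$; $[\eta]$ denotes the class of $\eta$. A Lie applicable Legendre map always means a pair $(f,[\eta])$ for a fixed choice of $[\eta]$. For every gauge potential $\eta$ and $t\in\mathbb{R}$ the connection $d+t\eta$ is flat. Darboux pairs. Let $(f,[\eta])$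 be Lie applicable and $m\in\mathbb{R}\setminus\{0\}$. If $\hat{s}$ is a rank 1 null subbundle which is parallel for $d+m\eta$, for some representative $\eta$ of $[\eta]$, and which lies nowhere in $f$, put $s_{0}=f\cap\hat{s}^{\perp}$ and $\hat{f}=s_{0}\oplus\hat{s}$; then $\hat{f}$ is called an $m$-Darboux transform of $f$. It is known that $\hat{f}$ is then also a Lie applicable Legendre map and that $f$ is an $m$-Darboux transform of $\hat{f}$; $(f,\hat{f})$ is called an $m$-Darboux pair. *)

theory Defs
  imports "HOL-Analysis.Analysis"
begin

section \<open>Smooth manifolds\<close>

text \<open>For open \<open>S\<close> in a finite-dimensional space this is \<open>C\<^sup>k\<close>:
  all iterated directional derivatives up to order \<open>k\<close> exist and are continuous.\<close>

primrec Ck_on :: "nat \<Rightarrow> 'a::euclidean_space set \<Rightarrow> ('a \<Rightarrow> 'b::real_normed_vector) \<Rightarrow> bool" where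
  "Ck_on 0 S f \<longleftrightarrow> continuous_on S f"
| "Ck_on (Suc k) S f \<longleftrightarrow>
     (\<forall>x\<in>S. f differentiable (at x)) \<and> (\<forall>v. Ck_on k S (\<lambda>x. frechet_derivative f (at x) v))"

definition smooth_on :: "'a::euclidean_space set \<Rightarrow> ('a \<Rightarrow> 'b::real_normed_vector) \<Rightarrow> bool" where
  "smooth_on S f \<longleftrightarrow> (\<forall>k. Ck_on k S f)"

type_synonym ('s, 'n) chart = "'s set \<times> ('s \<Rightarrow> real ^ 'n)"

definition smooth_atlas :: "('s::topological_space, 'n::finite) chart set \<Rightarrow> bool" where
  "smooth_atlas A \<longleftrightarrow>
     \<Union> (fst ` A) = UNIV \<and>
     (\<forall>(U, \<phi>)\<in>A. open U \<and> open (\<phi> ` U) \<and> homeomorphism U (\<phi> ` U) \<phi> (inv_into U \<phi>)) \<and>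
     (\<forall>(U, \<phi>)\<in>A. \<forall>(V, \<psi>)\<in>A. smooth_on (\<phi> ` (U \<inter> V)) (\<psi> \<circ> inv_into U \<phi>))"

definition msmooth_on ::
  "('s::topological_space, 'n::finite) chart set \<Rightarrow> 's set \<Rightarrow> ('s \<Rightarrow> 'b::real_normed_vector) \<Rightarrow> bool" where
  "msmooth_on A S F \<longleftrightarrow> (\<forall>(U, \<phi>)\<in>A. smooth_on (\<phi> ` (U \<inter> S)) (F \<circ> inv_into U \<phi>))"

abbreviation msmooth ::
  "('s::topological_space, 'n::finite) chart set \<Rightarrow> ('s \<Rightarrow> 'b::real_normed_vector) \<Rightarrow> bool" where
  "msmooth A \<equiv> msmooth_on A UNIV"

text \<open>Tangent vectors at \<open>p\<close> are the derivations at \<open>p\<close> of the algebra of smooth real functions.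
  HOL functions being total, they are set to vanish on non-smooth functions, so that a derivation
  is determined by its values on smooth functions.\<close>

type_synonym 's tvec = "('s \<Rightarrow> real) \<Rightarrow> real"

definition tangent_space :: "('s::topological_space, 'n::finite) chart set \<Rightarrow> 's \<Rightarrow> 's tvec set" where
  "tangent_space A p = {v.
     (\<forall>g h a b. msmooth A g \<longrightarrow> msmooth A h \<longrightarrow> v (\<lambda>x. a * g x + b * h x) = a * v g + b * v h) \<and>
     (\<forall>g h. msmooth A g \<longrightarrow> msmooth A h \<longrightarrow> v (\<lambda>x. g x * h x) = v g * h p + g p * v h) \<and>
     (\<forall>g. \<not> msmooth A g \<longrightarrow> v g = 0)}"

definition vector_field :: "('s::topological_space, 'n::finite) chart set \<Rightarrow> ('s \<Rightarrow> 's tvec) \<Rightarrow> bool" where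
  "vector_field A X \<longleftrightarrow>
     (\<forall>p. X p \<in> tangent_space A p) \<and> (\<forall>g. msmooth A g \<longrightarrow> msmooth A (\<lambda>p. X p g))"

definition lie_bracket ::
  "('s::topological_space, 'n::finite) chart set \<Rightarrow> ('s \<Rightarrow> 's tvec) \<Rightarrow> ('s \<Rightarrow> 's tvec) \<Rightarrow> 's \<Rightarrow> 's tvec" where
  "lie_bracket A X Y p g =
     (if msmooth A g then X p (\<lambda>x. Y x g) - Y p (\<lambda>x. X x g) else 0)"

text \<open>The trivial flat connection \<open>d\<close>: \<open>dir v \<sigma>\<close> is \<open>d\<^sub>v \<sigma>\<close>, computed componentwise.\<close>

definition dir :: "'s tvec \<Rightarrow> ('s \<Rightarrow> 'v::euclidean_space) \<Rightarrow> 'v" where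
  "dir v \<sigma> = (\<Sum>b\<in>Basis. v (\<lambda>x. \<sigma> x \<bullet> b) *\<^sub>R b)"

definition nonzero_on_dense_open :: "('s::topological_space \<Rightarrow> bool) \<Rightarrow> bool" where
  "nonzero_on_dense_open nz \<longleftrightarrow> (\<exists>U. open U \<and> closure U = UNIV \<and> (\<forall>p\<in>U. nz p))"


section \<open>Linear algebra of an indefinite inner product\<close>

text \<open>The Euclidean structure of \<open>'v\<close> plays no geometric role; it only makes \<open>'v\<close> a
  finite-dimensional real vector space.\<close>

definition sum_space :: "'v::real_vector set \<Rightarrow> 'v set \<Rightarrow> 'v set" where
  "sum_space S T = {x + y | x y. x \<in> S \<and> y \<in> T}"

definition has_signature ::
  "('v::euclidean_space \<Rightarrow> 'v \<Rightarrow> real) \<Rightarrow> 'v set \<Rightarrow> nat \<Rightarrow> nat \<Rightarrow> bool" where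
  "has_signature B S p q \<longleftrightarrow>
     (\<exists>P N. subspace P \<and> subspace N \<and> dim P = p \<and> dim N = q \<and> S = sum_space P N \<and>
        (\<forall>x\<in>P. x \<noteq> 0 \<longrightarrow> B x x > 0) \<and> (\<forall>y\<in>N. y \<noteq> 0 \<longrightarrow> B y y < 0) \<and>
        (\<forall>x\<in>P. \<forall>y\<in>N. B x y = 0))"

definition perp :: "('v \<Rightarrow> 'v \<Rightarrow> real) \<Rightarrow> 'v set \<Rightarrow> 'v set" where
  "perp B S = {x. \<forall>y\<in>S. B x y = 0}"

definition null_space :: "('v \<Rightarrow> 'v \<Rightarrow> real) \<Rightarrow> 'v set \<Rightarrow> bool" where
  "null_space B S \<longleftrightarrow> (\<forall>x\<in>S. \<forall>y\<in>S. B x y = 0)"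

text \<open>\<open>B\<close>-orthogonal projection onto a subspace on which \<open>B\<close> is non-degenerate.\<close>

definition oproj :: "('v::real_vector \<Rightarrow> 'v \<Rightarrow> real) \<Rightarrow> 'v set \<Rightarrow> 'v \<Rightarrow> 'v" where
  "oproj B S u = (THE w. w \<in> S \<and> u - w \<in> perp B S)"

definition wedge :: "('v::real_vector \<Rightarrow> 'v \<Rightarrow> real) \<Rightarrow> 'v \<Rightarrow> 'v \<Rightarrow> 'v \<Rightarrow> 'v" where
  "wedge B a b c = B a c *\<^sub>R b - B b c *\<^sub>R a"

text \<open>The span of all \<open>a \<and> b\<close> with \<open>a \<in> S\<close>, \<open>b \<in> T\<close>, for subspaces \<open>S\<close> and \<open>T\<close>
  (scalar coefficients can be absorbed into \<open>a\<close>).\<close>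

definition wedge_span ::
  "('v::real_vector \<Rightarrow> 'v \<Rightarrow> real) \<Rightarrow> 'v set \<Rightarrow> 'v set \<Rightarrow> ('v \<Rightarrow> 'v) set" where
  "wedge_span B S T =
     {\<lambda>c. \<Sum>i<k. wedge B (a i) (b i) c | (k::nat) a b. \<forall>i<k. a i \<in> S \<and> b i \<in> T}"

text \<open>Trace of a linear map from the subspace \<open>S\<close> to itself, from any basis of \<open>S\<close>.\<close>

definition trace_on :: "'v::euclidean_space set \<Rightarrow> ('v \<Rightarrow> 'v) \<Rightarrow> real" where
  "trace_on S T =
     (let b = (SOME b. independent b \<and> span b = S) in \<Sum>u\<in>b. representation b (T u) u)"


section \<open>Subbundles of the trivial bundle and connections\<close>

definition subbundle ::
  "('s::topological_space, 'n::finite) chart set \<Rightarrow> nat \<Rightarrow> ('s \<Rightarrow> 'v::euclidean_space set) \<Rightarrow> bool" where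
  "subbundle A k E \<longleftrightarrow>
     (\<forall>p. subspace (E p) \<and> dim (E p) = k) \<and>
     (\<forall>p. \<exists>U. open U \<and> p \<in> U \<and>
        (\<exists>s::nat \<Rightarrow> 's \<Rightarrow> 'v. (\<forall>i<k. msmooth_on A U (s i)) \<and>
           (\<forall>x\<in>U. E x = span ((\<lambda>i. s i x) ` {..<k}))))"

definition null_subbundle ::
  "('s::topological_space, 'n::finite) chart set \<Rightarrow> ('v::euclidean_space \<Rightarrow> 'v \<Rightarrow> real) \<Rightarrow>
     nat \<Rightarrow> ('s \<Rightarrow> 'v set) \<Rightarrow> bool" where
  "null_subbundle A B k E \<longleftrightarrow> subbundle A k E \<and> (\<forall>p. null_space B (E p))"

definition sections ::
  "('s::topological_space, 'n::finite) chart set \<Rightarrow> ('s \<Rightarrow> 'v::euclidean_space set) \<Rightarrow> ('s \<Rightarrow> 'v) set" where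
  "sections A E = {\<sigma>. msmooth A \<sigma> \<and> (\<forall>p. \<sigma> p \<in> E p)}"

text \<open>A connection is a function \<open>nabla\<close> such that \<open>nabla p v \<sigma>\<close> is the derivative at \<open>p\<close> of the
  section \<open>\<sigma>\<close> along the tangent vector \<open>v\<close> at \<open>p\<close>.\<close>

type_synonym ('s, 'v) conn = "'s \<Rightarrow> 's tvec \<Rightarrow> ('s \<Rightarrow> 'v) \<Rightarrow> 'v"

definition parallel ::
  "('s::topological_space, 'n::finite) chart set \<Rightarrow> ('s, 'v::euclidean_space) conn \<Rightarrow>
     ('s \<Rightarrow> 'v set) \<Rightarrow> bool" where
  "parallel A nabla E \<longleftrightarrow>
     (\<forall>\<sigma>\<in>sections A E. \<forall>p. \<forall>v\<in>tangent_space A p. nabla p v \<sigma> \<in> E p)"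

definition curvature ::
  "('s::topological_space, 'n::finite) chart set \<Rightarrow> ('s, 'v::euclidean_space) conn \<Rightarrow>
     ('s \<Rightarrow> 's tvec) \<Rightarrow> ('s \<Rightarrow> 's tvec) \<Rightarrow> ('s \<Rightarrow> 'v) \<Rightarrow> 's \<Rightarrow> 'v" where
  "curvature A nabla X Y \<sigma> p =
     nabla p (X p) (\<lambda>x. nabla x (Y x) \<sigma>) - nabla p (Y p) (\<lambda>x. nabla x (X x) \<sigma>)
       - nabla p (lie_bracket A X Y p) \<sigma>"

definition flat_on ::
  "('s::topological_space, 'n::finite) chart set \<Rightarrow> ('s, 'v::euclidean_space) conn \<Rightarrow>
     ('s \<Rightarrow> 'v set) \<Rightarrow> bool" where
  "flat_on A nabla E \<longleftrightarrow>
     (\<forall>X Y. vector_field A X \<longrightarrow> vector_field A Y \<longrightarrow>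
        (\<forall>\<sigma>\<in>sections A E. \<forall>p. curvature A nabla X Y \<sigma> p = 0))"


section \<open>Maps into the Grassmannian of (2,2)-planes and curved flats\<close>

definition map_G22 ::
  "('s::topological_space, 'n::finite) chart set \<Rightarrow> ('v::euclidean_space \<Rightarrow> 'v \<Rightarrow> real) \<Rightarrow>
     ('s \<Rightarrow> 'v set) \<Rightarrow> bool" where
  "map_G22 A B W \<longleftrightarrow> subbundle A 4 W \<and> (\<forall>p. has_signature B (W p) 2 2)"

definition DW :: "('v::euclidean_space \<Rightarrow> 'v \<Rightarrow> real) \<Rightarrow> ('s \<Rightarrow> 'v set) \<Rightarrow> ('s, 'v) conn" where
  "DW B W p v \<sigma> =
     oproj B (W p) (dir v (\<lambda>x. oproj B (W x) (\<sigma> x))) +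
     oproj B (perp B (W p)) (dir v (\<lambda>x. oproj B (perp B (W x)) (\<sigma> x)))"

text \<open>\<open>\<N>\<^sup>W = d - \<D>\<^sup>W\<close> is tensorial, so its value on \<open>u\<close> may be computed on the constant
  section through \<open>u\<close>.\<close>

definition NW ::
  "('v::euclidean_space \<Rightarrow> 'v \<Rightarrow> real) \<Rightarrow> ('s \<Rightarrow> 'v set) \<Rightarrow> 's \<Rightarrow> 's tvec \<Rightarrow> 'v \<Rightarrow> 'v" where
  "NW B W p v u = dir v (\<lambda>x::'s. u) - DW B W p v (\<lambda>x. u)"

definition regular_map ::
  "('s::topological_space, 'n::finite) chart set \<Rightarrow> ('v::euclidean_space \<Rightarrow> 'v \<Rightarrow> real) \<Rightarrow>
     ('s \<Rightarrow> 'v set) \<Rightarrow> bool" where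
  "regular_map A B W \<longleftrightarrow> nonzero_on_dense_open (\<lambda>p.
     \<exists>v\<in>tangent_space A p. \<exists>w\<in>tangent_space A p.
       trace_on (W p) (NW B W p v \<circ> NW B W p w) \<noteq> 0)"

definition curved_flat ::
  "('s::topological_space, 'n::finite) chart set \<Rightarrow> ('v::euclidean_space \<Rightarrow> 'v \<Rightarrow> real) \<Rightarrow>
     ('s \<Rightarrow> 'v set) \<Rightarrow> bool" where
  "curved_flat A B W \<longleftrightarrow>
     flat_on A (DW B W) W \<and> flat_on A (DW B W) (\<lambda>p. perp B (W p))"


section \<open>Demoulin families\<close>

definition RP1 :: "(real ^ 2) set set" where
  "RP1 = {L. subspace L \<and> dim L = 1}"

definition parallel_null_planes ::
  "('s::topological_space, 'n::finite) chart set \<Rightarrow> ('v::euclidean_space \<Rightarrow> 'v \<Rightarrow> real) \<Rightarrow>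
     ('s \<Rightarrow> 'v set) \<Rightarrow> ('s \<Rightarrow> 'v set) set" where
  "parallel_null_planes A B W =
     {g. null_subbundle A B 2 g \<and> (\<forall>p. g p \<subseteq> W p) \<and> parallel A (DW B W) g}"

text \<open>The two families exhaust the parallel null rank 2 subbundles of \<open>W\<close>; the last three
  conditions say how the subbundles are sorted into the two families.  Complementarity makes
  both parametrisations injective.\<close>

definition demoulin_families ::
  "('s::topological_space, 'n::finite) chart set \<Rightarrow> ('v::euclidean_space \<Rightarrow> 'v \<Rightarrow> real) \<Rightarrow>
     ('s \<Rightarrow> 'v set) \<Rightarrow> ((real ^ 2) set \<Rightarrow> 's \<Rightarrow> 'v set) \<Rightarrow> ((real ^ 2) set \<Rightarrow> 's \<Rightarrow> 'v set) \<Rightarrow> bool" where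
  "demoulin_families A B W f fh \<longleftrightarrow>
     parallel_null_planes A B W = f ` RP1 \<union> fh ` RP1 \<and>
     (\<forall>\<alpha>\<in>RP1. \<forall>\<alpha>'\<in>RP1. \<alpha> \<noteq> \<alpha>' \<longrightarrow>
        (\<forall>p. f \<alpha> p \<inter> f \<alpha>' p = {0} \<and> sum_space (f \<alpha> p) (f \<alpha>' p) = W p)) \<and>
     (\<forall>\<beta>\<in>RP1. \<forall>\<beta>'\<in>RP1. \<beta> \<noteq> \<beta>' \<longrightarrow>
        (\<forall>p. fh \<beta> p \<inter> fh \<beta>' p = {0} \<and> sum_space (fh \<beta> p) (fh \<beta>' p) = W p)) \<and>
     (\<forall>\<alpha>\<in>RP1. \<forall>\<beta>\<in>RP1. null_subbundle A B 1 (\<lambda>p. f \<alpha> p \<inter> fh \<beta> p))"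


section \<open>Legendre maps, gauge potentials and Darboux pairs\<close>

definition legendre_map ::
  "('s::topological_space, 'n::finite) chart set \<Rightarrow> ('v::euclidean_space \<Rightarrow> 'v \<Rightarrow> real) \<Rightarrow>
     ('s \<Rightarrow> 'v set) \<Rightarrow> bool" where
  "legendre_map A B f \<longleftrightarrow> null_subbundle A B 2 f \<and>
     (\<forall>\<sigma>\<in>sections A f. \<forall>p. \<forall>v\<in>tangent_space A p. dir v \<sigma> \<in> perp B (f p))"

text \<open>Endomorphism-valued 1-forms; \<open>\<eta> p v\<close> is only meaningful for \<open>v\<close> tangent at \<open>p\<close>, and
  smoothness is tested on vector fields and constant vectors \<open>u\<close>.\<close>

type_synonym ('s, 'v) form1 = "'s \<Rightarrow> 's tvec \<Rightarrow> 'v \<Rightarrow> 'v"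

definition one_form ::
  "('s::topological_space, 'n::finite) chart set \<Rightarrow> ('s \<Rightarrow> ('v::euclidean_space \<Rightarrow> 'v) set) \<Rightarrow>
     ('s, 'v) form1 \<Rightarrow> bool" where
  "one_form A V \<eta> \<longleftrightarrow>
     (\<forall>p. \<forall>v\<in>tangent_space A p. \<eta> p v \<in> V p) \<and>
     (\<forall>p. \<forall>v\<in>tangent_space A p. \<forall>w\<in>tangent_space A p. \<forall>a b u.
        \<eta> p (\<lambda>g. a * v g + b * w g) u = a *\<^sub>R \<eta> p v u + b *\<^sub>R \<eta> p w u) \<and>
     (\<forall>X u. vector_field A X \<longrightarrow> msmooth A (\<lambda>p. \<eta> p (X p) u))"

definition ext_deriv ::
  "('s::topological_space, 'n::finite) chart set \<Rightarrow> ('s, 'v::euclidean_space) form1 \<Rightarrow>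
     ('s \<Rightarrow> 's tvec) \<Rightarrow> ('s \<Rightarrow> 's tvec) \<Rightarrow> 's \<Rightarrow> 'v \<Rightarrow> 'v" where
  "ext_deriv A \<eta> X Y p u =
     dir (X p) (\<lambda>x. \<eta> x (Y x) u) - dir (Y p) (\<lambda>x. \<eta> x (X x) u) - \<eta> p (lie_bracket A X Y p) u"

definition bracket_wedge ::
  "('s, 'v::real_vector) form1 \<Rightarrow> 's \<Rightarrow> 's tvec \<Rightarrow> 's tvec \<Rightarrow> 'v \<Rightarrow> 'v" where
  "bracket_wedge \<eta> p v w u = 2 *\<^sub>R (\<eta> p v (\<eta> p w u) - \<eta> p w (\<eta> p v u))"

text \<open>\<open>q(v,w) = tr(f \<rightarrow> f : \<sigma> \<mapsto> \<eta>(v) d\<^sub>w \<sigma>)\<close>. For a Legendre map \<open>f\<close> and \<open>\<eta>\<close> with values in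
  \<open>f \<and> f\<^sup>\<bottom>\<close> the value at \<open>p\<close> depends only on \<open>\<sigma> p\<close>, so any section of \<open>f\<close> through \<open>u\<close> may be
  used.\<close>

definition quad_diff ::
  "('s::topological_space, 'n::finite) chart set \<Rightarrow> ('s \<Rightarrow> 'v::euclidean_space set) \<Rightarrow>
     ('s, 'v) form1 \<Rightarrow> 's \<Rightarrow> 's tvec \<Rightarrow> 's tvec \<Rightarrow> real" where
  "quad_diff A f \<eta> p v w =
     trace_on (f p) (\<lambda>u. \<eta> p v (dir w (SOME \<sigma>. \<sigma> \<in> sections A f \<and> \<sigma> p = u)))"

definition gauge_potential ::
  "('s::topological_space, 'n::finite) chart set \<Rightarrow> ('v::euclidean_space \<Rightarrow> 'v \<Rightarrow> real) \<Rightarrow>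
     ('s \<Rightarrow> 'v set) \<Rightarrow> ('s, 'v) form1 \<Rightarrow> bool" where
  "gauge_potential A B f \<eta> \<longleftrightarrow>
     one_form A (\<lambda>p. wedge_span B (f p) (perp B (f p))) \<eta> \<and>
     (\<forall>X Y. vector_field A X \<longrightarrow> vector_field A Y \<longrightarrow> (\<forall>p u. ext_deriv A \<eta> X Y p u = 0)) \<and>
     (\<forall>p. \<forall>v\<in>tangent_space A p. \<forall>w\<in>tangent_space A p. \<forall>u. bracket_wedge \<eta> p v w u = 0) \<and>
     nonzero_on_dense_open (\<lambda>p.
       \<exists>v\<in>tangent_space A p. \<exists>w\<in>tangent_space A p. quad_diff A f \<eta> p v w \<noteq> 0)"

definition gauge_equivalent ::
  "('s::topological_space, 'n::finite) chart set \<Rightarrow> ('v::euclidean_space \<Rightarrow> 'v \<Rightarrow> real) \<Rightarrow>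
     ('s \<Rightarrow> 'v set) \<Rightarrow> ('s, 'v) form1 \<Rightarrow> ('s, 'v) form1 \<Rightarrow> bool" where
  "gauge_equivalent A B f \<eta> \<eta>' \<longleftrightarrow>
     (\<exists>\<tau>::'s \<Rightarrow> 'v \<Rightarrow> 'v.
        (\<forall>p. \<tau> p \<in> wedge_span B (f p) (f p)) \<and> (\<forall>u. msmooth A (\<lambda>p. \<tau> p u)) \<and>
        (\<forall>p. \<forall>v\<in>tangent_space A p. \<forall>u. \<eta>' p v u = \<eta> p v u - dir v (\<lambda>x. \<tau> x u)))"

definition gauge_class ::
  "('s::topological_space, 'n::finite) chart set \<Rightarrow> ('v::euclidean_space \<Rightarrow> 'v \<Rightarrow> real) \<Rightarrow>
     ('s \<Rightarrow> 'v set) \<Rightarrow> ('s, 'v) form1 \<Rightarrow> ('s, 'v) form1 set" where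
  "gauge_class A B f \<eta> = {\<eta>'. gauge_equivalent A B f \<eta> \<eta>'}"

text \<open>A Lie applicable Legendre map is a pair of a Legendre map \<open>f\<close> and a gauge equivalence class
  \<open>C\<close> of gauge potentials of \<open>f\<close>.\<close>

definition lie_applicable ::
  "('s::topological_space, 'n::finite) chart set \<Rightarrow> ('v::euclidean_space \<Rightarrow> 'v \<Rightarrow> real) \<Rightarrow>
     ('s \<Rightarrow> 'v set) \<Rightarrow> ('s, 'v) form1 set \<Rightarrow> bool" where
  "lie_applicable A B f C \<longleftrightarrow>
     legendre_map A B f \<and> (\<exists>\<eta>. gauge_potential A B f \<eta> \<and> C = gauge_class A B f \<eta>)"

definition d_plus :: "real \<Rightarrow> ('s, 'v::euclidean_space) form1 \<Rightarrow> ('s, 'v) conn" where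
  "d_plus t \<eta> p v \<sigma> = dir v \<sigma> + t *\<^sub>R \<eta> p v (\<sigma> p)"

definition darboux_transform ::
  "('s::topological_space, 'n::finite) chart set \<Rightarrow> ('v::euclidean_space \<Rightarrow> 'v \<Rightarrow> real) \<Rightarrow> real \<Rightarrow>
     ('s \<Rightarrow> 'v set) \<Rightarrow> ('s, 'v) form1 set \<Rightarrow> ('s \<Rightarrow> 'v set) \<Rightarrow> bool" where
  "darboux_transform A B m f C fh \<longleftrightarrow>
     (\<exists>\<eta>\<in>C. \<exists>s. null_subbundle A B 1 s \<and> parallel A (d_plus m \<eta>) s \<and>
        (\<forall>p. \<not> s p \<subseteq> f p) \<and>
        (\<forall>p. fh p = sum_space (f p \<inter> perp B (s p)) (s p)))"

definition darboux_pair ::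
  "('s::topological_space, 'n::finite) chart set \<Rightarrow> ('v::euclidean_space \<Rightarrow> 'v \<Rightarrow> real) \<Rightarrow> real \<Rightarrow>
     ('s \<Rightarrow> 'v set) \<Rightarrow> ('s, 'v) form1 set \<Rightarrow> ('s \<Rightarrow> 'v set) \<Rightarrow> ('s, 'v) form1 set \<Rightarrow> bool" where
  "darboux_pair A B m f C fh Ch \<longleftrightarrow>
     m \<noteq> 0 \<and> lie_applicable A B f C \<and> lie_applicable A B fh Ch \<and>
     darboux_transform A B m f C fh \<and> darboux_transform A B m fh Ch f"

end

theory Submission
  imports Defs
begin

text \<open>Choose two members of each Demoulin family; they meet in four null lines, and each line pairs
  only with the opposite one. Hence the projections \<open>F\<close>, \<open>G\<close> of the trivial bundle onto two members
  \<open>f1\<close>, \<open>f2\<close> of a family are smooth, and \<open>P = F + G\<close> is the orthogonal projection onto \<open>W\<close>. Since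
  \<open>d\<close> is flat, \<open>W\<close> is a curved flat iff the endomorphisms \<open>d\<^sub>X P\<close> commute.

  If they do, the negative of the \<open>f1 \<and> W\<^sup>\<bottom>\<close>-part of \<open>\<N>\<^sup>W\<close> is a gauge potential of \<open>f1\<close>, and
  the intersection of \<open>f2\<close> with a member \<open>g\<close> of the opposite family is a parallel line for it that
  exhibits \<open>g\<close> as a \<open>1\<close>-Darboux transform. As commutation is needed for all tangent vectors, not
  only for values of vector fields, tangent vectors have to be extended to vector fields, which
  uses bump functions and Hadamard's lemma.

  Conversely, let \<open>\<eta>\<close> be a gauge potential of \<open>f1\<close>. After a gauge transformation every \<open>g\<close> of the
  opposite family contains, at each point, a vector outside \<open>f1\<close> on which \<open>m \<eta>\<close> and
  \<open>- \<N>\<^sup>W\<close> have the same \<open>W\<^sup>\<bottom>\<close>-part. As the planes \<open>g\<close> cover \<open>f2\<close>, these vectors can be chosen to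
  fill a null complement of \<open>f1\<close> in \<open>W\<close>; the \<open>W\<^sup>\<bottom>\<close>-part of \<open>d \<eta> = 0\<close> then says that the
  \<open>d\<^sub>X P\<close> commute on \<open>W\<^sup>\<bottom>\<close>.\<close>

section \<open>Calculus of smooth maps\<close>

text \<open>Parallelism of the planes gives \<open>G dF = 0\<close> and \<open>F dG = 0\<close>;
  with \<open>F F = F\<close>, \<open>F G = 0\<close> and the adjointness of \<open>F\<close> and
  \<open>G\<close> this yields the identities for \<open>dF\<close> and \<open>dG\<close> that the
  potential rests on. On \<open>f2\<close> the potential cancels \<open>\<N>\<^sup>W\<close>, so
  \<open>d + \<eta>\<close> is \<open>\<D>\<^sup>W\<close> there; hence \<open>m\<close> is 1. The
  obstacle of the converse: a Darboux transform \<open>h\<close> only provides some parallel line in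
  \<open>h\<close>, whose position relative to \<open>f1\<close> is unknown and may change with
  \<open>h\<close>. A third plane \<open>k\<close> fixes compatible bases of \<open>f1\<close> and
  \<open>f2\<close>, in which suitable planes \<open>h\<close> are spanned by two vectors with the
  same coefficients \<open>a\<close>, \<open>b\<close>. The unknown positions become factors of
  proportionality in a linear family, and linearity forces one common factor. It is found at one
  point for two tangent vectors, without any claim that it varies smoothly. This suffices because
  the \<open>W\<^sup>\<bottom>\<close>-part of \<open>d \<eta> = 0\<close>, evaluated on
  \<open>W\<^sup>\<bottom>\<close>, contains no derivative of \<open>\<eta>\<close>.\<close>

lemma linear_Basis_sum:
  fixes L :: "'a::euclidean_space \<Rightarrow> 'b::real_vector"
  assumes "linear L"
  shows "L w = (\<Sum>b\<in>Basis. (w \<bullet> b) *\<^sub>R L b)"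
proof -
  have "L w = L (\<Sum>b\<in>Basis. (w \<bullet> b) *\<^sub>R b)" by (simp only: euclidean_representation)
  also have "\<dots> = (\<Sum>b\<in>Basis. (w \<bullet> b) *\<^sub>R L b)"
    by (simp only: linear_sum[OF assms] linear_scale[OF assms])
  finally show ?thesis .
qed

lemma Ck_on_cong:
  assumes "open S" "\<And>x. x \<in> S \<Longrightarrow> f x = g x" "Ck_on k S f"
  shows "Ck_on k S g"
  using assms
proof (induction k arbitrary: f g)
  case 0
  then show ?case by (simp cong: continuous_on_cong)
next
  case (Suc k)
  have fr: "frechet_derivative f (at x) = frechet_derivative g (at x)" if "x \<in> S" for x
    by (rule frechet_derivative_transform_within_open[of f x S g]) (use Suc that in auto)
  have "g differentiable (at x)" if "x \<in> S" for x
    using Suc.prems that unfolding differentiable_def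
    by (metis Ck_on.simps(2) differentiable_def has_derivative_transform_within_open)
  moreover have "Ck_on k S (\<lambda>x. frechet_derivative g (at x) v)" for v
    using Suc.IH[of "\<lambda>x. frechet_derivative f (at x) v" "\<lambda>x. frechet_derivative g (at x) v"] Suc.prems fr
    by simp
  ultimately show ?case by simp
qed

lemma Ck_on_subset: "Ck_on k S f \<Longrightarrow> T \<subseteq> S \<Longrightarrow> Ck_on k T f"
  by (induction k arbitrary: f) (auto intro: continuous_on_subset)

text \<open>Lets the derivative be given by a formula \<open>D\<close> instead of the choice hidden
  in \<open>frechet_derivative\<close>; the closure properties below are inductions over it.\<close>

lemma Ck_on_SucI:
  assumes "open S" "\<And>x. x \<in> S \<Longrightarrow> (f has_derivative D x) (at x)" "\<And>v. Ck_on k S (\<lambda>x. D x v)"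
  shows "Ck_on (Suc k) S f"
proof -
  have "D x = frechet_derivative f (at x)" if "x \<in> S" for x
    by (rule frechet_derivative_at) (use assms that in auto)
  then have "Ck_on k S (\<lambda>x. frechet_derivative f (at x) v)" for v
    using Ck_on_cong[OF assms(1) _ assms(3)[of v]] by auto
  with assms show ?thesis by (auto simp: differentiable_def)
qed

lemma Ck_on_SucD: "Ck_on (Suc k) S f \<Longrightarrow> Ck_on k S f"
proof (induction k arbitrary: f)
  case 0
  then show ?case
    by (simp add: continuous_at_imp_continuous_on differentiable_imp_continuous_within)
next
  case (Suc k)
  then show ?case
    using Suc.IH[of "\<lambda>x. frechet_derivative f (at x) v" for v] by simp
qed

lemma Ck_on_has_derivative:
  "Ck_on (Suc k) S f \<Longrightarrow> x \<in> S \<Longrightarrow> (f has_derivative frechet_derivative f (at x)) (at x)"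
  by (simp add: frechet_derivative_works)

lemma Ck_on_const: "open S \<Longrightarrow> Ck_on k S (\<lambda>x. c)"
  by (induction k arbitrary: c) auto

lemma Ck_on_add:
  assumes "open S" "Ck_on k S f" "Ck_on k S g"
  shows "Ck_on k S (\<lambda>x. f x + g x)"
  using assms(2,3)
proof (induction k arbitrary: f g)
  case 0
  then show ?case by (simp add: continuous_intros)
next
  case (Suc k)
  show ?case
  proof (rule Ck_on_SucI[OF assms(1)])
    show "((\<lambda>x. f x + g x) has_derivative
        (\<lambda>v. frechet_derivative f (at x) v + frechet_derivative g (at x) v)) (at x)" if "x \<in> S" for x
      by (intro has_derivative_add Ck_on_has_derivative) (use Suc that in auto)
    show "Ck_on k S (\<lambda>x. frechet_derivative f (at x) v + frechet_derivative g (at x) v)" for v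
      using Suc by simp
  qed
qed

lemma Ck_on_sum:
  assumes "open S" "\<And>i. i \<in> I \<Longrightarrow> Ck_on k S (f i)"
  shows "Ck_on k S (\<lambda>x. \<Sum>i\<in>I. f i x)"
  using assms(2) by (induction I rule: infinite_finite_induct) (auto simp: Ck_on_const Ck_on_add assms(1))

lemma Ck_on_linear:
  assumes "open S" "bounded_linear L" "Ck_on k S f"
  shows "Ck_on k S (\<lambda>x. L (f x))"
  using assms(3)
proof (induction k arbitrary: f)
  case 0
  then show ?case using assms(2) by (simp add: bounded_linear.continuous_on)
next
  case (Suc k)
  show ?case
  proof (rule Ck_on_SucI[OF assms(1)])
    show "((\<lambda>x. L (f x)) has_derivative (\<lambda>v. L (frechet_derivative f (at x) v))) (at x)" if "x \<in> S" for x
      by (intro bounded_linear.has_derivative[OF assms(2)] Ck_on_has_derivative) (use Suc that in auto)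
    show "Ck_on k S (\<lambda>x. L (frechet_derivative f (at x) v))" for v
      using Suc by simp
  qed
qed

lemma Ck_on_bilinear:
  assumes "open S" "bounded_bilinear m" "Ck_on k S f" "Ck_on k S g"
  shows "Ck_on k S (\<lambda>x. m (f x) (g x))"
  using assms(3,4)
proof (induction k arbitrary: f g)
  case 0
  then show ?case using bounded_bilinear.continuous_on[OF assms(2)] by simp
next
  case (Suc k)
  show ?case
  proof (rule Ck_on_SucI[OF assms(1)])
    show "((\<lambda>x. m (f x) (g x)) has_derivative
       (\<lambda>v. m (f x) (frechet_derivative g (at x) v) + m (frechet_derivative f (at x) v) (g x))) (at x)"
      if "x \<in> S" for x
      by (intro bounded_bilinear.FDERIV[OF assms(2)] Ck_on_has_derivative) (use Suc that in auto)
    have "Ck_on k S f" "Ck_on k S g" using Suc.prems Ck_on_SucD by blast+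
    then show "Ck_on k S (\<lambda>x. m (f x) (frechet_derivative g (at x) v) +
        m (frechet_derivative f (at x) v) (g x))" for v
      using Suc by (intro Ck_on_add assms(1)) auto
  qed
qed

lemma Ck_on_inverse:
  fixes f :: "'a::euclidean_space \<Rightarrow> real"
  assumes "open S" "\<And>x. x \<in> S \<Longrightarrow> f x \<noteq> 0" "Ck_on k S f"
  shows "Ck_on k S (\<lambda>x. inverse (f x))"
  using assms(3)
proof (induction k)
  case 0
  then show ?case using assms(2) by (simp add: continuous_on_inverse)
next
  case (Suc k)
  show ?case
  proof (rule Ck_on_SucI[OF assms(1)])
    show "((\<lambda>x. inverse (f x)) has_derivative
       (\<lambda>v. - (inverse (f x) * frechet_derivative f (at x) v * inverse (f x)))) (at x)"
      if "x \<in> S" for x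
      by (intro Deriv.has_derivative_inverse Ck_on_has_derivative) (use Suc that assms(2) in auto)
    have i: "Ck_on k S (\<lambda>x. inverse (f x))" using Suc Ck_on_SucD by blast
    have d: "Ck_on k S (\<lambda>x. frechet_derivative f (at x) v)" for v using Suc by simp
    show "Ck_on k S (\<lambda>x. - (inverse (f x) * frechet_derivative f (at x) v * inverse (f x)))" for v
      by (intro Ck_on_linear[OF assms(1) bounded_linear_minus[OF bounded_linear_ident]]
        Ck_on_bilinear[OF assms(1) bounded_bilinear_mult] i d)
  qed
qed

lemma Ck_on_locally:
  assumes "open S" "\<And>x. x \<in> S \<Longrightarrow> \<exists>T. open T \<and> x \<in> T \<and> Ck_on k (S \<inter> T) f"
  shows "Ck_on k S f"
  using assms(2)
proof (induction k arbitrary: f)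
  case 0
  have "continuous (at x within S) f" if xS: "x \<in> S" for x
  proof -
    obtain T where T: "open T" "x \<in> T" "continuous_on (S \<inter> T) f" using 0 xS by auto
    with xS show ?thesis
      using assms(1) continuous_on_eq_continuous_at[of "S \<inter> T" f]
      by (auto intro: continuous_at_imp_continuous_at_within)
  qed
  then show ?case by (simp add: continuous_on_eq_continuous_within)
next
  case (Suc k)
  have "f differentiable at x" if "x \<in> S" for x using Suc.prems[OF that] that by auto
  moreover have "Ck_on k S (\<lambda>x. frechet_derivative f (at x) v)" for v
  proof (rule Suc.IH)
    fix x assume "x \<in> S"
    then obtain T where "open T \<and> x \<in> T \<and> Ck_on (Suc k) (S \<inter> T) f" using Suc.prems by blast
    then show "\<exists>T. open T \<and> x \<in> T \<and> Ck_on k (S \<inter> T) (\<lambda>x. frechet_derivative f (at x) v)" by auto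
  qed
  ultimately show ?case by simp
qed

lemma Ck_on_compose:
  fixes h :: "'a::euclidean_space \<Rightarrow> 'b::euclidean_space" and g :: "'b \<Rightarrow> 'c::real_normed_vector"
  assumes "open S" "open T" "h ` S \<subseteq> T" "Ck_on k T g" "Ck_on k S h"
  shows "Ck_on k S (\<lambda>x. g (h x))"
  using assms(4,5)
proof (induction k arbitrary: g)
  case 0
  then show ?case using assms(3) by (auto intro: continuous_on_compose2)
next
  case (Suc k)
  let ?h = "\<lambda>x v. frechet_derivative h (at x) v"
  let ?g = "\<lambda>y v. frechet_derivative g (at y) v"
  have h: "Ck_on k S h" using Suc.prems(2) by (rule Ck_on_SucD)
  show ?case
  proof (rule Ck_on_SucI[OF assms(1)])
    fix x assume x: "x \<in> S"
    have g': "(g has_derivative ?g (h x)) (at (h x))"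
      using Ck_on_has_derivative[OF Suc.prems(1)] x assms(3) by auto
    have d: "((\<lambda>x. g (h x)) has_derivative (\<lambda>v. ?g (h x) (?h x v))) (at x)"
      using has_derivative_compose[OF Ck_on_has_derivative[OF Suc.prems(2) x] g'] .
    \<comment> \<open>In the chain rule the outer derivative is taken in a direction that moves with
      \<open>x\<close>, whereas \<open>Ck_on\<close> speaks of fixed directions; hence the expansion
      in \<open>Basis\<close>.\<close>
    have e: "?g (h x) w = (\<Sum>b\<in>Basis. (w \<bullet> b) *\<^sub>R ?g (h x) b)" for w
      by (rule linear_Basis_sum[OF has_derivative_linear[OF g']])
    show "((\<lambda>x. g (h x)) has_derivative
        (\<lambda>v. \<Sum>b\<in>Basis. (?h x v \<bullet> b) *\<^sub>R ?g (h x) b)) (at x)"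
      by (rule has_derivative_eq_rhs[OF d]) (rule ext, rule e)
  next
    fix v
    show "Ck_on k S (\<lambda>x. \<Sum>b\<in>Basis. (?h x v \<bullet> b) *\<^sub>R ?g (h x) b)"
    proof (intro Ck_on_sum assms(1) Ck_on_bilinear[OF assms(1) bounded_bilinear_scaleR])
      fix b :: 'b
      show "Ck_on k S (\<lambda>x. ?h x v \<bullet> b)"
        by (rule Ck_on_linear[OF assms(1) bounded_linear_inner_left]) (use Suc.prems(2) in auto)
      show "Ck_on k S (\<lambda>x. ?g (h x) b)"
        using Suc.IH[of "\<lambda>y. ?g y b"] Suc.prems(1) h by auto
    qed
  qed
qed

lemma Ck_on_ident: "open S \<Longrightarrow> Ck_on k S (\<lambda>x. x)"
  by (induction k) (auto simp: Ck_on_const)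

text \<open>Differentiating under the integral sign produces a factor \<open>t\<close>, so the
  induction has to carry a power \<open>t ^ j\<close>; Hadamard's lemma takes
  \<open>j = 0\<close>.\<close>

lemma Ck_on_radial_integral:
  fixes g :: "'a::euclidean_space \<Rightarrow> real"
  assumes "\<And>k. Ck_on k (ball 0 r) g"
  shows "Ck_on k (ball 0 r) (\<lambda>x. integral {0..1} (\<lambda>t. t ^ j * g (t *\<^sub>R x)))"
  using assms
proof (induction k arbitrary: g j)
  have in_ball: "t *\<^sub>R x \<in> ball 0 r" if "x \<in> ball 0 r" "0 \<le> t" "t \<le> 1" for t and x :: 'a
  proof -
    have "norm (t *\<^sub>R x) \<le> 1 * norm x" using that by (simp add: mult_left_le_one_le)
    then show ?thesis using that by simp
  qed
  have cont: "continuous_on (ball 0 r \<times> cbox 0 1) (\<lambda>(x, t). t ^ j * g (t *\<^sub>R x))"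
    if "\<And>k. Ck_on k (ball 0 r) g" for g :: "'a \<Rightarrow> real" and j
  proof -
    have "continuous_on (ball 0 r) g" using that[of 0] by simp
    then have "continuous_on (ball 0 r \<times> cbox 0 (1::real)) (\<lambda>z. g (snd z *\<^sub>R fst z))"
      by (rule continuous_on_compose2) (use in_ball in \<open>auto intro!: continuous_intros\<close>)
    then show ?thesis by (auto simp: split_beta intro!: continuous_intros)
  qed
  {
    case 0
    show ?case
      using integral_continuous_on_param[OF cont[OF 0, of j]] by simp
  next
    case (Suc k)
    let ?g = "\<lambda>b y. frechet_derivative g (at y) b"
    \<comment> \<open>\<open>leibniz_rule\<close> takes the derivative as a bounded linear function
      depending continuously on \<open>x\<close> and \<open>t\<close>, so it is assembled from the
      functionals \<open>blinfun_inner_left b\<close>.\<close>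
    let ?D = "\<lambda>x t. \<Sum>b\<in>Basis. (t ^ Suc j * ?g b (t *\<^sub>R x)) *\<^sub>R blinfun_inner_left b"
    have g': "Ck_on k (ball 0 r) (?g b)" for b k using Suc.prems[of "Suc k"] by simp
    have int: "(\<lambda>t. t ^ j * g (t *\<^sub>R x)) integrable_on cbox 0 1"
      if "x \<in> ball 0 r" "\<And>k. Ck_on k (ball 0 r) g" for x j and g :: "'a \<Rightarrow> real"
    proof (rule integrable_continuous)
      show "continuous_on (cbox 0 1) (\<lambda>t. t ^ j * g (t *\<^sub>R x))"
        using continuous_on_compose2[OF cont[of g j], of "cbox 0 1" "\<lambda>t. (x, t)"] that
        by (simp add: continuous_intros image_subset_iff)
    qed
    have contD: "continuous_on (ball 0 r \<times> cbox 0 1) (\<lambda>(x, t). ?D x t)"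
    proof -
      have "continuous_on (ball 0 r \<times> cbox 0 1) (\<lambda>z. snd z ^ Suc j * ?g b (snd z *\<^sub>R fst z))" for b
        using cont[OF g', of "Suc j" b] by (simp add: split_beta)
      then show ?thesis unfolding split_beta
        by (intro continuous_on_sum continuous_on_scaleR continuous_on_const)
    qed
    show ?case
    proof (rule Ck_on_SucI)
      fix x :: 'a assume x: "x \<in> ball 0 r"
      have "((\<lambda>x. integral (cbox 0 1) (\<lambda>t. t ^ j * g (t *\<^sub>R x))) has_derivative
          integral (cbox 0 1) (?D x)) (at x within ball 0 r)"
      proof (rule leibniz_rule[OF _ _ contD x])
        show "(\<lambda>t. t ^ j * g (t *\<^sub>R x)) integrable_on cbox 0 1" if "x \<in> ball 0 r" for x
          using int that Suc.prems by blast
        fix x t assume xt: "x \<in> ball (0::'a) r" "t \<in> cbox 0 (1::real)"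
        then have tx: "t *\<^sub>R x \<in> ball 0 r" using in_ball by auto
        have dg: "(g has_derivative (\<lambda>v. ?g v (t *\<^sub>R x))) (at (t *\<^sub>R x))"
          using Ck_on_has_derivative[OF Suc.prems tx] .
        have lin: "linear (\<lambda>v. ?g v (t *\<^sub>R x))" using dg has_derivative_linear by blast
        have "((\<lambda>x. t ^ j * g (t *\<^sub>R x)) has_derivative (\<lambda>v. t ^ j * ?g (t *\<^sub>R v) (t *\<^sub>R x))) (at x within ball 0 r)"
          by (intro has_derivative_mult_right has_derivative_compose[where g = g and f = "\<lambda>x. t *\<^sub>R x", OF _ dg])
             (auto intro!: derivative_eq_intros)
        moreover have "(\<lambda>v. t ^ j * ?g (t *\<^sub>R v) (t *\<^sub>R x)) = blinfun_apply (?D x t)"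
        proof
          fix v
          have "?g v (t *\<^sub>R x) = (\<Sum>b\<in>Basis. (v \<bullet> b) * ?g b (t *\<^sub>R x))"
            using linear_Basis_sum[OF lin, of v] unfolding real_scaleR_def .
          then show "t ^ j * ?g (t *\<^sub>R v) (t *\<^sub>R x) = blinfun_apply (?D x t) v"
            by (simp add: linear_scale[OF lin] blinfun.sum_left blinfun.scaleR_left sum_distrib_left
                algebra_simps)
        qed
        ultimately show "((\<lambda>x. t ^ j * g (t *\<^sub>R x)) has_derivative blinfun_apply (?D x t)) (at x within ball 0 r)"
          by simp
      qed auto
      moreover have "blinfun_apply (integral (cbox 0 1) (?D x)) v =
          (\<Sum>b\<in>Basis. (v \<bullet> b) * integral (cbox 0 1) (\<lambda>t. t ^ Suc j * ?g b (t *\<^sub>R x)))" for v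
      proof -
        have Dint: "?D x integrable_on cbox 0 1"
          using continuous_on_compose2[OF contD, of "cbox 0 1" "\<lambda>t. (x, t)"] x
          by (intro integrable_continuous) (simp add: continuous_intros image_subset_iff)
        have "blinfun_apply (integral (cbox 0 1) (?D x)) v = integral (cbox 0 1) (\<lambda>t. blinfun_apply (?D x t) v)"
          using integral_linear[OF Dint, of "\<lambda>L. blinfun_apply L v"]
          by (simp add: o_def bounded_linear_blinfun_apply bounded_linear_ident
              blinfun.bounded_linear_left)
        also have "\<dots> = integral (cbox 0 1) (\<lambda>t. \<Sum>b\<in>Basis. (v \<bullet> b) * (t ^ Suc j * ?g b (t *\<^sub>R x)))"
          by (simp add: blinfun.sum_left blinfun.scaleR_left algebra_simps)
        also have "\<dots> = (\<Sum>b\<in>Basis. integral (cbox 0 1) (\<lambda>t. (v \<bullet> b) * (t ^ Suc j * ?g b (t *\<^sub>R x))))"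
          using int[OF x g', of "Suc j"] by (intro integral_sum integrable_on_mult_right) auto
        finally show ?thesis by simp
      qed
      ultimately show "((\<lambda>x. integral {0..1} (\<lambda>t. t ^ j * g (t *\<^sub>R x))) has_derivative
        (\<lambda>v. \<Sum>b\<in>Basis. (v \<bullet> b) * integral {0..1} (\<lambda>t. t ^ Suc j * ?g b (t *\<^sub>R x)))) (at x)"
        unfolding at_within_open[OF x open_ball] cbox_interval
        by (elim has_derivative_eq_rhs) (rule ext)
    next
      fix v :: 'a
      show "Ck_on k (ball 0 r) (\<lambda>x. \<Sum>b\<in>Basis. (v \<bullet> b) * integral {0..1} (\<lambda>t. t ^ Suc j * ?g b (t *\<^sub>R x)))"
        by (intro Ck_on_sum Ck_on_bilinear[OF _ bounded_bilinear_mult] Ck_on_const open_ball Suc.IH g')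
    qed simp
  }
qed

section \<open>Smooth functions on open sets and Hadamard's lemma\<close>

lemma smooth_on_cong: "open S \<Longrightarrow> (\<And>x. x \<in> S \<Longrightarrow> f x = g x) \<Longrightarrow> smooth_on S f \<Longrightarrow> smooth_on S g"
  unfolding smooth_on_def using Ck_on_cong by metis

lemma smooth_on_subset: "smooth_on S f \<Longrightarrow> T \<subseteq> S \<Longrightarrow> smooth_on T f"
  unfolding smooth_on_def using Ck_on_subset by metis

lemma smooth_on_locally:
  assumes "open S" "\<And>x. x \<in> S \<Longrightarrow> \<exists>T. open T \<and> x \<in> T \<and> smooth_on (S \<inter> T) f"
  shows "smooth_on S f"
  unfolding smooth_on_def
proof (intro allI Ck_on_locally[OF assms(1)])
  fix k x assume "x \<in> S"
  then show "\<exists>T. open T \<and> x \<in> T \<and> Ck_on k (S \<inter> T) f"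
    using assms(2)[of x] unfolding smooth_on_def by metis
qed

lemma smooth_on_compose:
  fixes h :: "'a::euclidean_space \<Rightarrow> 'b::euclidean_space" and g :: "'b \<Rightarrow> 'c::real_normed_vector"
  assumes "open S" "open T" "h ` S \<subseteq> T" "smooth_on T g" "smooth_on S h"
  shows "smooth_on S (\<lambda>x. g (h x))"
  using assms Ck_on_compose[of S T h _ g] unfolding smooth_on_def by blast

lemma smooth_on_deriv:
  "smooth_on S f \<Longrightarrow> smooth_on S (\<lambda>x. frechet_derivative f (at x) v)"
  unfolding smooth_on_def by (metis Ck_on.simps(2))

lemma smooth_on_has_derivative:
  "smooth_on S f \<Longrightarrow> x \<in> S \<Longrightarrow> (f has_derivative frechet_derivative f (at x)) (at x)"
  unfolding smooth_on_def using Ck_on_has_derivative by blast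

text \<open>Integrate the derivative of \<open>g (t *\<^sub>R x)\<close> over \<open>t\<close> from
  0 to 1: the coordinates \<open>x \<bullet> b\<close> leave the integral, and what remains is
  \<open>h b\<close>. It serves to show that a derivation sees a function only through its first
  partial derivatives.\<close>

lemma hadamard:
  fixes g :: "'a::euclidean_space \<Rightarrow> real"
  assumes g: "smooth_on (ball 0 r) g"
  obtains h where "\<And>b. smooth_on (ball 0 r) (h b)" "\<And>b. h b 0 = frechet_derivative g (at 0) b"
    "\<And>x. x \<in> ball 0 r \<Longrightarrow> g x = g 0 + (\<Sum>b\<in>Basis. (x \<bullet> b) * h b x)"
proof
  let ?g = "\<lambda>b y. frechet_derivative g (at y) b"
  let ?h = "\<lambda>b x. integral {0..1} (\<lambda>t. ?g b (t *\<^sub>R x))"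
  show "smooth_on (ball 0 r) (?h b)" for b
    using Ck_on_radial_integral[of r "?g b" _ 0] smooth_on_deriv[OF g, of b] by (simp add: smooth_on_def)
  show "?h b 0 = ?g b 0" for b by simp
  fix x :: 'a assume x: "x \<in> ball 0 r"
  have in_ball: "t *\<^sub>R x \<in> ball 0 r" if "0 \<le> t" "t \<le> 1" for t
  proof -
    have "norm (t *\<^sub>R x) \<le> 1 * norm x" using that by (simp add: mult_left_le_one_le)
    then show ?thesis using x by simp
  qed
  have int: "(\<lambda>t. (x \<bullet> b) * ?g b (t *\<^sub>R x)) integrable_on {0..1}" for b
  proof (intro integrable_on_mult_right integrable_continuous_interval)
    have "continuous_on (ball 0 r) (?g b)"
      using smooth_on_deriv[OF g, of b] unfolding smooth_on_def by (metis Ck_on.simps(1))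
    then show "continuous_on {0..1} (\<lambda>t. ?g b (t *\<^sub>R x))"
      by (rule continuous_on_compose2) (use in_ball in \<open>auto intro!: continuous_intros\<close>)
  qed
  have "((\<lambda>t. \<Sum>b\<in>Basis. (x \<bullet> b) * ?g b (t *\<^sub>R x)) has_integral g (1 *\<^sub>R x) - g (0 *\<^sub>R x)) {0..1}"
  proof (rule fundamental_theorem_of_calculus)
    fix t :: real assume t: "t \<in> {0..1}"
    have dg: "(g has_derivative (\<lambda>v. ?g v (t *\<^sub>R x))) (at (t *\<^sub>R x))"
      using smooth_on_has_derivative[OF g] in_ball t by auto
    have lin: "linear (\<lambda>v. ?g v (t *\<^sub>R x))" using dg has_derivative_linear by blast
    have A: "((\<lambda>t. g (t *\<^sub>R x)) has_derivative (\<lambda>s. ?g (s *\<^sub>R x) (t *\<^sub>R x))) (at t within {0..1})"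
      by (rule has_derivative_compose[where g = g and f = "\<lambda>t. t *\<^sub>R x", OF _ dg]) (auto intro!: derivative_eq_intros)
    have B: "?g x (t *\<^sub>R x) = (\<Sum>b\<in>Basis. (x \<bullet> b) * ?g b (t *\<^sub>R x))"
      using linear_Basis_sum[OF lin, of x] unfolding real_scaleR_def .
    show "((\<lambda>t. g (t *\<^sub>R x)) has_vector_derivative (\<Sum>b\<in>Basis. (x \<bullet> b) * ?g b (t *\<^sub>R x)))
        (at t within {0..1})"
      unfolding has_vector_derivative_def B[symmetric] using A unfolding linear_scale[OF lin] .
  qed simp
  from integral_unique[OF this] have "g x - g 0 = integral {0..1} (\<lambda>t. \<Sum>b\<in>Basis. (x \<bullet> b) * ?g b (t *\<^sub>R x))"
    by (simp only: scaleR_one scaleR_zero_left)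
  also have "\<dots> = (\<Sum>b\<in>Basis. integral {0..1} (\<lambda>t. (x \<bullet> b) * ?g b (t *\<^sub>R x)))"
    by (intro integral_sum int) auto
  finally show "g x = g 0 + (\<Sum>b\<in>Basis. (x \<bullet> b) * ?h b x)" by simp
qed

section \<open>Smooth functions, tangent vectors and vector fields on a manifold\<close>

lemma smooth_on_bilinear:
  "open S \<Longrightarrow> bounded_bilinear m \<Longrightarrow> smooth_on S f \<Longrightarrow> smooth_on S g \<Longrightarrow> smooth_on S (\<lambda>x. m (f x) (g x))"
  unfolding smooth_on_def using Ck_on_bilinear by metis

lemma smooth_on_linear:
  "open S \<Longrightarrow> bounded_linear L \<Longrightarrow> smooth_on S f \<Longrightarrow> smooth_on S (\<lambda>x. L (f x))"
  unfolding smooth_on_def using Ck_on_linear by metis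

lemma smooth_on_add:
  "open S \<Longrightarrow> smooth_on S f \<Longrightarrow> smooth_on S g \<Longrightarrow> smooth_on S (\<lambda>x. f x + g x)"
  unfolding smooth_on_def using Ck_on_add by metis

lemma smooth_on_sum:
  "open S \<Longrightarrow> (\<And>i. i \<in> I \<Longrightarrow> smooth_on S (f i)) \<Longrightarrow> smooth_on S (\<lambda>x. \<Sum>i\<in>I. f i x)"
  unfolding smooth_on_def using Ck_on_sum by metis

lemma smooth_on_inverse:
  "open S \<Longrightarrow> (\<And>x. x \<in> S \<Longrightarrow> f x \<noteq> 0) \<Longrightarrow> smooth_on S f \<Longrightarrow> smooth_on S (\<lambda>x. inverse (f x :: real))"
  unfolding smooth_on_def using Ck_on_inverse by metis

lemma smooth_on_const: "open S \<Longrightarrow> smooth_on S (\<lambda>x. c)"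
  unfolding smooth_on_def using Ck_on_const by metis

lemma smooth_on_ident: "open S \<Longrightarrow> smooth_on S (\<lambda>x. x)"
  unfolding smooth_on_def using Ck_on_ident by metis

text \<open>The functions \<open>t^(-j) exp (-1/t)\<close>, extended by 0, are closed under
  differentiation up to linear combinations, so one induction over the order proves all of them
  smooth at once.\<close>

lemma smooth_bump_real:
  obtains \<beta> :: "real \<Rightarrow> real"
  where "smooth_on UNIV \<beta>" "\<And>t. t \<le> 0 \<Longrightarrow> \<beta> t = 0" "\<And>t. t > 0 \<Longrightarrow> \<beta> t > 0"
proof -
  define b :: "nat \<Rightarrow> real \<Rightarrow> real" where
    "b j t = (if t > 0 then inverse t ^ j * exp (- inverse t) else 0)" for j t
  have deriv: "(b j has_real_derivative b (j + 2) t - real j * b (j + 1) t) (at t)" for j t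
  proof -
    consider "t > 0" | "t < 0" | "t = 0" by linarith
    then show ?thesis
    proof cases
      case 1
      have "((\<lambda>t. inverse t ^ j * exp (- inverse t)) has_real_derivative
          b (j + 2) t - real j * b (j + 1) t) (at t)"
      proof -
        have i: "(inverse has_real_derivative - (inverse t * inverse t)) (at t)"
          using DERIV_inverse[of t UNIV] 1 by (simp add: power2_eq_square)
        have p: "((\<lambda>t. inverse t ^ j) has_real_derivative - (real j * inverse t ^ (j + 1))) (at t)"
          using DERIV_power[OF i, of j] by (cases j) (simp_all add: algebra_simps)
        have e: "((\<lambda>t. exp (- inverse t)) has_real_derivative exp (- inverse t) * (inverse t * inverse t)) (at t)"
          using DERIV_fun_exp[OF DERIV_minus[OF i]] by simp
        show ?thesis
          using DERIV_mult[OF p e] 1 by (simp add: b_def algebra_simps)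
      qed
      then show ?thesis
        by (rule DERIV_cong_ev[THEN iffD1, rotated -1])
           (use 1 eventually_nhds_in_open[of "{0<..}" t] in \<open>auto simp: b_def elim!: eventually_mono\<close>)
    next
      case 2
      have "((\<lambda>t. 0) has_real_derivative b (j + 2) t - real j * b (j + 1) t) (at t)"
        using 2 by (simp add: b_def)
      then show ?thesis
        by (rule DERIV_cong_ev[THEN iffD1, rotated -1])
           (use 2 eventually_nhds_in_open[of "{..<0}" t] in \<open>auto simp: b_def elim!: eventually_mono\<close>)
    next
      case 3
      have "((\<lambda>t. inverse t ^ Suc j / exp (inverse t)) \<longlongrightarrow> (0::real)) (at_right 0)"
        using filterlim_compose[OF tendsto_power_div_exp_0[of "Suc j"] filterlim_inverse_at_top_right] .
      then have "(b (Suc j) \<longlongrightarrow> 0) (at_right 0)"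
        by (rule tendsto_cong[THEN iffD1, rotated])
           (auto simp: b_def exp_minus divide_inverse eventually_at_filter)
      moreover have "(b (Suc j) \<longlongrightarrow> 0) (at_left 0)"
        by (rule tendsto_cong[THEN iffD1, rotated, OF tendsto_const])
           (auto simp: b_def eventually_at_filter)
      ultimately have "(b (Suc j) \<longlongrightarrow> 0) (at 0)" using filterlim_split_at by blast
      \<comment> \<open>The difference quotient at 0 is again a member of the family, and its limit
        has just been found.\<close>
      moreover have "(b j y - b j 0) / (y - 0) = b (Suc j) y" for y
        by (simp add: b_def field_simps)
      ultimately have "((\<lambda>y. (b j y - b j 0) / (y - 0)) \<longlongrightarrow> 0) (at 0)" by simp
      then have "(b j has_real_derivative 0) (at 0)"
        unfolding has_field_derivative_iff by simp
      then show ?thesis using 3 by (simp add: b_def)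
    qed
  qed
  have "Ck_on k UNIV (b j)" for k j
  proof (induction k arbitrary: j)
    case 0
    show ?case using deriv by (auto intro!: continuous_at_imp_continuous_on DERIV_isCont)
  next
    case (Suc k)
    show ?case
    proof (rule Ck_on_SucI)
      show "(b j has_derivative (\<lambda>v. v * (b (j + 2) t + (- real j) * b (j + 1) t))) (at t)" for t
        using deriv[of j t] by (simp add: has_field_derivative_def mult_commute_abs)
      show "Ck_on k UNIV (\<lambda>t. v * (b (j + 2) t + (- real j) * b (j + 1) t))" for v
        by (intro Ck_on_bilinear[OF _ bounded_bilinear_mult] Ck_on_const Ck_on_add Suc open_UNIV)
    qed simp
  qed
  then have "smooth_on UNIV (b 0)" by (simp add: smooth_on_def)
  then show thesis by (rule that) (auto simp: b_def)
qed

text \<open>The Hausdorff property enters through bump functions: the compact preimage of a closed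
  coordinate ball has to be closed in the whole manifold.\<close>

locale smooth_manifold =
  fixes A :: "('s::t2_space, 'n::finite) chart set"
  assumes atlas: "smooth_atlas A"
begin

section \<open>Charts and smooth maps on the manifold\<close>

lemma chart_cover: obtains U \<phi> where "(U, \<phi>) \<in> A" "p \<in> U"
proof -
  have "p \<in> \<Union> (fst ` A)" using atlas unfolding smooth_atlas_def by simp
  then show thesis using that by auto
qed

lemma
  assumes "(U, \<phi>) \<in> A"
  shows open_chart: "open U"
    and homeo_chart: "homeomorphism U (\<phi> ` U) \<phi> (inv_into U \<phi>)"
    and open_chart_image: "open (\<phi> ` U)"
  using atlas assms unfolding smooth_atlas_def by fast+

lemma inj_chart: "(U, \<phi>) \<in> A \<Longrightarrow> inj_on \<phi> U"
  using homeo_chart unfolding homeomorphism_def by (metis inj_on_inverseI)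

lemma open_chart_image_Int:
  assumes "(U, \<phi>) \<in> A" "open S"
  shows "open (\<phi> ` (U \<inter> S))"
proof -
  have "openin (top_of_set (\<phi> ` U)) (\<phi> ` (U \<inter> S))"
    by (rule homeomorphism_imp_open_map[OF homeo_chart[OF assms(1)]]) (use assms(2) in auto)
  then show ?thesis using open_chart_image[OF assms(1)] openin_open_eq by auto
qed

lemma chart_transition:
  assumes "(U, \<phi>) \<in> A" "(V, \<psi>) \<in> A"
  shows "smooth_on (\<phi> ` (U \<inter> V)) (\<lambda>y. \<psi> (inv_into U \<phi> y))"
  using atlas assms unfolding smooth_atlas_def o_def by fast

lemma msmooth_onI:
  "(\<And>U \<phi>. (U, \<phi>) \<in> A \<Longrightarrow> smooth_on (\<phi> ` (U \<inter> S)) (\<lambda>y. F (inv_into U \<phi> y))) \<Longrightarrow> msmooth_on A S F"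
  unfolding msmooth_on_def o_def by auto

lemma msmooth_onD:
  "msmooth_on A S F \<Longrightarrow> (U, \<phi>) \<in> A \<Longrightarrow> smooth_on (\<phi> ` (U \<inter> S)) (\<lambda>y. F (inv_into U \<phi> y))"
  unfolding msmooth_on_def o_def by auto

lemma msmooth_on_subset: "msmooth_on A S F \<Longrightarrow> T \<subseteq> S \<Longrightarrow> msmooth_on A T F"
  by (rule msmooth_onI, rule smooth_on_subset[OF msmooth_onD]) auto

lemma msmooth_on_cong:
  assumes "open S" "\<And>x. x \<in> S \<Longrightarrow> F x = G x" "msmooth_on A S F"
  shows "msmooth_on A S G"
proof (rule msmooth_onI)
  fix U \<phi> assume c: "(U, \<phi>) \<in> A"
  show "smooth_on (\<phi> ` (U \<inter> S)) (\<lambda>y. G (inv_into U \<phi> y))"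
    by (rule smooth_on_cong[OF open_chart_image_Int[OF c assms(1)] _ msmooth_onD[OF assms(3) c]])
       (use inj_chart[OF c] assms(2) in auto)
qed

lemma msmooth_on_locally:
  assumes "open S" "\<And>p. p \<in> S \<Longrightarrow> \<exists>T. open T \<and> p \<in> T \<and> msmooth_on A (S \<inter> T) F"
  shows "msmooth_on A S F"
proof (rule msmooth_onI, rule smooth_on_locally)
  fix U \<phi> assume c: "(U, \<phi>) \<in> A"
  show "open (\<phi> ` (U \<inter> S))" by (rule open_chart_image_Int[OF c assms(1)])
  fix y assume "y \<in> \<phi> ` (U \<inter> S)"
  then obtain p where p: "p \<in> U" "p \<in> S" "y = \<phi> p" by auto
  then obtain T where T: "open T" "p \<in> T" "msmooth_on A (S \<inter> T) F" using assms(2) by blast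
  have "\<phi> ` (U \<inter> S) \<inter> \<phi> ` (U \<inter> T) = \<phi> ` (U \<inter> (S \<inter> T))"
    using inj_on_image_Int[OF inj_chart[OF c], of "U \<inter> S" "U \<inter> T"] by (simp add: Int_ac)
  then show "\<exists>T. open T \<and> y \<in> T \<and> smooth_on (\<phi> ` (U \<inter> S) \<inter> T) (\<lambda>y. F (inv_into U \<phi> y))"
    using msmooth_onD[OF T(3) c] open_chart_image_Int[OF c T(1)] p T(2) by fastforce
qed

lemma msmooth_on_const:
  assumes "open S"
  shows "msmooth_on A S (\<lambda>x. c)"
  by (rule msmooth_onI, rule smooth_on_const, rule open_chart_image_Int) (use assms in auto)

lemma msmooth_on_add:
  assumes "open S" "msmooth_on A S F" "msmooth_on A S G"
  shows "msmooth_on A S (\<lambda>x. F x + G x)"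
proof (rule msmooth_onI)
  fix U \<phi> assume c: "(U, \<phi>) \<in> A"
  show "smooth_on (\<phi> ` (U \<inter> S)) (\<lambda>y. F (inv_into U \<phi> y) + G (inv_into U \<phi> y))"
    by (rule smooth_on_add[OF open_chart_image_Int[OF c assms(1)] msmooth_onD[OF assms(2) c]
        msmooth_onD[OF assms(3) c]])
qed

lemma msmooth_on_sum:
  assumes "open S" "\<And>i. i \<in> I \<Longrightarrow> msmooth_on A S (F i)"
  shows "msmooth_on A S (\<lambda>x. \<Sum>i\<in>I. F i x)"
  using assms(2)
  by (induction I rule: infinite_finite_induct) (simp_all add: msmooth_on_const msmooth_on_add assms(1))

lemma msmooth_on_bilinear:
  assumes "open S" "bounded_bilinear m" "msmooth_on A S F" "msmooth_on A S G"
  shows "msmooth_on A S (\<lambda>x. m (F x) (G x))"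
proof (rule msmooth_onI)
  fix U \<phi> assume c: "(U, \<phi>) \<in> A"
  show "smooth_on (\<phi> ` (U \<inter> S)) (\<lambda>y. m (F (inv_into U \<phi> y)) (G (inv_into U \<phi> y)))"
    by (rule smooth_on_bilinear[OF open_chart_image_Int[OF c assms(1)] assms(2) msmooth_onD[OF assms(3) c]
        msmooth_onD[OF assms(4) c]])
qed

lemma msmooth_on_linear:
  assumes "open S" "bounded_linear L" "msmooth_on A S F"
  shows "msmooth_on A S (\<lambda>x. L (F x))"
proof (rule msmooth_onI)
  fix U \<phi> assume c: "(U, \<phi>) \<in> A"
  show "smooth_on (\<phi> ` (U \<inter> S)) (\<lambda>y. L (F (inv_into U \<phi> y)))"
    by (rule smooth_on_linear[OF open_chart_image_Int[OF c assms(1)] assms(2) msmooth_onD[OF assms(3) c]])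
qed

lemma msmooth_on_inverse:
  assumes "open S" "\<And>x. x \<in> S \<Longrightarrow> F x \<noteq> 0" "msmooth_on A S F"
  shows "msmooth_on A S (\<lambda>x. inverse (F x :: real))"
proof (rule msmooth_onI)
  fix U \<phi> assume c: "(U, \<phi>) \<in> A"
  show "smooth_on (\<phi> ` (U \<inter> S)) (\<lambda>y. inverse (F (inv_into U \<phi> y)))"
    by (rule smooth_on_inverse[OF open_chart_image_Int[OF c assms(1)] _ msmooth_onD[OF assms(3) c]])
       (use inj_chart[OF c] assms(2) in auto)
qed

lemma msmooth_on_mult:
  "open S \<Longrightarrow> msmooth_on A S F \<Longrightarrow> msmooth_on A S G \<Longrightarrow> msmooth_on A S (\<lambda>x. F x * G x :: real)"
  by (rule msmooth_on_bilinear[OF _ bounded_bilinear_mult])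

lemma msmooth_on_scaleR:
  "open S \<Longrightarrow> msmooth_on A S F \<Longrightarrow> msmooth_on A S G \<Longrightarrow> msmooth_on A S (\<lambda>x. F x *\<^sub>R G x)"
  by (rule msmooth_on_bilinear[OF _ bounded_bilinear_scaleR])

lemma msmooth_on_diff:
  assumes "open S" "msmooth_on A S F" "msmooth_on A S G"
  shows "msmooth_on A S (\<lambda>x. F x - G x)"
  using msmooth_on_add[OF assms(1,2) msmooth_on_linear[OF assms(1) bounded_linear_minus[OF bounded_linear_ident] assms(3)]]
  by simp

lemma msmooth_on_inner_left:
  "open S \<Longrightarrow> msmooth_on A S F \<Longrightarrow> msmooth_on A S (\<lambda>x. F x \<bullet> b)"
  by (rule msmooth_on_linear[OF _ bounded_linear_inner_left])

text \<open>Endomorphism fields are tested on constant vectors only; the basis expansion of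
  \<open>\<sigma> x\<close> passes to sections.\<close>

lemma msmooth_on_apply:
  fixes T :: "'s \<Rightarrow> 'v::euclidean_space \<Rightarrow> 'w::real_normed_vector"
  assumes S: "open S" and lin: "\<And>x. linear (T x)" and T: "\<And>u. msmooth_on A S (\<lambda>x. T x u)"
    and \<sigma>: "msmooth_on A S \<sigma>"
  shows "msmooth_on A S (\<lambda>x. T x (\<sigma> x))"
proof -
  have "msmooth_on A S (\<lambda>x. \<Sum>b\<in>Basis. (\<sigma> x \<bullet> b) *\<^sub>R T x b)"
    by (intro msmooth_on_sum msmooth_on_scaleR msmooth_on_inner_left S T \<sigma>)
  moreover have "(\<lambda>x. \<Sum>b\<in>Basis. (\<sigma> x \<bullet> b) *\<^sub>R T x b) = (\<lambda>x. T x (\<sigma> x))"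
    by (rule ext, rule linear_Basis_sum[OF lin, symmetric])
  ultimately show ?thesis by simp
qed

lemma msmooth_on_chart_compose:
  assumes c: "(U, \<phi>) \<in> A" and S: "open S" "S \<subseteq> U" and T: "open T" "\<phi> ` S \<subseteq> T" "smooth_on T g"
  shows "msmooth_on A S (\<lambda>x. g (\<phi> x))"
proof (rule msmooth_onI)
  fix V \<psi> assume d: "(V, \<psi>) \<in> A"
  show "smooth_on (\<psi> ` (V \<inter> S)) (\<lambda>y. g (\<phi> (inv_into V \<psi> y)))"
  proof (rule smooth_on_compose[OF open_chart_image_Int[OF d S(1)] T(1) _ T(3)])
    show "(\<lambda>y. \<phi> (inv_into V \<psi> y)) ` \<psi> ` (V \<inter> S) \<subseteq> T"
      using T(2) inj_chart[OF d] by auto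
    show "smooth_on (\<psi> ` (V \<inter> S)) (\<lambda>y. \<phi> (inv_into V \<psi> y))"
      by (rule smooth_on_subset[OF chart_transition[OF d c]]) (use S in auto)
  qed
qed

section \<open>Derivations, vector fields and the flat connection \<open>d\<close>\<close>

lemma
  assumes "v \<in> tangent_space A p" "msmooth A g" "msmooth A h"
  shows tangent_lincomb: "v (\<lambda>x. a * g x + b * h x) = a * v g + b * v h"
    and tangent_mult: "v (\<lambda>x. g x * h x) = v g * h p + g p * v h"
  using assms unfolding tangent_space_def by blast+

lemma tangent_add:
  "v \<in> tangent_space A p \<Longrightarrow> msmooth A g \<Longrightarrow> msmooth A h \<Longrightarrow> v (\<lambda>x. g x + h x) = v g + v h"
  using tangent_lincomb[of v p g h 1 1] by simp

lemma tangent_cmult: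
  "v \<in> tangent_space A p \<Longrightarrow> msmooth A g \<Longrightarrow> v (\<lambda>x. c * g x) = c * v g"
  using tangent_lincomb[of v p g g c 0] by simp

lemma tangent_const:
  assumes "v \<in> tangent_space A p"
  shows "v (\<lambda>x. c) = 0"
proof -
  have s: "msmooth A (\<lambda>x. 1::real)" by (rule msmooth_on_const) simp
  have "v (\<lambda>x. 1) = 0" using tangent_mult[OF assms s s] by simp
  then show ?thesis using tangent_cmult[OF assms s, of c] by simp
qed

lemma tangent_sum:
  assumes v: "v \<in> tangent_space A p" and "\<And>i. i \<in> I \<Longrightarrow> msmooth A (g i)"
  shows "v (\<lambda>x. \<Sum>i\<in>I. g i x) = (\<Sum>i\<in>I. v (g i))"
  using assms(2)
proof (induction I rule: infinite_finite_induct)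
  case (insert i I)
  then have "v (\<lambda>x. g i x + (\<Sum>i\<in>I. g i x)) = v (g i) + v (\<lambda>x. \<Sum>i\<in>I. g i x)"
    by (intro tangent_add[OF v] msmooth_on_sum) auto
  with insert show ?case by simp
qed (simp_all add: tangent_const[OF v])

lemma dir_const: "v \<in> tangent_space A p \<Longrightarrow> dir v (\<lambda>x. c) = 0"
  by (simp add: dir_def tangent_const)

lemma dir_inner:
  "b \<in> Basis \<Longrightarrow> dir v \<sigma> \<bullet> b = v (\<lambda>x. \<sigma> x \<bullet> b)"
  by (simp add: dir_def)

lemma dir_linear:
  fixes \<sigma> :: "'s \<Rightarrow> 'v::euclidean_space" and L :: "'v \<Rightarrow> 'w::euclidean_space"
  assumes v: "v \<in> tangent_space A p" and "linear L" and \<sigma>: "msmooth A \<sigma>"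
  shows "dir v (\<lambda>x. L (\<sigma> x)) = L (dir v \<sigma>)"
proof (rule euclidean_eqI)
  fix b :: 'w assume b: "b \<in> Basis"
  have "dir v (\<lambda>x. L (\<sigma> x)) \<bullet> b = v (\<lambda>x. \<Sum>c\<in>Basis. (L c \<bullet> b) * (\<sigma> x \<bullet> c))"
    by (subst linear_Basis_sum[OF \<open>linear L\<close>])
       (simp add: dir_inner[OF b] inner_sum_left mult.commute)
  also have "\<dots> = (\<Sum>c\<in>Basis. v (\<lambda>x. (L c \<bullet> b) * (\<sigma> x \<bullet> c)))"
    by (intro tangent_sum[OF v] msmooth_on_mult msmooth_on_const msmooth_on_inner_left \<sigma> open_UNIV)
  also have "\<dots> = (\<Sum>c\<in>Basis. (L c \<bullet> b) * (dir v \<sigma> \<bullet> c))"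
    by (intro sum.cong refl) (simp add: tangent_cmult[OF v] msmooth_on_inner_left \<sigma> dir_inner)
  also have "\<dots> = L (dir v \<sigma>) \<bullet> b"
    by (subst linear_Basis_sum[OF \<open>linear L\<close>]) (simp add: inner_sum_left mult.commute)
  finally show "dir v (\<lambda>x. L (\<sigma> x)) \<bullet> b = L (dir v \<sigma>) \<bullet> b" .
qed

lemma dir_add:
  assumes v: "v \<in> tangent_space A p" and \<sigma>: "msmooth A \<sigma>" and \<tau>: "msmooth A \<tau>"
  shows "dir v (\<lambda>x. \<sigma> x + \<tau> x) = dir v \<sigma> + dir v \<tau>"
proof (rule euclidean_eqI)
  fix b :: 'a assume b: "b \<in> Basis"
  show "dir v (\<lambda>x. \<sigma> x + \<tau> x) \<bullet> b = (dir v \<sigma> + dir v \<tau>) \<bullet> b"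
    using tangent_add[OF v msmooth_on_inner_left[OF _ \<sigma>] msmooth_on_inner_left[OF _ \<tau>], of b b]
    by (simp add: dir_inner[OF b] inner_add_left)
qed

lemma dir_diff:
  assumes v: "v \<in> tangent_space A p" and \<sigma>: "msmooth A \<sigma>" and \<tau>: "msmooth A \<tau>"
  shows "dir v (\<lambda>x. \<sigma> x - \<tau> x) = dir v \<sigma> - dir v \<tau>"
proof (rule euclidean_eqI)
  fix b :: 'a assume b: "b \<in> Basis"
  show "dir v (\<lambda>x. \<sigma> x - \<tau> x) \<bullet> b = (dir v \<sigma> - dir v \<tau>) \<bullet> b"
    using tangent_lincomb[OF v msmooth_on_inner_left[OF _ \<sigma>] msmooth_on_inner_left[OF _ \<tau>], of 1 b "-1" b]
    by (simp add: dir_inner[OF b] inner_diff_left)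
qed

text \<open>The Leibniz rule, with the derivative of \<open>T\<close> evaluated on the constant
  vector \<open>\<sigma> p\<close>. In this form the derivative of an endomorphism field is handled
  through constant vectors alone.\<close>

lemma dir_apply:
  fixes T :: "'s \<Rightarrow> 'v::euclidean_space \<Rightarrow> 'w::euclidean_space"
  assumes v: "v \<in> tangent_space A p" and lin: "\<And>x. linear (T x)" and T: "\<And>u. msmooth A (\<lambda>x. T x u)"
    and \<sigma>: "msmooth A \<sigma>"
  shows "dir v (\<lambda>x. T x (\<sigma> x)) = dir v (\<lambda>x. T x (\<sigma> p)) + T p (dir v \<sigma>)"
proof (rule euclidean_eqI)
  fix b :: 'w assume b: "b \<in> Basis"
  have sum: "T x u \<bullet> b = (\<Sum>c\<in>Basis. (u \<bullet> c) * (T x c \<bullet> b))" for x u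
    by (subst linear_Basis_sum[OF lin]) (simp add: inner_sum_left)
  have "dir v (\<lambda>x. T x (\<sigma> x)) \<bullet> b = v (\<lambda>x. \<Sum>c\<in>Basis. (\<sigma> x \<bullet> c) * (T x c \<bullet> b))"
    unfolding dir_inner[OF b] sum[of x "\<sigma> x" for x] ..
  also have "\<dots> = (\<Sum>c\<in>Basis. v (\<lambda>x. (\<sigma> x \<bullet> c) * (T x c \<bullet> b)))"
    by (intro tangent_sum[OF v] msmooth_on_mult msmooth_on_inner_left \<sigma> T open_UNIV)
  also have "\<dots> = (\<Sum>c\<in>Basis. (dir v \<sigma> \<bullet> c) * (T p c \<bullet> b) + (\<sigma> p \<bullet> c) * v (\<lambda>x. T x c \<bullet> b))"
    by (intro sum.cong refl) (simp add: tangent_mult[OF v] msmooth_on_inner_left \<sigma> T dir_inner)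
  also have "\<dots> = T p (dir v \<sigma>) \<bullet> b + (\<Sum>c\<in>Basis. (\<sigma> p \<bullet> c) * v (\<lambda>x. T x c \<bullet> b))"
    by (simp only: sum.distrib sum[of p "dir v \<sigma>"])
  also have "(\<Sum>c\<in>Basis. (\<sigma> p \<bullet> c) * v (\<lambda>x. T x c \<bullet> b)) =
      (\<Sum>c\<in>Basis. v (\<lambda>x. (\<sigma> p \<bullet> c) * (T x c \<bullet> b)))"
    by (intro sum.cong refl) (simp add: tangent_cmult[OF v] msmooth_on_inner_left T)
  also have "\<dots> = v (\<lambda>x. \<Sum>c\<in>Basis. (\<sigma> p \<bullet> c) * (T x c \<bullet> b))"
    by (intro tangent_sum[OF v, symmetric] msmooth_on_mult msmooth_on_const msmooth_on_inner_left T open_UNIV)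
  also have "\<dots> = dir v (\<lambda>x. T x (\<sigma> p)) \<bullet> b"
    unfolding dir_inner[OF b] sum[of x "\<sigma> p" for x] ..
  finally show "dir v (\<lambda>x. T x (\<sigma> x)) \<bullet> b = (dir v (\<lambda>x. T x (\<sigma> p)) + T p (dir v \<sigma>)) \<bullet> b"
    by (simp add: inner_add_left)
qed

lemma vector_field_tangent: "vector_field A X \<Longrightarrow> X p \<in> tangent_space A p"
  unfolding vector_field_def by blast

lemma vector_field_smooth: "vector_field A X \<Longrightarrow> msmooth A g \<Longrightarrow> msmooth A (\<lambda>p. X p g)"
  unfolding vector_field_def by blast

lemma msmooth_dir:
  assumes X: "vector_field A X" and \<sigma>: "msmooth A \<sigma>"
  shows "msmooth A (\<lambda>p. dir (X p) \<sigma>)"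
  unfolding dir_def
proof (rule msmooth_on_sum[OF open_UNIV])
  fix b
  show "msmooth A (\<lambda>p. X p (\<lambda>x. \<sigma> x \<bullet> b) *\<^sub>R b)"
    by (rule msmooth_on_scaleR[OF open_UNIV vector_field_smooth[OF X msmooth_on_inner_left[OF open_UNIV \<sigma>]]
        msmooth_on_const[OF open_UNIV]])
qed

lemma lie_bracket_tangent:
  assumes X: "vector_field A X" and Y: "vector_field A Y"
  shows "lie_bracket A X Y p \<in> tangent_space A p"
proof -
  have lincomb: "msmooth A (\<lambda>x. a * g x + b * h x)" if "msmooth A g" "msmooth A h"
    for a b :: real and g h
    by (intro msmooth_on_add msmooth_on_mult msmooth_on_const that open_UNIV)
  note Xp = vector_field_tangent[OF X] and Yp = vector_field_tangent[OF Y]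
  have mult: "msmooth A (\<lambda>x. g x * h x)" if "msmooth A g" "msmooth A h" for g h :: "'s \<Rightarrow> real"
    by (intro msmooth_on_mult that open_UNIV)
  \<comment> \<open>The mixed terms are symmetric under exchanging \<open>X\<close> and
    \<open>Y\<close>, so they cancel in the bracket.\<close>
  have XY: "X p (\<lambda>x. Y x (\<lambda>y. g y * h y)) =
      X p (\<lambda>x. Y x g) * h p + Y p g * X p h + (X p g * Y p h + g p * X p (\<lambda>x. Y x h))"
    if g: "msmooth A g" and h: "msmooth A h" and X: "vector_field A X" and Y: "vector_field A Y" for g h X Y
  proof -
    note Xp = vector_field_tangent[OF X] and Yp = vector_field_tangent[OF Y]
    show ?thesis
      unfolding tangent_mult[OF Yp g h]
      by (subst tangent_add[OF Xp mult[OF vector_field_smooth[OF Y g] h] mult[OF g vector_field_smooth[OF Y h]]])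
         (simp add: tangent_mult[OF Xp] vector_field_smooth[OF Y] g h)
  qed
  show ?thesis
    unfolding tangent_space_def mem_Collect_eq
  proof (intro conjI allI impI)
    fix g h :: "'s \<Rightarrow> real" and a b :: real assume g: "msmooth A g" and h: "msmooth A h"
    show "lie_bracket A X Y p (\<lambda>x. a * g x + b * h x) = a * lie_bracket A X Y p g + b * lie_bracket A X Y p h"
      unfolding lie_bracket_def
      by (simp add: lincomb g h tangent_lincomb[OF Xp] tangent_lincomb[OF Yp] vector_field_smooth[OF X]
          vector_field_smooth[OF Y] algebra_simps)
    show "lie_bracket A X Y p (\<lambda>x. g x * h x) = lie_bracket A X Y p g * h p + g p * lie_bracket A X Y p h"
      unfolding lie_bracket_def
      by (simp add: mult g h XY[OF g h X Y] XY[OF g h Y X] algebra_simps)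
  qed (simp add: lie_bracket_def)
qed

text \<open>The flatness of \<open>d\<close>: the bracket is the commutator of the two derivations,
  read in each component. Second derivatives in curvatures and exterior derivatives cancel through
  this identity.\<close>

lemma dir_lie_bracket:
  assumes X: "vector_field A X" and Y: "vector_field A Y" and \<sigma>: "msmooth A \<sigma>"
  shows "dir (X p) (\<lambda>x. dir (Y x) \<sigma>) - dir (Y p) (\<lambda>x. dir (X x) \<sigma>) = dir (lie_bracket A X Y p) \<sigma>"
  by (rule euclidean_eqI)
     (simp add: dir_inner inner_diff_left lie_bracket_def msmooth_on_inner_left \<sigma>)

text \<open>A cut-off by a bump function turns a smooth function of the coordinates near \<open>p\<close> into a
  global smooth function.\<close>

lemma cutoff:
  obtains U \<phi> r \<rho> where "(U, \<phi>) \<in> A" "p \<in> U" "r > 0" "ball (\<phi> p) r \<subseteq> \<phi> ` U"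
    "msmooth A \<rho>" "\<rho> p \<noteq> 0"
    "\<And>x. x \<notin> U \<or> \<phi> x \<notin> ball (\<phi> p) r \<Longrightarrow> \<rho> x = 0"
    "\<And>g :: real ^ 'n \<Rightarrow> real. smooth_on (ball 0 r) g \<Longrightarrow> msmooth A (\<lambda>x. \<rho> x * g (\<phi> x - \<phi> p))"
proof -
  obtain U \<phi> where c: "(U, \<phi>) \<in> A" and p: "p \<in> U" using chart_cover .
  obtain r where r: "r > 0" "ball (\<phi> p) r \<subseteq> \<phi> ` U"
    using open_chart_image[OF c] p by (meson imageI openE)
  obtain \<beta> :: "real \<Rightarrow> real" where \<beta>: "smooth_on UNIV \<beta>" "\<And>t. t \<le> 0 \<Longrightarrow> \<beta> t = 0" "\<And>t. t > 0 \<Longrightarrow> \<beta> t > 0"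
    using smooth_bump_real by metis
  \<comment> \<open>The argument of \<open>\<beta>\<close> is positive exactly within radius
    \<open>r / 2\<close>. The margin up to \<open>r\<close> keeps the compact set \<open>K\<close>
    inside the open ball on which \<open>g\<close> is smooth, and the squared norm is smooth at the
    centre.\<close>
  define \<rho> where "\<rho> x = (if x \<in> U then \<beta> (r\<^sup>2 / 4 - (\<phi> x - \<phi> p) \<bullet> (\<phi> x - \<phi> p)) else 0)" for x
  define K where "K = inv_into U \<phi> ` cball (\<phi> p) (r / 2)"
  have sub: "cball (\<phi> p) (r / 2) \<subseteq> ball (\<phi> p) r" using r(1) by auto
  have "compact K" unfolding K_def
  proof (rule compact_continuous_image)
    show "continuous_on (cball (\<phi> p) (r / 2)) (inv_into U \<phi>)"
      using homeo_chart[OF c] sub r(2) unfolding homeomorphism_def by (meson continuous_on_subset order_trans)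
  qed simp
  then have openK: "open (- K)" using compact_imp_closed by blast
  have zero: "\<rho> x = 0" if "x \<notin> K" for x
  proof (cases "x \<in> U")
    case True
    then have "inv_into U \<phi> (\<phi> x) = x" using inj_chart[OF c] by simp
    then have "\<phi> x \<notin> cball (\<phi> p) (r / 2)" using that unfolding K_def by (metis imageI)
    then have "(r / 2)\<^sup>2 \<le> (norm (\<phi> x - \<phi> p))\<^sup>2"
      using r(1) by (intro power_mono) (auto simp: dist_norm norm_minus_commute)
    then show ?thesis
      using True \<beta>(2) unfolding \<rho>_def by (simp add: power2_norm_eq_inner power_divide)
  qed (simp add: \<rho>_def)
  have KU: "x \<in> U \<and> \<phi> x \<in> ball (\<phi> p) r" if "x \<in> K" for x
    using that sub r(2) unfolding K_def
    by (smt (verit, best) f_inv_into_f image_iff inv_into_into subsetD)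
  define D where "D = {x \<in> U. \<phi> x \<in> ball (\<phi> p) r}"
  have "D = inv_into U \<phi> ` ball (\<phi> p) r"
    using inj_chart[OF c] r(2) unfolding D_def by (auto simp: image_iff f_inv_into_f inv_into_into subset_iff) (metis inv_into_f_f mem_ball)
  moreover have "openin (top_of_set U) (inv_into U \<phi> ` ball (\<phi> p) r)"
    by (rule homeomorphism_imp_open_map[OF homeomorphism_symD[OF homeo_chart[OF c]]]) (use r(2) in \<open>auto simp: openin_open_eq open_chart_image[OF c]\<close>)
  ultimately have openD: "open D" using open_chart[OF c] openin_open_eq by auto
  have cut: "msmooth A (\<lambda>x. \<rho> x * g (\<phi> x - \<phi> p))" if g: "smooth_on (ball 0 r) g" for g
  proof (rule msmooth_on_locally)
    fix x :: 's
    let ?h = "\<lambda>y. \<beta> (r\<^sup>2 / 4 - (y - \<phi> p) \<bullet> (y - \<phi> p)) * g (y - \<phi> p)"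
    show "\<exists>T. open T \<and> x \<in> T \<and> msmooth_on A (UNIV \<inter> T) (\<lambda>x. \<rho> x * g (\<phi> x - \<phi> p))"
    proof (cases "x \<in> K")
      case True
      have sm: "smooth_on S (\<lambda>y. y - \<phi> p)" if "open S" for S
        using smooth_on_add[OF that smooth_on_ident[OF that] smooth_on_const[OF that, of "- \<phi> p"]] by simp
      have i: "smooth_on (ball (\<phi> p) r) (\<lambda>y. r\<^sup>2 / 4 + - ((y - \<phi> p) \<bullet> (y - \<phi> p)))"
        by (intro smooth_on_add smooth_on_const smooth_on_linear[OF _ bounded_linear_minus[OF bounded_linear_ident]]
            smooth_on_bilinear[OF _ bounded_bilinear_inner] sm open_ball)
      have "smooth_on (ball (\<phi> p) r) ?h"
        using i
        by (intro smooth_on_bilinear[OF _ bounded_bilinear_mult] smooth_on_compose[OF _ _ _ \<beta>(1)]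
            smooth_on_compose[OF _ _ _ g] sm open_ball open_UNIV) (auto simp: dist_norm norm_minus_commute)
      then have "msmooth_on A D (\<lambda>x. ?h (\<phi> x))"
        by (intro msmooth_on_chart_compose[OF c openD, where T = "ball (\<phi> p) r"]) (auto simp: D_def)
      then have "msmooth_on A D (\<lambda>x. \<rho> x * g (\<phi> x - \<phi> p))"
        by (rule msmooth_on_cong[OF openD, rotated]) (auto simp: \<rho>_def D_def)
      then show ?thesis using openD KU[OF True] unfolding D_def by auto
    next
      case False
      have "msmooth_on A (- K) (\<lambda>x. \<rho> x * g (\<phi> x - \<phi> p))"
        by (rule msmooth_on_cong[OF openK _ msmooth_on_const[OF openK, of 0]]) (use zero in auto)
      then show ?thesis using openK False by auto
    qed
  qed simp
  show thesis
  proof (rule that[OF c p r _ _ _ cut])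
    show "msmooth A \<rho>" using cut[OF smooth_on_const[of _ 1]] by simp
    show "\<rho> p \<noteq> 0" using \<beta>(3)[of "r\<^sup>2 / 4"] r(1) p by (simp add: \<rho>_def)
    show "\<rho> x = 0" if "x \<notin> U \<or> \<phi> x \<notin> ball (\<phi> p) r" for x using zero KU that by blast
  qed
qed

text \<open>By Hadamard's lemma \<open>v\<close> acts as a combination of partial derivatives at
  \<open>p\<close>, with coefficients \<open>a b\<close>. The field keeps these coefficients
  constant in the chart and is cut off by \<open>\<rho> q / \<rho> p\<close>.\<close>

theorem tangent_extends_to_vector_field:
  assumes v: "v \<in> tangent_space A p"
  obtains X where "vector_field A X" "X p = v"
proof -
  obtain U \<phi> r \<rho> where c: "(U, \<phi>) \<in> A" and p: "p \<in> U" and r: "r > 0" "ball (\<phi> p) r \<subseteq> \<phi> ` U"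
    and \<rho>: "msmooth A \<rho>" "\<rho> p \<noteq> 0" "\<And>x. x \<notin> U \<or> \<phi> x \<notin> ball (\<phi> p) r \<Longrightarrow> \<rho> x = 0"
    and cut: "\<And>g :: real ^ 'n \<Rightarrow> real. smooth_on (ball 0 r) g \<Longrightarrow> msmooth A (\<lambda>x. \<rho> x * g (\<phi> x - \<phi> p))"
    by (rule cutoff[of p]) (rule that)
  define loc where "loc G y = G (inv_into U \<phi> (\<phi> p + y))" for G :: "'s \<Rightarrow> real" and y
  have loc: "smooth_on (ball 0 r) (loc G)" if "msmooth A G" for G
    unfolding loc_def
  proof (rule smooth_on_compose[OF open_ball open_chart_image[OF c], where h = "\<lambda>y. \<phi> p + y"])
    show "smooth_on (\<phi> ` U) (\<lambda>y. G (inv_into U \<phi> y))" using msmooth_onD[OF that c] by simp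
    show "smooth_on (ball 0 r) (\<lambda>y. \<phi> p + y)" by (intro smooth_on_add smooth_on_const smooth_on_ident open_ball)
    show "(+) (\<phi> p) ` ball 0 r \<subseteq> \<phi> ` U" using r(2) by (auto simp: ball_translation[of "\<phi> p" 0, simplified])
  qed
  have loc_at: "loc G (\<phi> x - \<phi> p) = G x" if "x \<in> U" for G x
    unfolding loc_def using inj_chart[OF c] that by simp
  define a where "a b = v (\<lambda>x. \<rho> x * ((\<phi> x - \<phi> p) \<bullet> b)) / \<rho> p" for b
  define d where "d G y = (\<Sum>b\<in>Basis. a b * frechet_derivative (loc G) (at y) b)" for G y
  have vG: "v G = d G 0" if G: "msmooth A G" for G
  proof -
    obtain h where h: "\<And>b. smooth_on (ball 0 r) (h b)" "\<And>b. h b 0 = frechet_derivative (loc G) (at 0) b"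
      "\<And>y. y \<in> ball 0 r \<Longrightarrow> loc G y = loc G 0 + (\<Sum>b\<in>Basis. (y \<bullet> b) * h b y)"
      by (rule hadamard[OF loc[OF G]]) (rule that)
    let ?y = "\<lambda>b x. \<rho> x * ((\<phi> x - \<phi> p) \<bullet> b)" and ?h = "\<lambda>b x. \<rho> x * h b (\<phi> x - \<phi> p)"
    have y: "msmooth A (?y b)" for b
      by (rule cut) (intro smooth_on_linear[OF _ bounded_linear_inner_left] smooth_on_ident open_ball)
    have hs: "msmooth A (?h b)" for b by (rule cut[OF h(1)])
    \<comment> \<open>Both the coordinate and the function \<open>h b\<close> are only local; each
      absorbs one factor \<open>\<rho>\<close> to become a smooth function on the manifold.\<close>
    have "\<rho> x * \<rho> x * (G x + - G p) = (\<Sum>b\<in>Basis. ?y b x * ?h b x)" for x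
    proof (cases "x \<in> U \<and> \<phi> x \<in> ball (\<phi> p) r")
      case True
      then have "\<phi> x - \<phi> p \<in> ball 0 r" by (auto simp: dist_norm norm_minus_commute)
      from h(3)[OF this] have "G x + - G p = (\<Sum>b\<in>Basis. ((\<phi> x - \<phi> p) \<bullet> b) * h b (\<phi> x - \<phi> p))"
        using True loc_at[of x G] loc_at[of p G] p by simp
      then show ?thesis by (simp add: sum_distrib_left mult_ac)
    qed (use \<rho>(3) in auto)
    then have eq: "(\<lambda>x. \<rho> x * \<rho> x * (G x + - G p)) = (\<lambda>x. \<Sum>b\<in>Basis. ?y b x * ?h b x)" by (rule ext)
    have Gp: "msmooth A (\<lambda>x. G x + - G p)"
      by (intro msmooth_on_add G msmooth_on_const open_UNIV)
    have "\<rho> p * \<rho> p * v G = v (\<lambda>x. \<rho> x * \<rho> x * (G x + - G p))"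
      unfolding tangent_mult[OF v msmooth_on_mult[OF open_UNIV \<rho>(1) \<rho>(1)] Gp]
        tangent_add[OF v G msmooth_on_const[OF open_UNIV]] tangent_const[OF v] by simp
    also have "\<dots> = (\<Sum>b\<in>Basis. v (\<lambda>x. ?y b x * ?h b x))"
      unfolding eq by (intro tangent_sum[OF v] msmooth_on_mult y hs open_UNIV)
    also have "\<dots> = (\<Sum>b\<in>Basis. v (?y b) * ?h b p + ?y b p * v (?h b))"
      by (simp only: tangent_mult[OF v y hs])
    also have "\<dots> = \<rho> p * \<rho> p * d G 0"
      unfolding d_def a_def sum_distrib_left using \<rho>(2) by (intro sum.cong refl) (simp add: h(2))
    finally show ?thesis using \<rho>(2) by simp
  qed
  define X where "X q G = (if msmooth A G then \<rho> q / \<rho> p * d G (\<phi> q - \<phi> p) else 0)" for q G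
  have "vector_field A X" unfolding vector_field_def
  proof (intro conjI allI impI)
    fix q
    show "X q \<in> tangent_space A q"
    proof (cases "q \<in> U \<and> \<phi> q \<in> ball (\<phi> p) r")
      case False
      then have "X q = (\<lambda>G. 0)" using \<rho>(3) by (auto simp: X_def)
      then show ?thesis by (simp add: tangent_space_def)
    next
      case True
      then have q: "\<phi> q - \<phi> p \<in> ball 0 r" by (auto simp: dist_norm norm_minus_commute)
      show ?thesis unfolding tangent_space_def mem_Collect_eq
      proof (intro conjI allI impI)
        fix g h :: "'s \<Rightarrow> real" and s t :: real assume g: "msmooth A g" and h: "msmooth A h"
        let ?D = "\<lambda>G. frechet_derivative (loc G) (at (\<phi> q - \<phi> p))"
        note dg = smooth_on_has_derivative[OF loc[OF g] q]
          and dh = smooth_on_has_derivative[OF loc[OF h] q]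
        have sum: "msmooth A (\<lambda>x. s * g x + t * h x)"
          by (intro msmooth_on_add msmooth_on_mult msmooth_on_const g h open_UNIV)
        have mult: "msmooth A (\<lambda>x. g x * h x)" by (intro msmooth_on_mult g h open_UNIV)
        have l1: "loc (\<lambda>x. s * g x + t * h x) = (\<lambda>y. s * loc g y + t * loc h y)"
          and l2: "loc (\<lambda>x. g x * h x) = (\<lambda>y. loc g y * loc h y)"
          by (auto simp: loc_def)
        have "?D (\<lambda>x. s * g x + t * h x) = (\<lambda>b. s * ?D g b + t * ?D h b)"
          unfolding l1
          by (rule frechet_derivative_at[symmetric]) (intro has_derivative_add has_derivative_mult_right dg dh)
        then have d1: "d (\<lambda>x. s * g x + t * h x) (\<phi> q - \<phi> p) = s * d g (\<phi> q - \<phi> p) + t * d h (\<phi> q - \<phi> p)"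
          by (simp add: d_def sum_distrib_left sum.distrib algebra_simps)
        have "?D (\<lambda>x. g x * h x) = (\<lambda>b. g q * ?D h b + ?D g b * h q)"
          unfolding l2 using frechet_derivative_at[OF has_derivative_mult[OF dg dh]]
          by (simp add: loc_at True)
        then have d2: "d (\<lambda>x. g x * h x) (\<phi> q - \<phi> p) = d g (\<phi> q - \<phi> p) * h q + g q * d h (\<phi> q - \<phi> p)"
          by (simp add: d_def sum_distrib_left sum_distrib_right sum.distrib algebra_simps)
        show "X q (\<lambda>x. s * g x + t * h x) = s * X q g + t * X q h"
          using sum g h by (simp add: X_def d1 algebra_simps)
        show "X q (\<lambda>x. g x * h x) = X q g * h q + g q * X q h"
          using mult g h by (simp add: X_def d2 algebra_simps)
      qed (simp add: X_def)
    qed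
  next
    fix G :: "'s \<Rightarrow> real" assume G: "msmooth A G"
    have "msmooth A (\<lambda>q. \<rho> q * (inverse (\<rho> p) * d G (\<phi> q - \<phi> p)))"
      unfolding d_def
      by (rule cut[where g = "\<lambda>y. inverse (\<rho> p) * (\<Sum>b\<in>Basis. a b * frechet_derivative (loc G) (at y) b)"])
         (intro smooth_on_bilinear[OF _ bounded_bilinear_mult] smooth_on_const smooth_on_sum smooth_on_deriv
          loc G open_ball)
    then show "msmooth A (\<lambda>q. X q G)" using G by (simp add: X_def divide_inverse mult.assoc)
  qed
  moreover have "X p = v"
  proof
    fix G
    show "X p G = v G"
    proof (cases "msmooth A G")
      case True
      then show ?thesis using vG \<rho>(2) by (simp add: X_def)
    next
      case False
      then have "v G = 0" using v unfolding tangent_space_def by blast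
      then show ?thesis using False by (simp add: X_def)
    qed
  qed
  ultimately show thesis using that by blast
qed

end

section \<open>Indefinite inner products\<close>

text \<open>\<open>trace_on\<close> picks its basis by choice. Expanding through two bases gives one
  double sum that can be read in either order. \<open>L\<close> stands in for \<open>T\<close> on
  \<open>S\<close> because a map such as the one in \<open>quad_diff\<close>, with a section picked
  by choice, has no evident linearity.\<close>

lemma trace_on_eq:
  assumes b: "independent b" "span b = S" and L: "linear L" "\<And>u. u \<in> S \<Longrightarrow> L u \<in> S"
    and T: "\<And>u. u \<in> S \<Longrightarrow> T u = L u"
  shows "trace_on S T = (\<Sum>u\<in>b. representation b (L u) u)"
proof -
  define c where "c = (SOME b. independent b \<and> span b = S)"
  have c: "independent c" "span c = S"
    using someI[of "\<lambda>b. independent b \<and> span b = S" b] b unfolding c_def by auto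
  have fin: "finite b" "finite c" using b(1) c(1) independent_imp_finite by auto
  have inS: "w \<in> S" if "w \<in> b \<or> w \<in> c" for w using that b c span_base by blast
  have expand: "representation b (L u) w = (\<Sum>z\<in>c. representation c (L u) z * representation b z w)"
    if "u \<in> S" for u w
  proof -
    have "L u = (\<Sum>z\<in>c. representation c (L u) z *\<^sub>R z)"
      using sum_representation_eq[OF c(1) _ fin(2) order_refl, of "L u"] L(2)[OF that] c(2) by simp
    then have "representation b (L u) w = representation b (\<Sum>z\<in>c. representation c (L u) z *\<^sub>R z) w" by simp
    also have "\<dots> = (\<Sum>z\<in>c. representation b (representation c (L u) z *\<^sub>R z) w)"
      using b inS by (subst representation_sum) (auto intro: span_scale)
    also have "\<dots> = (\<Sum>z\<in>c. representation c (L u) z * representation b z w)"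
      using b inS by (intro sum.cong refl) (simp add: representation_scale)
    finally show ?thesis .
  qed
  have expand': "(\<Sum>u\<in>b. representation b z u * representation c (L u) z) = representation c (L z) z"
    if z: "z \<in> c" for z
  proof -
    have "L z = L (\<Sum>u\<in>b. representation b z u *\<^sub>R u)"
      using sum_representation_eq[OF b(1) _ fin(1) order_refl, of z] inS z b(2) by simp
    also have "\<dots> = (\<Sum>u\<in>b. representation b z u *\<^sub>R L u)"
      by (simp add: linear_sum[OF L(1)] linear_scale[OF L(1)])
    finally have "representation c (L z) z = representation c (\<Sum>u\<in>b. representation b z u *\<^sub>R L u) z" by simp
    also have "\<dots> = (\<Sum>u\<in>b. representation c (representation b z u *\<^sub>R L u) z)"
      using c inS L(2) by (subst representation_sum) (auto intro: span_scale)
    also have "\<dots> = (\<Sum>u\<in>b. representation b z u * representation c (L u) z)"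
      using c inS L(2) by (intro sum.cong refl) (simp add: representation_scale)
    finally show ?thesis by simp
  qed
  have "(\<Sum>u\<in>b. representation b (L u) u) =
      (\<Sum>u\<in>b. \<Sum>z\<in>c. representation b z u * representation c (L u) z)"
    using expand inS by (intro sum.cong refl) (simp add: mult.commute)
  also have "\<dots> = (\<Sum>z\<in>c. representation c (L z) z)"
    by (subst sum.swap) (simp add: expand')
  also have "\<dots> = trace_on S T"
    unfolding trace_on_def Let_def c_def[symmetric] using T inS by simp
  finally show ?thesis ..
qed

locale sym_form =
  fixes B :: "'v::euclidean_space \<Rightarrow> 'v \<Rightarrow> real"
  assumes bilin: "bilinear B" and sym: "B x y = B y x"
begin

lemma B_simps [simp]:
  "B (x + y) z = B x z + B y z" "B z (x + y) = B z x + B z y"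
  "B (x - y) z = B x z - B y z" "B z (x - y) = B z x - B z y"
  "B (c *\<^sub>R x) z = c * B x z" "B z (c *\<^sub>R x) = c * B z x"
  "B 0 z = 0" "B z 0 = 0" "B (- x) z = - B x z" "B z (- x) = - B z x"
  using bilin by (simp_all add: bilinear_ladd bilinear_radd bilinear_lsub bilinear_rsub bilinear_lmul
      bilinear_rmul bilinear_lzero bilinear_rzero bilinear_lneg bilinear_rneg)

lemma bounded_bilinear_B: "bounded_bilinear B"
  using bilin bilinear_conv_bounded_bilinear by blast

lemma linear_B: "linear (\<lambda>x. B x z)"
  by (rule linearI) simp_all

lemma subspace_perp: "subspace (perp B S)"
  by (rule subspaceI) (auto simp: perp_def)

lemma perpD: "x \<in> perp B S \<Longrightarrow> y \<in> S \<Longrightarrow> B x y = 0"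
  by (simp add: perp_def)

lemma has_signature_nondegenerate:
  assumes "has_signature B S p q" "x \<in> S" "\<And>y. y \<in> S \<Longrightarrow> B x y = 0"
  shows "x = 0"
proof -
  obtain P N where PN: "subspace P" "subspace N" "S = sum_space P N"
    "\<And>x. x \<in> P \<Longrightarrow> x \<noteq> 0 \<Longrightarrow> B x x > 0" "\<And>x. x \<in> N \<Longrightarrow> x \<noteq> 0 \<Longrightarrow> B x x < 0"
    "\<And>x y. x \<in> P \<Longrightarrow> y \<in> N \<Longrightarrow> B x y = 0"
    using assms(1) unfolding has_signature_def by metis
  obtain a n where x: "x = a + n" "a \<in> P" "n \<in> N" using assms(2) PN(3) by (auto simp: sum_space_def)
  have "a \<in> S" unfolding PN(3) sum_space_def using x(2) subspace_0[OF PN(2)] by force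
  moreover have "n \<in> S" unfolding PN(3) sum_space_def using x(3) subspace_0[OF PN(1)] by force
  ultimately have "B x a = 0" "B x n = 0" using assms(3) by auto
  then have "B a a = 0" "B n n = 0" using x PN(6)[OF x(2,3)] by (simp_all add: sym[of n a])
  then have "a = 0" "n = 0" using PN(4)[OF x(2)] PN(5)[OF x(3)] by force+
  then show ?thesis using x by simp
qed

lemma linear_wedge: "linear (wedge B a b)"
  by (rule linearI) (simp_all add: wedge_def algebra_simps)

lemma linear_wedge_sum: "linear (\<lambda>c. \<Sum>i\<in>I. wedge B (a i) (b i) c)"
  by (rule linear_compose_sum) (auto simp: linear_wedge)

lemma B_sum_left: "B (\<Sum>i\<in>I. h i) z = (\<Sum>i\<in>I. B (h i) z)"
  by (rule linear_sum[OF linear_B])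

lemma B_sum_right: "B z (\<Sum>i\<in>I. h i) = (\<Sum>i\<in>I. B z (h i))"
  using B_sum_left[of h I z] by (simp add: sym)

lemma wedge_span_skew:
  assumes "\<eta> \<in> wedge_span B S T"
  shows "B (\<eta> x) y = - B x (\<eta> y)"
  using assms unfolding wedge_span_def
  by (auto simp: B_sum_left B_sum_right wedge_def sum_negf[symmetric] sym algebra_simps intro!: sum.cong)

lemma wedge_span_linear: "\<eta> \<in> wedge_span B S T \<Longrightarrow> linear \<eta>"
  unfolding wedge_span_def using linear_wedge_sum by auto

lemma wedge_span_perp:
  assumes "\<eta> \<in> wedge_span B S (perp B S)" "subspace S" "x \<in> perp B S"
  shows "\<eta> x \<in> S"
proof -
  obtain k :: nat and a b where \<eta>: "\<eta> = (\<lambda>c. \<Sum>i<k. wedge B (a i) (b i) c)"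
    and ab: "\<And>i. i < k \<Longrightarrow> a i \<in> S \<and> b i \<in> perp B S"
    using assms(1) unfolding wedge_span_def by blast
  have "wedge B (a i) (b i) x \<in> S" if "i < k" for i
    using ab[OF that] assms(2,3) by (auto simp: wedge_def sym[of "a i"] perpD subspace_neg subspace_scale)
  then show ?thesis unfolding \<eta> by (intro subspace_sum[OF assms(2)]) auto
qed

lemma wedge_span_annihilates:
  assumes "\<eta> \<in> wedge_span B S (perp B S)" "null_space B S" "x \<in> S"
  shows "\<eta> x = 0"
proof -
  obtain k :: nat and a b where \<eta>: "\<eta> = (\<lambda>c. \<Sum>i<k. wedge B (a i) (b i) c)"
    and ab: "\<And>i. i < k \<Longrightarrow> a i \<in> S \<and> b i \<in> perp B S"
    using assms(1) unfolding wedge_span_def by blast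
  have "wedge B (a i) (b i) x = 0" if "i < k" for i
    using ab[OF that] assms(2,3) perpD[of "b i" S x] unfolding wedge_def null_space_def by simp
  then show ?thesis unfolding \<eta> by simp
qed

lemma wedge_span_in:
  assumes "\<tau> \<in> wedge_span B S S" "subspace S"
  shows "\<tau> x \<in> S"
proof -
  obtain k :: nat and a b where \<tau>: "\<tau> = (\<lambda>c. \<Sum>i<k. wedge B (a i) (b i) c)"
    and ab: "\<And>i. i < k \<Longrightarrow> a i \<in> S \<and> b i \<in> S"
    using assms(1) unfolding wedge_span_def by blast
  have "wedge B (a i) (b i) x \<in> S" if "i < k" for i
    using ab[OF that] assms(2) by (simp add: wedge_def subspace_diff subspace_scale)
  then show ?thesis unfolding \<tau> by (intro subspace_sum[OF assms(2)]) auto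
qed

end

section \<open>Line subbundles and the projections onto them\<close>

lemma sum_space_commute: "sum_space S T = sum_space T S"
  unfolding sum_space_def by (metis add.commute)

lemma subspace_sum_space: "subspace S \<Longrightarrow> subspace T \<Longrightarrow> subspace (sum_space S T)"
  unfolding sum_space_def by (rule subspace_sums)

lemma dim_one_span:
  fixes S :: "'a::euclidean_space set"
  assumes "subspace S" "dim S = 1" "a \<in> S" "a \<noteq> 0"
  shows "S = span {a}"
  using assms by (intro subspace_dim_equal[symmetric]) (auto simp: span_minimal dim_singleton)

lemma dim_one_nonzero:
  fixes S :: "'a::euclidean_space set"
  assumes "dim S = 1"
  obtains a where "a \<in> S" "a \<noteq> 0"
proof -
  have "\<not> S \<subseteq> {0}" using assms dim_eq_0[of S] by simp
  then show thesis using that by auto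
qed

text \<open>The projection onto the line \<open>E\<close> with kernel \<open>F\<^sup>\<bottom>\<close>; it does not depend on the chosen vectors.\<close>

definition lproj :: "('v::euclidean_space \<Rightarrow> 'v \<Rightarrow> real) \<Rightarrow> 'v set \<Rightarrow> 'v set \<Rightarrow> 'v \<Rightarrow> 'v" where
  "lproj B E F u = (let a = (SOME a. a \<in> E \<and> a \<noteq> 0); b = (SOME b. b \<in> F \<and> b \<noteq> 0) in
     (B u b / B a b) *\<^sub>R a)"

lemma (in sym_form) lproj_span:
  assumes "E = span {a}" "F = span {b}" "a \<noteq> 0" "b \<noteq> 0"
  shows "lproj B E F u = (B u b / B a b) *\<^sub>R a"
proof -
  define a' where "a' = (SOME a. a \<in> E \<and> a \<noteq> 0)"
  define b' where "b' = (SOME b. b \<in> F \<and> b \<noteq> 0)"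
  have "a' \<in> E \<and> a' \<noteq> 0" unfolding a'_def by (rule someI[of _ a]) (use assms in \<open>auto intro: span_base\<close>)
  then obtain s where s: "a' = s *\<^sub>R a" "s \<noteq> 0" using assms(1) by (auto simp: span_singleton)
  have "b' \<in> F \<and> b' \<noteq> 0" unfolding b'_def by (rule someI[of _ b]) (use assms in \<open>auto intro: span_base\<close>)
  then obtain t where t: "b' = t *\<^sub>R b" "t \<noteq> 0" using assms(2) by (auto simp: span_singleton)
  have "lproj B E F u = (B u b' / B a' b') *\<^sub>R a'"
    unfolding lproj_def Let_def a'_def b'_def ..
  then show ?thesis using s t by simp
qed

locale form_manifold = smooth_manifold A + sym_form B
  for A :: "('s::t2_space, 'n::finite) chart set" and B :: "'v::euclidean_space \<Rightarrow> 'v \<Rightarrow> real"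
begin

lemma line_subbundle_local:
  assumes "subbundle A 1 E"
  obtains U s where "open U" "p \<in> U" "msmooth_on A U s" "\<And>x. x \<in> U \<Longrightarrow> E x = span {s x}"
    "\<And>x. x \<in> U \<Longrightarrow> s x \<noteq> 0"
proof -
  obtain U s where U: "open U" "p \<in> U" "\<forall>i<1. msmooth_on A U (s i)"
    "\<forall>x\<in>U. E x = span ((\<lambda>i. s i x) ` {..<1::nat})"
    using assms unfolding subbundle_def by metis
  have E: "E x = span {s 0 x}" if "x \<in> U" for x
    using U(4) that by (simp add: lessThan_Suc)
  have "s 0 x \<noteq> 0" if "x \<in> U" for x
  proof
    assume "s 0 x = 0"
    then have "dim (E x) = 0" using E[OF that] by simp
    then show False using assms unfolding subbundle_def by simp
  qed
  then show thesis using that[of U "s 0"] U E by simp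
qed

text \<open>As \<open>lproj\<close> does not depend on the vectors picked in the two lines, smooth
  local spanning sections may take their place near each point.\<close>

lemma msmooth_lproj:
  assumes E: "subbundle A 1 E" and F: "subbundle A 1 F"
    and pair: "\<And>x a b. a \<in> E x \<Longrightarrow> b \<in> F x \<Longrightarrow> a \<noteq> 0 \<Longrightarrow> b \<noteq> 0 \<Longrightarrow> B a b \<noteq> 0"
  shows "msmooth A (\<lambda>x. lproj B (E x) (F x) u)"
proof (rule msmooth_on_locally)
  fix p
  obtain U s where U: "open U" "p \<in> U" "msmooth_on A U s" "\<And>x. x \<in> U \<Longrightarrow> E x = span {s x}"
    "\<And>x. x \<in> U \<Longrightarrow> s x \<noteq> 0" by (rule line_subbundle_local[OF E, of p]) (rule that)
  obtain V t where V: "open V" "p \<in> V" "msmooth_on A V t" "\<And>x. x \<in> V \<Longrightarrow> F x = span {t x}"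
    "\<And>x. x \<in> V \<Longrightarrow> t x \<noteq> 0" by (rule line_subbundle_local[OF F, of p]) (rule that)
  have UV: "open (U \<inter> V)" using U V by auto
  have s: "msmooth_on A (U \<inter> V) s" and t: "msmooth_on A (U \<inter> V) t"
    using msmooth_on_subset U(3) V(3) by blast+
  have nz: "B (s x) (t x) \<noteq> 0" if "x \<in> U \<inter> V" for x
    by (rule pair[of _ x]) (use that U V in \<open>auto intro: span_base\<close>)
  have "msmooth_on A (U \<inter> V) (\<lambda>x. (B u (t x) * inverse (B (s x) (t x))) *\<^sub>R s x)"
    by (intro msmooth_on_scaleR msmooth_on_mult msmooth_on_inverse nz UV s t
        msmooth_on_bilinear[OF UV bounded_bilinear_B] msmooth_on_const)
  then have "msmooth_on A (U \<inter> V) (\<lambda>x. lproj B (E x) (F x) u)"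
    by (rule msmooth_on_cong[OF UV, rotated]) (use U V lproj_span in \<open>auto simp: divide_inverse\<close>)
  then show "\<exists>T. open T \<and> p \<in> T \<and> msmooth_on A (UNIV \<inter> T) (\<lambda>x. lproj B (E x) (F x) u)"
    using UV U(2) V(2) by auto
qed simp

text \<open>The section is the Euclidean orthogonal projection of the constant \<open>u\<close> onto
  the lines; \<open>B\<close> cannot provide it, since the lines for which it is wanted are
  null.\<close>

lemma line_subbundle_section:
  fixes E :: "'s \<Rightarrow> 'v set"
  assumes E: "subbundle A 1 E" and u: "u \<in> E p"
  obtains \<sigma> where "\<sigma> \<in> sections A E" "\<sigma> p = u"
proof -
  interpret euclid: form_manifold A "(\<bullet>) :: 'v \<Rightarrow> _"
    by unfold_locales (auto simp: inner_commute bilinear_def intro!: linearI simp: inner_add_left inner_add_right)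
  have pair: "a \<bullet> b \<noteq> 0" if "a \<in> E x" "b \<in> E x" "a \<noteq> 0" "b \<noteq> 0" for x a b
  proof -
    have "E x = span {a}" using E that unfolding subbundle_def by (intro dim_one_span) auto
    with that show ?thesis by (auto simp: span_singleton)
  qed
  have s: "msmooth A (\<lambda>x. lproj (\<bullet>) (E x) (E x) u)"
    by (rule euclid.msmooth_lproj[OF E E pair])
  have span: "\<exists>a. E x = span {a} \<and> a \<noteq> 0" for x
    using E dim_one_nonzero[of "E x"] dim_one_span[of "E x"] unfolding subbundle_def by metis
  have "lproj (\<bullet>) (E x) (E x) u \<in> E x" for x
    using span[of x] euclid.lproj_span[of "E x" _ "E x"] by (auto simp: span_singleton)
  moreover have "lproj (\<bullet>) (E p) (E p) u = u"
    using span[of p] euclid.lproj_span[of "E p" _ "E p"] u by (auto simp: span_singleton)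
  ultimately show thesis using that[of "\<lambda>x. lproj (\<bullet>) (E x) (E x) u"] s by (simp add: sections_def)
qed

end

section \<open>Projections of a Demoulin grid\<close>

text \<open>The projection onto \<open>f1\<close> along \<open>f2\<close> and \<open>W\<^sup>\<bottom>\<close>; \<open>g1\<close> and \<open>g2\<close> only provide the lines.\<close>

definition planeproj ::
  "('v::euclidean_space \<Rightarrow> 'v \<Rightarrow> real) \<Rightarrow> ('s \<Rightarrow> 'v set) \<Rightarrow> ('s \<Rightarrow> 'v set) \<Rightarrow> ('s \<Rightarrow> 'v set) \<Rightarrow>
     ('s \<Rightarrow> 'v set) \<Rightarrow> 's \<Rightarrow> 'v \<Rightarrow> 'v" where
  "planeproj B f1 f2 g1 g2 p u =
     lproj B (f1 p \<inter> g1 p) (f2 p \<inter> g2 p) u + lproj B (f1 p \<inter> g2 p) (f2 p \<inter> g1 p) u"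

locale grid = form_manifold A B
  for A :: "('s::t2_space, 'n::finite) chart set" and B :: "'v::euclidean_space \<Rightarrow> 'v \<Rightarrow> real" +
  fixes W f1 f2 g1 g2 :: "'s \<Rightarrow> 'v set"
  assumes nondeg: "(\<And>y. B x y = 0) \<Longrightarrow> x = 0"
    and nondeg_W: "x \<in> W p \<Longrightarrow> (\<And>y. y \<in> W p \<Longrightarrow> B x y = 0) \<Longrightarrow> x = 0"
    and subspace_W: "subspace (W p)"
    and planes: "{f1, f2, g1, g2} \<subseteq> parallel_null_planes A B W"
    and f12: "f1 p \<inter> f2 p = {0}" "sum_space (f1 p) (f2 p) = W p"
    and g12: "g1 p \<inter> g2 p = {0}" "sum_space (g1 p) (g2 p) = W p"
    and lines: "subbundle A 1 (\<lambda>p. f1 p \<inter> g1 p)" "subbundle A 1 (\<lambda>p. f1 p \<inter> g2 p)"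
      "subbundle A 1 (\<lambda>p. f2 p \<inter> g1 p)" "subbundle A 1 (\<lambda>p. f2 p \<inter> g2 p)"
begin

text \<open>Facts are proved for one plane or one corner of the grid; this symmetry and the two
  below carry them to the others.\<close>

lemma swap_f: "grid A B W f2 f1 g1 g2"
  by unfold_locales
     (use nondeg nondeg_W planes f12 g12 lines subspace_W in \<open>auto simp: Int_commute sum_space_commute\<close>)

lemma swap_g: "grid A B W f1 f2 g2 g1"
  by unfold_locales
     (use nondeg nondeg_W planes f12 g12 lines subspace_W in \<open>auto simp: Int_commute sum_space_commute\<close>)

lemma transpose: "grid A B W g1 g2 f1 f2"
  by unfold_locales
     (use nondeg nondeg_W planes f12 g12 lines subspace_W in \<open>auto simp: Int_commute sum_space_commute\<close>)

lemma
  shows subspace_f1: "subspace (f1 p)" and dim_f1: "dim (f1 p) = 2" and f1_W: "f1 p \<subseteq> W p"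
    and null_f1: "x \<in> f1 p \<Longrightarrow> y \<in> f1 p \<Longrightarrow> B x y = 0" and parallel_f1: "parallel A (DW B W) f1"
  using planes unfolding parallel_null_planes_def null_subbundle_def subbundle_def null_space_def by auto

lemma line_span:
  assumes "a \<in> f1 p \<inter> g1 p" "a \<noteq> 0"
  shows "f1 p \<inter> g1 p = span {a}"
  using lines(1) assms unfolding subbundle_def by (intro dim_one_span) auto

text \<open>The two lines meet only in 0 because \<open>g1\<close> and \<open>g2\<close> do, so by
  dimension they fill the plane.\<close>

lemma f1_decomp: "f1 p = sum_space (f1 p \<inter> g1 p) (f1 p \<inter> g2 p)"
proof -
  have s: "subspace (f1 p \<inter> g1 p)" "subspace (f1 p \<inter> g2 p)"
    and d: "dim (f1 p \<inter> g1 p) = 1" "dim (f1 p \<inter> g2 p) = 1"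
    using lines unfolding subbundle_def by auto
  have "(f1 p \<inter> g1 p) \<inter> (f1 p \<inter> g2 p) = {0}" using g12(1)[of p] subspace_0[OF subspace_f1] by auto
  then have "dim (sum_space (f1 p \<inter> g1 p) (f1 p \<inter> g2 p)) = 2"
    using dim_sums_Int[OF s] d unfolding sum_space_def by simp
  moreover have "sum_space (f1 p \<inter> g1 p) (f1 p \<inter> g2 p) \<subseteq> f1 p"
    using subspace_f1 by (auto simp: sum_space_def subspace_add)
  ultimately show ?thesis
    using dim_f1 by (intro subspace_dim_equal[symmetric] subspace_sum_space s subspace_f1) auto
qed

text \<open>\<open>a\<close> lies in the null planes \<open>f1\<close> and \<open>g1\<close>, hence
  is orthogonal to every corner except \<open>f2 p \<inter> g2 p\<close>; were it orthogonal to that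
  one too, it would be orthogonal to all of \<open>W p\<close>.\<close>

lemma line_pairing:
  assumes a: "a \<in> f1 p \<inter> g1 p" "a \<noteq> 0" and b: "b \<in> f2 p \<inter> g2 p" "b \<noteq> 0"
  shows "B a b \<noteq> 0"
proof
  assume 0: "B a b = 0"
  have "a = 0"
  proof (rule nondeg_W[of a p])
    show "a \<in> W p" using a f1_W by auto
    fix y assume "y \<in> W p"
    then obtain u w where y: "y = u + w" "u \<in> f1 p" "w \<in> f2 p"
      unfolding f12(2)[symmetric] sum_space_def by auto
    then have "w \<in> sum_space (f2 p \<inter> g1 p) (f2 p \<inter> g2 p)"
      using grid.f1_decomp[OF swap_f, of p] by argo
    then obtain c d where w: "w = c + d" "c \<in> f2 p \<inter> g1 p" "d \<in> f2 p \<inter> g2 p"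
      unfolding sum_space_def by auto
    have "f2 p \<inter> g2 p = span {b}"
      using grid.line_span[OF grid.swap_f[OF swap_g], of b p] b by blast
    then obtain t where "d = t *\<^sub>R b" using w(3) by (auto simp: span_singleton)
    moreover have "B a u = 0" using null_f1 a y by auto
    moreover have "B a c = 0" using grid.null_f1[OF transpose, of a p c] a w by auto
    ultimately show "B a y = 0" using y w 0 by simp
  qed
  with a show False by simp
qed

abbreviation F where "F \<equiv> planeproj B f1 f2 g1 g2"
abbreviation G where "G \<equiv> planeproj B f2 f1 g1 g2"

text \<open>Opposite corners are scaled to pair to 1, which gives two hyperbolic pairs. The vector
  dual to a corner is the opposite corner, so all four projections become explicit.\<close>

lemma frame:
  obtains a11 a12 a21 a22 where
    "a11 \<in> f1 p \<inter> g1 p" "a12 \<in> f1 p \<inter> g2 p" "a21 \<in> f2 p \<inter> g1 p" "a22 \<in> f2 p \<inter> g2 p"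
    "B a11 a22 = 1" "B a12 a21 = 1"
    "\<And>u. F p u = B u a22 *\<^sub>R a11 + B u a21 *\<^sub>R a12"
    "\<And>u. G p u = B u a12 *\<^sub>R a21 + B u a11 *\<^sub>R a22"
    "\<And>u. planeproj B g1 g2 f1 f2 p u = B u a22 *\<^sub>R a11 + B u a12 *\<^sub>R a21"
    "\<And>u. planeproj B g2 g1 f1 f2 p u = B u a21 *\<^sub>R a12 + B u a11 *\<^sub>R a22"
    "f1 p = {s *\<^sub>R a11 + t *\<^sub>R a12 | s t. True}" "f2 p = {s *\<^sub>R a21 + t *\<^sub>R a22 | s t. True}"
    "g1 p = {s *\<^sub>R a11 + t *\<^sub>R a21 | s t. True}" "g2 p = {s *\<^sub>R a12 + t *\<^sub>R a22 | s t. True}"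
proof -
  have d: "dim (f1 p \<inter> g1 p) = 1" "dim (f1 p \<inter> g2 p) = 1" "dim (f2 p \<inter> g1 p) = 1" "dim (f2 p \<inter> g2 p) = 1"
    using lines unfolding subbundle_def by auto
  obtain a11 where a11: "a11 \<in> f1 p \<inter> g1 p" "a11 \<noteq> 0" by (rule dim_one_nonzero[OF d(1)])
  obtain a12 where a12: "a12 \<in> f1 p \<inter> g2 p" "a12 \<noteq> 0" by (rule dim_one_nonzero[OF d(2)])
  obtain c21 where c21: "c21 \<in> f2 p \<inter> g1 p" "c21 \<noteq> 0" by (rule dim_one_nonzero[OF d(3)])
  obtain c22 where c22: "c22 \<in> f2 p \<inter> g2 p" "c22 \<noteq> 0" by (rule dim_one_nonzero[OF d(4)])
  have n1: "B a11 c22 \<noteq> 0" using line_pairing a11 c22 by blast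
  have n2: "B a12 c21 \<noteq> 0" using grid.line_pairing[OF swap_g] a12 c21 by blast
  define a22 where "a22 = (1 / B a11 c22) *\<^sub>R c22"
  define a21 where "a21 = (1 / B a12 c21) *\<^sub>R c21"
  have sub: "subspace (f2 p \<inter> g1 p)" "subspace (f2 p \<inter> g2 p)" using lines unfolding subbundle_def by auto
  have a21: "a21 \<in> f2 p \<inter> g1 p" "a21 \<noteq> 0" "B a12 a21 = 1"
    unfolding a21_def using n2 c21 subspace_scale[OF sub(1)] by auto
  have a22: "a22 \<in> f2 p \<inter> g2 p" "a22 \<noteq> 0" "B a11 a22 = 1"
    unfolding a22_def using n1 c22 subspace_scale[OF sub(2)] by auto
  have sp: "f1 p \<inter> g1 p = span {a11}" "f1 p \<inter> g2 p = span {a12}" "f2 p \<inter> g1 p = span {a21}"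
    "f2 p \<inter> g2 p = span {a22}"
    using line_span[OF a11] grid.line_span[OF swap_g a12] grid.line_span[OF swap_f a21(1,2)]
      grid.line_span[OF grid.swap_f[OF swap_g] a22(1,2)] by auto
  note lp = lproj_span[OF sp(1) sp(4) a11(2) a22(2)] lproj_span[OF sp(2) sp(3) a12(2) a21(2)]
    lproj_span[OF sp(3) sp(2) a21(2) a12(2)] lproj_span[OF sp(4) sp(1) a22(2) a11(2)]
  have fr: "planeproj B f1 f2 g1 g2 p u = B u a22 *\<^sub>R a11 + B u a21 *\<^sub>R a12"
    "planeproj B f2 f1 g1 g2 p u = B u a12 *\<^sub>R a21 + B u a11 *\<^sub>R a22"
    "planeproj B g1 g2 f1 f2 p u = B u a22 *\<^sub>R a11 + B u a12 *\<^sub>R a21"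
    "planeproj B g2 g1 f1 f2 p u = B u a21 *\<^sub>R a12 + B u a11 *\<^sub>R a22" for u
    using lp a21(3) a22(3)
    by (simp_all add: planeproj_def Int_commute[of "g1 p"] Int_commute[of "g2 p"] sym[of a21] sym[of a22])
  have de: "f1 p = sum_space (span {a11}) (span {a12})" "f2 p = sum_space (span {a21}) (span {a22})"
    "g1 p = sum_space (span {a11}) (span {a21})" "g2 p = sum_space (span {a12}) (span {a22})"
    using f1_decomp[of p] grid.f1_decomp[OF swap_f, of p] grid.f1_decomp[OF transpose, of p]
      grid.f1_decomp[OF grid.swap_f[OF transpose], of p] sp
    by (simp_all add: Int_commute[of "g1 p"] Int_commute[of "g2 p"])
  have ss: "sum_space (span {a}) (span {b}) = {s *\<^sub>R a + t *\<^sub>R b | s t. True}" for a b :: 'v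
    unfolding sum_space_def span_singleton by blast
  show thesis
    using that[OF a11(1) a12(1) a21(1) a22(1) a22(3) a21(3) fr] de unfolding ss by simp
qed

lemma linear_F: "linear (F p)"
  by (rule linearI) (simp_all add: planeproj_def lproj_def Let_def add_divide_distrib algebra_simps)

lemma F_in: "F p u \<in> f1 p"
  by (rule frame[of p]) auto

lemma F_id: "u \<in> f1 p \<Longrightarrow> F p u = u"
proof (rule frame[of p])
  fix a11 a12 a21 a22
  assume u: "u \<in> f1 p" and a: "a11 \<in> f1 p \<inter> g1 p" "a12 \<in> f1 p \<inter> g2 p" "a21 \<in> f2 p \<inter> g1 p" "a22 \<in> f2 p \<inter> g2 p"
    "B a11 a22 = 1" "B a12 a21 = 1" "\<And>u. F p u = B u a22 *\<^sub>R a11 + B u a21 *\<^sub>R a12"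
    and f: "f1 p = {s *\<^sub>R a11 + t *\<^sub>R a12 | s t. True}"
  have "B a11 a21 = 0" "B a12 a22 = 0"
    using a grid.null_f1[OF transpose, of a11 p a21] grid.null_f1[OF grid.swap_f[OF transpose], of a12 p a22] by auto
  then show ?thesis using u f a by auto
qed

lemma F_f2: "u \<in> f2 p \<Longrightarrow> F p u = 0"
proof (rule frame[of p])
  fix a11 a12 a21 a22
  assume u: "u \<in> f2 p" and a: "a21 \<in> f2 p \<inter> g1 p" "a22 \<in> f2 p \<inter> g2 p"
    "\<And>u. F p u = B u a22 *\<^sub>R a11 + B u a21 *\<^sub>R a12"
  then show ?thesis using grid.null_f1[OF swap_f, of u p] by simp
qed

lemma F_g1: "u \<in> g1 p \<Longrightarrow> F p u \<in> g1 p"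
proof (rule frame[of p])
  fix a11 a12 a21 a22
  assume u: "u \<in> g1 p" and a: "a11 \<in> f1 p \<inter> g1 p" "a21 \<in> f2 p \<inter> g1 p"
    "\<And>u. F p u = B u a22 *\<^sub>R a11 + B u a21 *\<^sub>R a12"
  have "B u a21 = 0" using u a grid.null_f1[OF transpose, of u p a21] by simp
  then show ?thesis using a grid.subspace_f1[OF transpose, of p] by (simp add: subspace_scale)
qed

lemma F_perp: "u \<in> perp B (W p) \<Longrightarrow> F p u = 0"
proof (rule frame[of p])
  fix a11 a12 a21 a22
  assume u: "u \<in> perp B (W p)" and a: "a21 \<in> f2 p \<inter> g1 p" "a22 \<in> f2 p \<inter> g2 p"
    "\<And>u. F p u = B u a22 *\<^sub>R a11 + B u a21 *\<^sub>R a12"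
  then have "a21 \<in> W p" "a22 \<in> W p" using grid.f1_W[OF swap_f] by auto
  then show ?thesis using u a perpD by simp
qed

text \<open>In the frame formula for \<open>F\<close>, moving the coefficients to the other argument
  of \<open>B\<close> exchanges each corner with its opposite, that is \<open>f1\<close> with
  \<open>f2\<close>.\<close>

lemma F_adj: "B (F p u) w = B u (G p w)"
  by (rule frame[of p]) (simp add: sym[of w])

lemma msmooth_F: "msmooth A (\<lambda>x. F x u)"
  unfolding planeproj_def
proof (intro msmooth_on_add msmooth_lproj lines open_UNIV)
  show "B a b \<noteq> 0" if "a \<in> f1 x \<inter> g1 x" "b \<in> f2 x \<inter> g2 x" "a \<noteq> 0" "b \<noteq> 0" for x a b
    using line_pairing that by blast
  show "B a b \<noteq> 0" if "a \<in> f1 x \<inter> g2 x" "b \<in> f2 x \<inter> g1 x" "a \<noteq> 0" "b \<noteq> 0" for x a b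
    using grid.line_pairing[OF swap_g] that by blast
qed

lemmas linear_G = grid.linear_F[OF swap_f] and G_in = grid.F_in[OF swap_f] and G_id = grid.F_id[OF swap_f]
  and G_f1 = grid.F_f2[OF swap_f] and G_g1 = grid.F_g1[OF swap_f] and G_perp = grid.F_perp[OF swap_f]
  and G_adj = grid.F_adj[OF swap_f] and msmooth_G = grid.msmooth_F[OF swap_f]

lemma FG_zero: "F p (G p u) = 0" and GF_zero: "G p (F p u) = 0" and FF: "F p (F p u) = F p u"
  and GG: "G p (G p u) = G p u"
  using F_f2 G_f1 F_in G_in F_id G_id by auto

definition P :: "'s \<Rightarrow> 'v \<Rightarrow> 'v" where "P p u = F p u + G p u"

lemma linear_P: "linear (P p)"
  unfolding P_def by (intro linear_compose_add linear_F linear_G)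

lemma P_in: "P p u \<in> W p"
  unfolding P_def f12(2)[symmetric] sum_space_def using F_in G_in by blast

lemma P_id: "u \<in> W p \<Longrightarrow> P p u = u"
  unfolding P_def f12(2)[symmetric] sum_space_def
  by (auto simp: linear_add[OF linear_F] linear_add[OF linear_G] F_id F_f2 G_id G_f1)

lemma P_perp: "u \<in> perp B (W p) \<Longrightarrow> P p u = 0"
  unfolding P_def by (simp add: F_perp G_perp)

lemma P_adj: "B (P p u) w = B u (P p w)"
  unfolding P_def by (simp add: F_adj G_adj)

lemma diff_P_perp: "u - P p u \<in> perp B (W p)"
  unfolding perp_def using P_adj P_id by simp

lemma in_perp_iff: "u \<in> perp B (W p) \<longleftrightarrow> P p u = 0"
  using P_perp diff_P_perp[of u p] by auto

lemma PP: "P p (P p u) = P p u"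
  by (rule P_id[OF P_in])

lemma msmooth_P: "msmooth A (\<lambda>x. P x u)"
  unfolding P_def by (intro msmooth_on_add msmooth_F msmooth_G open_UNIV)

text \<open>\<open>u - P p u\<close> is orthogonal to \<open>W p\<close>, and for \<open>u\<close>
  in the double complement also to \<open>W\<^sup>\<bottom>\<close>; nondegeneracy of
  \<open>B\<close> on the whole space then makes it 0.\<close>

lemma perp_perp: "u \<in> perp B (perp B (W p)) \<longleftrightarrow> u \<in> W p"
proof
  assume u: "u \<in> perp B (perp B (W p))"
  have "B (u - P p u) y = 0" for y
  proof -
    have "B (u - P p u) (y - P p y) = 0"
      using u perpD[OF u diff_P_perp[of y p]] perpD[OF diff_P_perp[of y p] P_in[of p u]]
      by (simp add: sym[of "P p u"] sym[of "P p (P p u)"])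
    moreover have "B (u - P p u) (P p y) = 0" using perpD[OF diff_P_perp P_in] .
    ultimately show ?thesis by simp
  qed
  then have "u - P p u = 0" by (rule nondeg)
  then show "u \<in> W p" using P_in[of p u] by simp
next
  assume "u \<in> W p"
  then show "u \<in> perp B (perp B (W p))" using perpD[of _ "W p" u] sym unfolding perp_def by auto
qed

lemma oproj_W: "oproj B (W p) u = P p u"
  unfolding oproj_def
proof (rule the_equality)
  show "P p u \<in> W p \<and> u - P p u \<in> perp B (W p)" using P_in diff_P_perp by auto
  fix w assume "w \<in> W p \<and> u - w \<in> perp B (W p)"
  then show "w = P p u" using P_perp[of "u - w" p] P_id[of w p] linear_diff[OF linear_P] by simp
qed

lemma oproj_perp: "oproj B (perp B (W p)) u = u - P p u"
  unfolding oproj_def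
proof (rule the_equality)
  show "u - P p u \<in> perp B (W p) \<and> u - (u - P p u) \<in> perp B (perp B (W p))"
    using P_in diff_P_perp perp_perp by simp
  fix w assume w: "w \<in> perp B (W p) \<and> u - w \<in> perp B (perp B (W p))"
  then have "P p (u - w) = u - w" using perp_perp P_id by blast
  then show "w = u - P p u" using P_perp[of w p] w linear_diff[OF linear_P, of p u w] by simp
qed

end

section \<open>The Gauss equation for a smooth field of projections\<close>

context smooth_manifold
begin

lemma linear_dir:
  fixes T :: "'s \<Rightarrow> 'v::euclidean_space \<Rightarrow> 'w::euclidean_space"
  assumes v: "v \<in> tangent_space A p" and lin: "\<And>x. linear (T x)" and T: "\<And>u. msmooth A (\<lambda>x. T x u)"
  shows "linear (\<lambda>u. dir v (\<lambda>x. T x u))"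
proof (rule linearI)
  fix u w and c :: real
  show "dir v (\<lambda>x. T x (u + w)) = dir v (\<lambda>x. T x u) + dir v (\<lambda>x. T x w)"
    by (simp add: linear_add[OF lin] dir_add[OF v T T])
  show "dir v (\<lambda>x. T x (c *\<^sub>R u)) = c *\<^sub>R dir v (\<lambda>x. T x u)"
    by (simp add: linear_scale[OF lin] dir_linear[OF v linear_scaleR T])
qed

lemma dir_compose:
  fixes T :: "'s \<Rightarrow> 'v::euclidean_space \<Rightarrow> 'w::euclidean_space" and R :: "'s \<Rightarrow> 'u::euclidean_space \<Rightarrow> 'v"
  assumes v: "v \<in> tangent_space A p" and lin: "\<And>x. linear (T x)" and T: "\<And>u. msmooth A (\<lambda>x. T x u)"
    and R: "\<And>u. msmooth A (\<lambda>x. R x u)"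
  shows "dir v (\<lambda>x. T x (R x u)) = dir v (\<lambda>x. T x (R p u)) + T p (dir v (\<lambda>x. R x u))"
  by (rule dir_apply[OF v lin T R])

text \<open>The Gauss equation for the connection \<open>R d\<close> on the image of
  \<open>R\<close>: second derivatives of \<open>\<sigma>\<close> cancel against the Lie bracket,
  and the rest depends on \<open>\<sigma> p\<close> alone. It is applied to \<open>P\<close> and to
  \<open>1 - P\<close>.\<close>

lemma projection_curvature:
  fixes R :: "'s \<Rightarrow> 'v::euclidean_space \<Rightarrow> 'v"
  assumes lin: "\<And>x. linear (R x)" and R: "\<And>u. msmooth A (\<lambda>x. R x u)"
    and idem: "\<And>x u. R x (R x u) = R x u"
    and X: "vector_field A X" and Y: "vector_field A Y" and \<sigma>: "msmooth A \<sigma>" "\<And>x. R x (\<sigma> x) = \<sigma> x"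
  shows "R p (dir (X p) (\<lambda>x. R x (dir (Y x) \<sigma>))) - R p (dir (Y p) (\<lambda>x. R x (dir (X x) \<sigma>)))
      - R p (dir (lie_bracket A X Y p) \<sigma>) =
    R p (dir (X p) (\<lambda>x. R x (dir (Y p) (\<lambda>x. R x (\<sigma> p)))) - dir (Y p) (\<lambda>x. R x (dir (X p) (\<lambda>x. R x (\<sigma> p)))))"
proof -
  \<comment> \<open>Differentiate \<open>R R = R\<close> and apply \<open>R\<close> once more: this
    gives \<open>R dR R = 0\<close>.\<close>
  have RdR: "R p (dir v (\<lambda>x. R x (R p z))) = 0" if v: "v \<in> tangent_space A p" for v z
  proof -
    have "dir v (\<lambda>x. R x z) = dir v (\<lambda>x. R x (R p z)) + R p (dir v (\<lambda>x. R x z))"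
      using dir_compose[of v p R R z, OF v lin R R] by (simp add: idem)
    then have "R p (dir v (\<lambda>x. R x z)) = R p (dir v (\<lambda>x. R x (R p z)) + R p (dir v (\<lambda>x. R x z)))"
      by (rule arg_cong)
    then show ?thesis by (simp add: linear_add[OF lin] idem)
  qed
  have half: "R p (dir (X p) (\<lambda>x. R x (dir (Y x) \<sigma>))) =
      R p (dir (X p) (\<lambda>x. R x (dir (Y p) (\<lambda>x. R x (\<sigma> p))))) + R p (dir (X p) (\<lambda>x. dir (Y x) \<sigma>))"
    if X: "vector_field A X" and Y: "vector_field A Y" for X Y
  proof -
    note Xp = vector_field_tangent[OF X, of p] and Yp = vector_field_tangent[OF Y, of p]
    have e: "dir (Y p) \<sigma> = dir (Y p) (\<lambda>x. R x (\<sigma> p)) + R p (dir (Y p) \<sigma>)"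
      using dir_apply[OF Yp lin R \<sigma>(1)] unfolding \<sigma>(2) .
    have "dir (X p) (\<lambda>x. R x (dir (Y p) \<sigma>)) =
        dir (X p) (\<lambda>x. R x (dir (Y p) (\<lambda>x. R x (\<sigma> p)) + R p (dir (Y p) \<sigma>)))"
      using e by (rule arg_cong)
    also have "\<dots> = dir (X p) (\<lambda>x. R x (dir (Y p) (\<lambda>x. R x (\<sigma> p)))) + dir (X p) (\<lambda>x. R x (R p (dir (Y p) \<sigma>)))"
      by (rule linear_add[OF linear_dir[OF Xp lin R]])
    finally have "dir (X p) (\<lambda>x. R x (dir (Y p) \<sigma>)) =
        dir (X p) (\<lambda>x. R x (dir (Y p) (\<lambda>x. R x (\<sigma> p)))) + dir (X p) (\<lambda>x. R x (R p (dir (Y p) \<sigma>)))" .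
    moreover have "dir (X p) (\<lambda>x. R x (dir (Y x) \<sigma>)) =
        dir (X p) (\<lambda>x. R x (dir (Y p) \<sigma>)) + R p (dir (X p) (\<lambda>x. dir (Y x) \<sigma>))"
      by (rule dir_apply[OF Xp lin R msmooth_dir[OF Y \<sigma>(1)]])
    ultimately show ?thesis by (simp add: linear_add[OF lin] RdR[OF Xp] idem)
  qed
  show ?thesis
    using dir_lie_bracket[OF X Y \<sigma>(1), of p, symmetric]
    by (simp add: half[OF X Y] half[OF Y X] linear_diff[OF lin])
qed

end

section \<open>First derivatives of the projections and flatness of
  \<open>\<D>\<^sup>W\<close>\<close>

context grid
begin

abbreviation dF where "dF v u \<equiv> dir v (\<lambda>x. F x u)"
abbreviation dG where "dG v u \<equiv> dir v (\<lambda>x. G x u)"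
abbreviation dP where "dP v u \<equiv> dir v (\<lambda>x. P x u)"

lemma DW_eq:
  assumes v: "v \<in> tangent_space A p" and \<sigma>: "\<And>x. \<sigma> x \<in> W x"
  shows "DW B W p v \<sigma> = P p (dir v \<sigma>)"
proof -
  have P: "P x (\<sigma> x) = \<sigma> x" for x using P_id \<sigma> by simp
  show ?thesis
    unfolding DW_def oproj_W oproj_perp P by (simp add: dir_const[OF v] linear_0[OF linear_P])
qed

lemma DW_perp_eq:
  assumes v: "v \<in> tangent_space A p" and \<sigma>: "\<And>x. \<sigma> x \<in> perp B (W x)"
  shows "DW B W p v \<sigma> = dir v \<sigma> - P p (dir v \<sigma>)"
proof -
  have P: "P x (\<sigma> x) = 0" for x using P_perp \<sigma> by simp
  show ?thesis
    unfolding DW_def oproj_W oproj_perp P by (simp add: dir_const[OF v] linear_0[OF linear_P])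
qed

lemma linear_dF: "v \<in> tangent_space A p \<Longrightarrow> linear (dF v)"
  by (rule linear_dir[OF _ linear_F msmooth_F])

lemma linear_dG: "v \<in> tangent_space A p \<Longrightarrow> linear (dG v)"
  by (rule linear_dir[OF _ linear_G msmooth_G])

lemma linear_dP: "v \<in> tangent_space A p \<Longrightarrow> linear (dP v)"
  by (rule linear_dir[OF _ linear_P msmooth_P])

lemma dP_eq: "v \<in> tangent_space A p \<Longrightarrow> dP v u = dF v u + dG v u"
  unfolding P_def by (rule dir_add[OF _ msmooth_F msmooth_G])

lemma FP: "F p (P p u) = F p u" and GP: "G p (P p u) = G p u"
  unfolding P_def by (simp_all add: linear_add[OF linear_F] linear_add[OF linear_G] FG_zero GF_zero FF GG)

text \<open>Here parallelism of \<open>f1\<close> enters; for sections of \<open>W\<close> the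
  connection \<open>\<D>\<^sup>W\<close> is \<open>P d\<close>, and \<open>G P = G\<close>.\<close>

lemma f1_section_derivative:
  assumes v: "v \<in> tangent_space A p" and \<sigma>: "\<sigma> \<in> sections A f1"
  shows "G p (dir v \<sigma>) = 0"
proof -
  have "DW B W p v \<sigma> \<in> f1 p" using parallel_f1 \<sigma> v unfolding parallel_def by blast
  moreover have "DW B W p v \<sigma> = P p (dir v \<sigma>)"
    using \<sigma> f1_W by (intro DW_eq[OF v]) (auto simp: sections_def)
  ultimately show ?thesis using G_f1 GP by metis
qed

lemma F_section: "(\<lambda>x. F x u) \<in> sections A f1"
  unfolding sections_def using msmooth_F F_in by simp

lemma G_dF:
  assumes "v \<in> tangent_space A p"
  shows "G p (dF v u) = 0"
  by (rule f1_section_derivative[OF assms F_section])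

lemmas F_dG = grid.G_dF[OF swap_f]

text \<open>Differentiate \<open>F G = 0\<close>; the term \<open>F dG\<close> vanishes by
  parallelism of \<open>f2\<close>.\<close>

lemma dF_G:
  assumes v: "v \<in> tangent_space A p"
  shows "dF v (G p u) = 0"
  using dir_compose[of v p F G u, OF v linear_F msmooth_F msmooth_G] by (simp add: FG_zero dir_const[OF v] F_dG[OF v])

lemmas dG_F = grid.dF_G[OF swap_f]

lemma dF_F:
  assumes v: "v \<in> tangent_space A p"
  shows "dF v u = dF v (F p u) + F p (dF v u)"
  using dir_compose[of v p F F u, OF v linear_F msmooth_F msmooth_F] by (simp add: FF)

lemmas dG_G = grid.dF_F[OF swap_f]

lemma F_dF_F:
  assumes v: "v \<in> tangent_space A p"
  shows "F p (dF v (F p u)) = 0"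
proof -
  have "F p (dF v u) = F p (dF v (F p u) + F p (dF v u))" using dF_F[OF v, of u] by metis
  then show ?thesis by (simp add: linear_add[OF linear_F] FF)
qed

lemmas G_dG_G = grid.F_dF_F[OF swap_f]

lemma dF_adj:
  assumes v: "v \<in> tangent_space A p"
  shows "B (dF v u) w = B u (dG v w)"
proof -
  have lin: "linear (\<lambda>z. B z y)" for y by (rule linear_B)
  have "B (dF v u) w = dir v (\<lambda>x. B (F x u) w)" by (rule dir_linear[OF v lin msmooth_F, symmetric])
  also have "\<dots> = dir v (\<lambda>x. B (G x w) u)" by (simp add: F_adj sym[of u])
  also have "\<dots> = B (dG v w) u" by (rule dir_linear[OF v lin msmooth_G])
  finally show ?thesis by (simp add: sym)
qed

lemmas dG_adj = grid.dF_adj[OF swap_f]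

lemma dP_adj: "v \<in> tangent_space A p \<Longrightarrow> B (dP v u) w = B u (dP v w)"
  by (simp add: dP_eq dF_adj dG_adj)

lemma dP_P:
  assumes v: "v \<in> tangent_space A p"
  shows "dP v u = dP v (P p u) + P p (dP v u)"
  using dir_compose[of v p P P u, OF v linear_P msmooth_P msmooth_P] by (simp add: PP)

text \<open>Differentiating \<open>P P = P\<close> shows that \<open>dP\<close> exchanges
  \<open>W\<close> and \<open>W\<^sup>\<bottom>\<close>. It is \<open>\<N>\<^sup>W\<close> on
  \<open>W\<close> and \<open>- \<N>\<^sup>W\<close> on \<open>W\<^sup>\<bottom>\<close>.\<close>

lemma P_dP_W:
  assumes v: "v \<in> tangent_space A p" and u: "u \<in> W p"
  shows "P p (dP v u) = 0"
  using dP_P[OF v, of u] P_id[OF u] by simp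

lemma dP_perp_W:
  assumes v: "v \<in> tangent_space A p" and u: "u \<in> perp B (W p)"
  shows "dP v u \<in> W p"
proof -
  have "dP v u = P p (dP v u)" using dP_P[OF v, of u] P_perp[OF u] linear_0[OF linear_dP[OF v]] by simp
  then show ?thesis using P_in by metis
qed

lemma W_section_derivative:
  assumes v: "v \<in> tangent_space A p" and \<sigma>: "msmooth A \<sigma>" "\<And>x. \<sigma> x \<in> W x"
  shows "dir v \<sigma> - P p (dir v \<sigma>) = dP v (\<sigma> p)"
proof -
  have P: "P x (\<sigma> x) = \<sigma> x" for x using P_id \<sigma>(2) .
  have "dir v \<sigma> = dP v (\<sigma> p) + P p (dir v \<sigma>)"
    using dir_apply[OF v linear_P msmooth_P \<sigma>(1)] unfolding P .
  then show ?thesis by (metis add_diff_cancel_right')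
qed

text \<open>By the Gauss equation the curvature is tensorial, and \<open>\<lambda>x. P x u\<close>
  is a section through any given \<open>u\<close> in \<open>W p\<close>.\<close>

lemma flat_W_iff:
  "flat_on A (DW B W) W \<longleftrightarrow> (\<forall>X Y. vector_field A X \<longrightarrow> vector_field A Y \<longrightarrow>
     (\<forall>p. \<forall>u\<in>W p. P p (dP (X p) (dP (Y p) u) - dP (Y p) (dP (X p) u)) = 0))"
proof -
  have curv: "curvature A (DW B W) X Y \<sigma> p = P p (dP (X p) (dP (Y p) (\<sigma> p)) - dP (Y p) (dP (X p) (\<sigma> p)))"
    if X: "vector_field A X" and Y: "vector_field A Y" and \<sigma>: "\<sigma> \<in> sections A W" for X Y \<sigma> p
  proof -
    have s: "msmooth A \<sigma>" "\<And>x. \<sigma> x \<in> W x" using \<sigma> by (auto simp: sections_def)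
    note t = vector_field_tangent[OF X] vector_field_tangent[OF Y] lie_bracket_tangent[OF X Y]
    have eq: "DW B W x (Z x) \<sigma> = P x (dir (Z x) \<sigma>)" if "vector_field A Z" for Z x
      by (rule DW_eq[OF vector_field_tangent[OF that] s(2)])
    show ?thesis
      unfolding curvature_def eq[OF X] eq[OF Y] DW_eq[OF t(1) P_in] DW_eq[OF t(2) P_in] DW_eq[OF t(3) s(2)]
      by (rule projection_curvature[OF linear_P msmooth_P PP X Y s(1) P_id[OF s(2)]])
  qed
  have sec: "(\<lambda>x. P x u) \<in> sections A W" for u
    unfolding sections_def using msmooth_P P_in by simp
  show ?thesis
    unfolding flat_on_def
  proof (intro iff_allI imp_cong refl)
    fix X Y :: "'s \<Rightarrow> 's tvec" assume XY: "vector_field A X" "vector_field A Y"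
    show "(\<forall>\<sigma>\<in>sections A W. \<forall>p. curvature A (DW B W) X Y \<sigma> p = 0) \<longleftrightarrow>
      (\<forall>p. \<forall>u\<in>W p. P p (dP (X p) (dP (Y p) u) - dP (Y p) (dP (X p) u)) = 0)"
    proof
      assume *: "\<forall>\<sigma>\<in>sections A W. \<forall>p. curvature A (DW B W) X Y \<sigma> p = 0"
      show "\<forall>p. \<forall>u\<in>W p. P p (dP (X p) (dP (Y p) u) - dP (Y p) (dP (X p) u)) = 0"
      proof (intro allI ballI)
        fix p u assume u: "u \<in> W p"
        show "P p (dP (X p) (dP (Y p) u) - dP (Y p) (dP (X p) u)) = 0"
          using *[rule_format, OF sec[of u], of p] curv[OF XY sec[of u], of p] by (simp add: P_id[OF u])
      qed
    next
      assume "\<forall>p. \<forall>u\<in>W p. P p (dP (X p) (dP (Y p) u) - dP (Y p) (dP (X p) u)) = 0"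
      then show "\<forall>\<sigma>\<in>sections A W. \<forall>p. curvature A (DW B W) X Y \<sigma> p = 0"
        using curv[OF XY] by (simp add: sections_def)
    qed
  qed
qed

text \<open>The Gauss equation for \<open>Q = 1 - P\<close>, where the two signs in
  \<open>dQ = - dP\<close> cancel. The outer projection disappears because \<open>dP dP\<close> maps
  \<open>W\<^sup>\<bottom>\<close> to itself.\<close>

lemma flat_perp_iff:
  "flat_on A (DW B W) (\<lambda>p. perp B (W p)) \<longleftrightarrow> (\<forall>X Y. vector_field A X \<longrightarrow> vector_field A Y \<longrightarrow>
     (\<forall>p. \<forall>u\<in>perp B (W p). dP (X p) (dP (Y p) u) = dP (Y p) (dP (X p) u)))"
proof -
  define Q where "Q p u = u - P p u" for p u
  have linQ: "linear (Q p)" for p unfolding Q_def by (intro linear_compose_sub linear_id[unfolded id_def] linear_P)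
  have smQ: "msmooth A (\<lambda>x. Q x u)" for u
    unfolding Q_def by (intro msmooth_on_diff msmooth_on_const msmooth_P open_UNIV)
  have QQ: "Q p (Q p u) = Q p u" for p u by (simp add: Q_def linear_diff[OF linear_P] PP)
  have Q_in: "Q p u \<in> perp B (W p)" for p u unfolding Q_def by (rule diff_P_perp)
  have dQ: "dir v (\<lambda>x. Q x u) = - dP v u" if "v \<in> tangent_space A p" for v p u
    unfolding Q_def by (simp add: dir_diff[OF that msmooth_on_const msmooth_P] dir_const[OF that])
  have curv: "curvature A (DW B W) X Y \<sigma> p = dP (X p) (dP (Y p) (\<sigma> p)) - dP (Y p) (dP (X p) (\<sigma> p))"
    if X: "vector_field A X" and Y: "vector_field A Y" and \<sigma>: "\<sigma> \<in> sections A (\<lambda>p. perp B (W p))" for X Y \<sigma> p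
  proof -
    have s: "msmooth A \<sigma>" "\<And>x. \<sigma> x \<in> perp B (W x)" using \<sigma> by (auto simp: sections_def)
    note Xp = vector_field_tangent[OF X] and Yp = vector_field_tangent[OF Y]
    note t = Xp Yp lie_bracket_tangent[OF X Y]
    have eq: "DW B W x v \<tau> = Q x (dir v \<tau>)"
      if "v \<in> tangent_space A x" "\<And>x. \<tau> x \<in> perp B (W x)" for v x \<tau>
      unfolding Q_def by (rule DW_perp_eq[OF that])
    have eq': "DW B W x (Z x) \<sigma> = Q x (dir (Z x) \<sigma>)" if "vector_field A Z" for Z x
      by (rule eq[OF vector_field_tangent[OF that] s(2)])
    have Qs: "Q x (\<sigma> x) = \<sigma> x" for x unfolding Q_def using P_perp[OF s(2)] by simp
    have "curvature A (DW B W) X Y \<sigma> p =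
        Q p (dP (X p) (dP (Y p) (\<sigma> p)) - dP (Y p) (dP (X p) (\<sigma> p)))"
      unfolding curvature_def eq'[OF X] eq'[OF Y] eq[OF t(1) Q_in] eq[OF t(2) Q_in] eq[OF t(3) s(2)]
      unfolding projection_curvature[OF linQ smQ QQ X Y s(1) Qs] dQ[OF Xp] dQ[OF Yp]
      by (simp add: linear_neg[OF linear_dP[OF Xp]] linear_neg[OF linear_dP[OF Yp]])
    moreover have "P p (dP (X p) (dP (Y p) (\<sigma> p))) = 0" "P p (dP (Y p) (dP (X p) (\<sigma> p))) = 0"
      by (intro P_dP_W dP_perp_W Xp Yp s)+
    ultimately show ?thesis by (simp add: Q_def linear_diff[OF linear_P])
  qed
  have sec: "(\<lambda>x. Q x u) \<in> sections A (\<lambda>p. perp B (W p))" for u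
    unfolding sections_def using smQ Q_in by simp
  show ?thesis
    unfolding flat_on_def
  proof (intro iff_allI imp_cong refl)
    fix X Y :: "'s \<Rightarrow> 's tvec" assume XY: "vector_field A X" "vector_field A Y"
    show "(\<forall>\<sigma>\<in>sections A (\<lambda>p. perp B (W p)). \<forall>p. curvature A (DW B W) X Y \<sigma> p = 0) \<longleftrightarrow>
      (\<forall>p. \<forall>u\<in>perp B (W p). dP (X p) (dP (Y p) u) = dP (Y p) (dP (X p) u))"
    proof
      assume *: "\<forall>\<sigma>\<in>sections A (\<lambda>p. perp B (W p)). \<forall>p. curvature A (DW B W) X Y \<sigma> p = 0"
      show "\<forall>p. \<forall>u\<in>perp B (W p). dP (X p) (dP (Y p) u) = dP (Y p) (dP (X p) u)"
      proof (intro allI ballI)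
        fix p u assume u: "u \<in> perp B (W p)"
        then have "Q p u = u" unfolding Q_def using P_perp by simp
        then show "dP (X p) (dP (Y p) u) = dP (Y p) (dP (X p) u)"
          using *[rule_format, OF sec[of u], of p] curv[OF XY sec[of u], of p] by simp
      qed
    next
      assume "\<forall>p. \<forall>u\<in>perp B (W p). dP (X p) (dP (Y p) u) = dP (Y p) (dP (X p) u)"
      then show "\<forall>\<sigma>\<in>sections A (\<lambda>p. perp B (W p)). \<forall>p. curvature A (DW B W) X Y \<sigma> p = 0"
        using curv[OF XY] by (simp add: sections_def)
    qed
  qed
qed

lemma curved_flat_commute:
  assumes cf: "curved_flat A B W" and v: "v \<in> tangent_space A p" and w: "w \<in> tangent_space A p"
  shows "dP v (dP w u) = dP w (dP v u)"
proof -
  obtain X where X: "vector_field A X" "X p = v" by (rule tangent_extends_to_vector_field[OF v])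
  obtain Y where Y: "vector_field A Y" "Y p = w" by (rule tangent_extends_to_vector_field[OF w])
  have W: "dP v (dP w u) = dP w (dP v u)" if u: "u \<in> W p" for u
  proof -
    have "P p (dP v (dP w u) - dP w (dP v u)) = 0"
      using cf X Y u unfolding curved_flat_def flat_W_iff by blast
    moreover have "dP a (dP b u) \<in> W p" if "a \<in> tangent_space A p" "b \<in> tangent_space A p" for a b
      by (intro dP_perp_W that) (simp add: in_perp_iff P_dP_W that u)
    then have "dP v (dP w u) - dP w (dP v u) \<in> W p" using v w subspace_W subspace_diff by blast
    ultimately show ?thesis using P_id by simp
  qed
  have perp: "dP v (dP w u) = dP w (dP v u)" if u: "u \<in> perp B (W p)" for u
    using cf X Y u unfolding curved_flat_def flat_perp_iff by blast
  have "dP v (dP w (P p u + (u - P p u))) = dP w (dP v (P p u + (u - P p u)))"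
    using W[OF P_in[of p u]] perp[OF diff_P_perp[of u p]]
    unfolding linear_add[OF linear_dP[OF v]] linear_add[OF linear_dP[OF w]] by simp
  then show ?thesis by simp
qed

end

section \<open>From curved flats to Darboux pairs\<close>

text \<open>\<open>- (F dF - dG G)\<close> is the \<open>f1 \<and> W\<^sup>\<bottom>\<close>-part of \<open>\<N>\<^sup>W\<close>; it is written here without the
  composition \<open>dG G\<close> so that it can be differentiated termwise.\<close>

definition wedge_part ::
  "('v::euclidean_space \<Rightarrow> 'v \<Rightarrow> real) \<Rightarrow> ('s \<Rightarrow> 'v set) \<Rightarrow> ('s \<Rightarrow> 'v set) \<Rightarrow> ('s \<Rightarrow> 'v set) \<Rightarrow>
     ('s \<Rightarrow> 'v set) \<Rightarrow> ('s, 'v) form1" where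
  "wedge_part B f1 f2 g1 g2 p v u =
     planeproj B f1 f2 g1 g2 p (dir v (\<lambda>x. planeproj B f1 f2 g1 g2 x u)) +
     planeproj B f2 f1 g1 g2 p (dir v (\<lambda>x. planeproj B f2 f1 g1 g2 x u)) -
     dir v (\<lambda>x. planeproj B f2 f1 g1 g2 x u)"

context sym_form
begin

text \<open>Pairing with the dual family \<open>d\<close> reads off coefficients; this gives both
  the independence of \<open>E\<close> and the diagonal entries.\<close>

lemma trace_on_dual_basis:
  assumes fin: "finite E" and S: "span E = S"
    and dual: "\<And>e e'. e \<in> E \<Longrightarrow> e' \<in> E \<Longrightarrow> B e (d e') = (if e = e' then 1 else 0)"
    and L: "linear L" "\<And>u. u \<in> S \<Longrightarrow> L u \<in> S" and T: "\<And>u. u \<in> S \<Longrightarrow> T u = L u"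
  shows "trace_on S T = (\<Sum>e\<in>E. B (L e) (d e))"
proof -
  have coeff: "B (\<Sum>e\<in>E. c e *\<^sub>R e) (d e') = c e'" if "e' \<in> E" for c e'
  proof -
    have "B (\<Sum>e\<in>E. c e *\<^sub>R e) (d e') = (\<Sum>e\<in>E. if e = e' then c e else 0)"
      unfolding B_sum_left using dual that by (intro sum.cong) auto
    then show ?thesis using fin that by simp
  qed
  have ind: "independent E"
  proof
    assume "dependent E"
    then obtain c where c: "\<exists>e\<in>E. c e \<noteq> 0" "(\<Sum>e\<in>E. c e *\<^sub>R e) = 0" using dependent_finite[OF fin] by auto
    then show False using coeff[of _ c] by auto
  qed
  have "representation E x e = B x (d e)" if "x \<in> S" "e \<in> E" for x e
  proof -
    have "x = (\<Sum>e\<in>E. representation E x e *\<^sub>R e)"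
      using sum_representation_eq[OF ind _ fin order_refl, of x] that S by simp
    then have "B x (d e) = B (\<Sum>e\<in>E. representation E x e *\<^sub>R e) (d e)" by (rule arg_cong)
    then show ?thesis using coeff[OF that(2), of "representation E x"] by simp
  qed
  then have rep: "representation E (L e) e = B (L e) (d e)" if "e \<in> E" for e
    using that L(2) S span_base by blast
  have "trace_on S T = (\<Sum>e\<in>E. representation E (L e) e)"
    by (rule trace_on_eq[OF ind S L]) (simp_all add: T)
  then show ?thesis using rep by simp
qed

end

lemma dir_lincomb_vector: "dir (\<lambda>g. a * v g + b * w g) \<sigma> = a *\<^sub>R dir v \<sigma> + b *\<^sub>R dir w \<sigma>"
  by (simp add: dir_def scaleR_sum_right sum.distrib algebra_simps)

section \<open>The gauge potential cut out of \<open>\<N>\<^sup>W\<close>\<close>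

context grid
begin

abbreviation eta where "eta \<equiv> wedge_part B f1 f2 g1 g2"

lemma eta_eq:
  assumes v: "v \<in> tangent_space A p"
  shows "eta p v u = F p (dF v u) - dG v (G p u)"
  unfolding wedge_part_def using dG_G[OF v, of u] by (simp add: algebra_simps)

lemma linear_eta: "v \<in> tangent_space A p \<Longrightarrow> linear (eta p v)"
  unfolding wedge_part_def
  by (intro linear_compose_sub linear_compose_add linear_compose[OF linear_dF linear_F, unfolded o_def]
      linear_compose[OF linear_dG linear_G, unfolded o_def] linear_dG)

text \<open>\<open>F dF\<close> and \<open>dG G\<close> are adjoint to each other, so
  \<open>eta\<close> is an operator minus its adjoint.\<close>

lemma eta_skew:
  assumes v: "v \<in> tangent_space A p"
  shows "B (eta p v x) y = - B x (eta p v y)"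
  unfolding eta_eq[OF v] by (simp add: F_adj G_adj dF_adj[OF v] dG_adj[OF v])

lemma f1_perp: "x \<in> perp B (W p) \<Longrightarrow> x \<in> perp B (f1 p)"
  using f1_W unfolding perp_def by blast

lemma dF_f1_perp:
  assumes v: "v \<in> tangent_space A p" and u: "u \<in> f1 p"
  shows "dF v u \<in> perp B (W p)"
  using F_dF_F[OF v, of u] G_dF[OF v, of u] F_id[OF u] by (simp add: in_perp_iff P_def)

lemmas dG_f2_perp = grid.dF_f1_perp[OF swap_f]

text \<open>In terms of the frame, \<open>eta\<close> is \<open>a11\<close> wedge
  \<open>eta a22\<close> plus \<open>a12\<close> wedge \<open>eta a21\<close>. The part
  \<open>eta G\<close> gives one half of each wedge and the component \<open>F eta\<close>, by
  skew-symmetry, the other; \<open>eta\<close> maps \<open>f2\<close> into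
  \<open>W\<^sup>\<bottom>\<close>.\<close>

lemma eta_wedge_span:
  assumes v: "v \<in> tangent_space A p"
  shows "eta p v \<in> wedge_span B (f1 p) (perp B (f1 p))"
proof (rule frame[of p])
  fix a11 a12 a21 a22
  assume a: "a11 \<in> f1 p \<inter> g1 p" "a12 \<in> f1 p \<inter> g2 p" "a21 \<in> f2 p \<inter> g1 p" "a22 \<in> f2 p \<inter> g2 p"
    and F: "\<And>u. F p u = B u a22 *\<^sub>R a11 + B u a21 *\<^sub>R a12"
    and G: "\<And>u. G p u = B u a12 *\<^sub>R a21 + B u a11 *\<^sub>R a22"
  note lin = linear_eta[OF v]
  define a where "a i = (if i = (0::nat) then a11 else a12)" for i
  define b where "b i = (if i = (0::nat) then eta p v a22 else eta p v a21)" for i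
  have perp: "eta p v y \<in> perp B (f1 p)" if "y \<in> f2 p" for y
  proof -
    have "eta p v y = - dG v y"
      using eta_eq[OF v, of y] dF_G[OF v, of y] G_id[OF that] by (simp add: linear_0[OF linear_F])
    then show ?thesis using f1_perp[OF dG_f2_perp[OF v that]] subspace_neg[OF subspace_perp] by simp
  qed
  have eta: "eta p v u = eta p v (G p u) + F p (eta p v u)" for u
    using dF_G[OF v, of u] F_dG[OF v, of "G p u"]
    by (simp add: eta_eq[OF v] GG FF linear_diff[OF linear_F] linear_0[OF linear_F])
  have "eta p v u = (\<Sum>i<2. wedge B (a i) (b i) u)" for u
  proof -
    have "eta p v (G p u) = B u a12 *\<^sub>R eta p v a21 + B u a11 *\<^sub>R eta p v a22"
      unfolding G by (simp add: linear_add[OF lin] linear_scale[OF lin])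
    moreover have "F p (eta p v u) = - B (eta p v a22) u *\<^sub>R a11 - B (eta p v a21) u *\<^sub>R a12"
      unfolding F using eta_skew[OF v, of u] by (simp add: sym[of u])
    ultimately show ?thesis
      using eta[of u] by (simp add: numeral_2_eq_2 wedge_def a_def b_def sym[of u])
  qed
  then have "eta p v = (\<lambda>u. \<Sum>i<2. wedge B (a i) (b i) u)" by (rule ext)
  moreover have "\<forall>i<2. a i \<in> f1 p \<and> b i \<in> perp B (f1 p)"
    using a perp unfolding a_def b_def by auto
  ultimately show ?thesis unfolding wedge_span_def by blast
qed

lemma eta_one_form: "one_form A (\<lambda>p. wedge_span B (f1 p) (perp B (f1 p))) eta"
  unfolding one_form_def
proof (intro conjI allI ballI impI)
  fix p v w a b u assume "v \<in> tangent_space A p" "w \<in> tangent_space A p"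
  show "eta p (\<lambda>g. a * v g + b * w g) u = a *\<^sub>R eta p v u + b *\<^sub>R eta p w u"
    unfolding wedge_part_def dir_lincomb_vector
    by (simp add: linear_add[OF linear_F] linear_scale[OF linear_F] linear_add[OF linear_G]
        linear_scale[OF linear_G] algebra_simps)
next
  fix X u assume X: "vector_field A X"
  show "msmooth A (\<lambda>p. eta p (X p) u)"
    unfolding wedge_part_def
    by (intro msmooth_on_diff msmooth_on_add open_UNIV msmooth_dir[OF X] msmooth_F msmooth_G
        msmooth_on_apply[where T = F, OF open_UNIV linear_F msmooth_F]
        msmooth_on_apply[where T = G, OF open_UNIV linear_G msmooth_G])
qed (rule eta_wedge_span)

lemma dP_f1:
  assumes v: "v \<in> tangent_space A p" and u: "u \<in> f1 p"
  shows "dP v u = dF v u"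
  using dP_eq[OF v] dG_F[OF v, of u] F_id[OF u] by simp

lemma F_dP:
  assumes v: "v \<in> tangent_space A p"
  shows "F p (dP v u) = F p (dF v u)"
  by (simp add: dP_eq[OF v] linear_add[OF linear_F] F_dG[OF v])

lemma dF_perp:
  assumes v: "v \<in> tangent_space A p" and u: "u \<in> perp B (W p)"
  shows "F p (dF v u) = dF v u"
  using dF_F[OF v, of u] F_perp[OF u] linear_0[OF linear_dF[OF v]] by simp

lemma dF_dF_f1:
  assumes v: "v \<in> tangent_space A p" and w: "w \<in> tangent_space A p" and u: "u \<in> f1 p"
  shows "dF v (dF w u) = F p (dP v (dP w u))"
  by (simp add: dP_f1[OF w u] F_dP[OF v] dF_perp[OF v dF_f1_perp[OF w u]])

lemma dP_dP_perp:
  assumes v: "v \<in> tangent_space A p" and w: "w \<in> tangent_space A p" and u: "u \<in> perp B (W p)"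
  shows "dF v (dF w u) + dG v (dG w u) = dP v (dP w u)"
proof -
  have "G p (dG w u) = dG w u" by (rule grid.dF_perp[OF swap_f w u])
  then have "dF v (dG w u) = 0" using dF_G[OF v, of "dG w u"] by simp
  moreover have "dG v (dF w u) = 0" using dG_F[OF v, of "dF w u"] dF_perp[OF w u] by simp
  ultimately show ?thesis
    by (simp add: dP_eq[OF v] dP_eq[OF w] linear_add[OF linear_dF[OF v]] linear_add[OF linear_dG[OF v]])
qed

lemma swap_P: "grid.P B f2 f1 g1 g2 = P"
  unfolding P_def grid.P_def[OF swap_f] fun_eq_iff by (simp add: add.commute)

text \<open>On \<open>f1\<close>, \<open>f2\<close> and \<open>W\<^sup>\<bottom>\<close> the sum is
  \<open>F dP dP\<close>, \<open>G dP dP\<close> and \<open>dP dP\<close>, so it inherits the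
  symmetry of \<open>dP dP\<close>. It is the quadratic term in the exterior derivative of
  \<open>eta\<close>.\<close>

lemma dFdF_dGdG_commute:
  assumes cf: "curved_flat A B W" and v: "v \<in> tangent_space A p" and w: "w \<in> tangent_space A p"
  shows "dF v (dF w u) + dG v (dG w u) = dF w (dF v u) + dG w (dG v u)"
proof -
  define S where "S v w u = dF v (dF w u) + dG v (dG w u)" for v w u
  have lin: "linear (S v w)" if "v \<in> tangent_space A p" "w \<in> tangent_space A p" for v w
    unfolding S_def
    using linear_compose_add[OF linear_compose[OF linear_dF[OF that(2)] linear_dF[OF that(1)]]
        linear_compose[OF linear_dG[OF that(2)] linear_dG[OF that(1)]]] by (simp add: o_def)
  have f1: "S v w u = F p (dP v (dP w u))"
    if u: "u \<in> f1 p" and t: "v \<in> tangent_space A p" "w \<in> tangent_space A p" for u v w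
    using dG_F[OF t(2), of u] F_id[OF u] linear_0[OF linear_dG[OF t(1)]]
    by (simp add: S_def dF_dF_f1[OF t u])
  have f2: "S v w u = G p (dP v (dP w u))"
    if u: "u \<in> f2 p" and t: "v \<in> tangent_space A p" "w \<in> tangent_space A p" for u v w
    using dF_G[OF t(2), of u] G_id[OF u] linear_0[OF linear_dF[OF t(1)]]
      grid.dF_dF_f1[OF swap_f t u] by (simp add: S_def swap_P)
  have perp: "S v w u = dP v (dP w u)"
    if u: "u \<in> perp B (W p)" and t: "v \<in> tangent_space A p" "w \<in> tangent_space A p" for u v w
    unfolding S_def by (rule dP_dP_perp[OF t u])
  note c = curved_flat_commute[OF cf v w]
  have "S v w (F p u) = S w v (F p u)" using f1[OF F_in v w] f1[OF F_in w v] c by simp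
  moreover have "S v w (G p u) = S w v (G p u)" using f2[OF G_in v w] f2[OF G_in w v] c by simp
  moreover have "S v w (u - P p u) = S w v (u - P p u)"
    using perp[OF diff_P_perp v w] perp[OF diff_P_perp w v] c by simp
  moreover have "u = F p u + G p u + (u - P p u)" by (simp add: P_def)
  ultimately have "S v w u = S w v u"
    using linear_add[OF lin[OF v w]] linear_add[OF lin[OF w v]] by metis
  then show ?thesis unfolding S_def .
qed

text \<open>Termwise differentiation leaves the products \<open>dF dF + dG dG\<close> and second
  derivatives of \<open>F\<close> and \<open>G\<close>; the latter cancel against the Lie bracket,
  the former by \<open>dFdF_dGdG_commute\<close>.\<close>

lemma eta_closed:
  assumes cf: "curved_flat A B W" and X: "vector_field A X" and Y: "vector_field A Y"
  shows "ext_deriv A eta X Y p u = 0"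
proof -
  have half: "dir (X p) (\<lambda>x. eta x (Y x) u) =
      dF (X p) (dF (Y p) u) + dG (X p) (dG (Y p) u) + F p (dir (X p) (\<lambda>x. dF (Y x) u)) +
      G p (dir (X p) (\<lambda>x. dG (Y x) u)) - dir (X p) (\<lambda>x. dG (Y x) u)"
    if X: "vector_field A X" and Y: "vector_field A Y" for X Y
  proof -
    note Xp = vector_field_tangent[OF X, of p]
    note sF = msmooth_dir[OF Y msmooth_F, of u] and sG = msmooth_dir[OF Y msmooth_G, of u]
    have m: "msmooth A (\<lambda>x. F x (dF (Y x) u))" "msmooth A (\<lambda>x. G x (dG (Y x) u))"
      using msmooth_on_apply[where T = F, OF open_UNIV linear_F msmooth_F sF]
        msmooth_on_apply[where T = G, OF open_UNIV linear_G msmooth_G sG] by auto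
    show ?thesis
      unfolding wedge_part_def dir_diff[OF Xp msmooth_on_add[OF open_UNIV m] sG] dir_add[OF Xp m]
        dir_apply[where T = F, OF Xp linear_F msmooth_F sF] dir_apply[where T = G, OF Xp linear_G msmooth_G sG]
      by (simp add: algebra_simps)
  qed
  note lF = dir_lie_bracket[OF X Y msmooth_F, of p u, symmetric]
    and lG = dir_lie_bracket[OF X Y msmooth_G, of p u, symmetric]
  show ?thesis
    unfolding ext_deriv_def half[OF X Y] half[OF Y X]
    unfolding wedge_part_def lF lG linear_diff[OF linear_F] linear_diff[OF linear_G]
    using dFdF_dGdG_commute[OF cf vector_field_tangent[OF X] vector_field_tangent[OF Y], of p u]
    by (simp add: algebra_simps)
qed

text \<open>Since \<open>eta\<close> kills \<open>f1\<close>, only \<open>- F dP dP G\<close>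
  survives in a product, and this is symmetric in the two tangent vectors.\<close>

lemma eta_bracket:
  assumes cf: "curved_flat A B W" and v: "v \<in> tangent_space A p" and w: "w \<in> tangent_space A p"
  shows "bracket_wedge eta p v w u = 0"
proof -
  have ee: "eta p v (eta p w u) = - F p (dP v (dP w (G p u)))"
    if v: "v \<in> tangent_space A p" and w: "w \<in> tangent_space A p" for v w
  proof -
    have 1: "eta p v (F p z) = 0" for z
      by (simp add: eta_eq[OF v] F_dF_F[OF v] GF_zero linear_0[OF linear_dG[OF v]])
    have 2: "eta p v (dG w (G p u)) = F p (dF v (dG w (G p u)))"
      by (simp add: eta_eq[OF v] G_dG_G[OF w] linear_0[OF linear_dG[OF v]])
    have 3: "dP w (G p u) = dG w (G p u)"
      by (simp add: dP_eq[OF w] dF_G[OF w])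
    show ?thesis
      unfolding eta_eq[OF w] linear_diff[OF linear_eta[OF v]] 1 2 3 F_dP[OF v] by simp
  qed
  show ?thesis
    unfolding bracket_wedge_def ee[OF v w] ee[OF w v] using curved_flat_commute[OF cf v w] by simp
qed

text \<open>\<open>eta\<close> kills the \<open>f1\<close>-component of
  \<open>dir w \<sigma>\<close>, which leaves a tensorial expression and removes the chosen section
  from \<open>quad_diff\<close>.\<close>

lemma eta_section_derivative:
  assumes v: "v \<in> tangent_space A p" and w: "w \<in> tangent_space A p" and \<sigma>: "\<sigma> \<in> sections A f1"
  shows "eta p v (dir w \<sigma>) = F p (dP v (dP w (\<sigma> p)))"
proof -
  have s: "msmooth A \<sigma>" "\<And>x. F x (\<sigma> x) = \<sigma> x" "\<sigma> p \<in> f1 p" using \<sigma> F_id by (auto simp: sections_def)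
  have "dir w \<sigma> = dF w (\<sigma> p) + F p (dir w \<sigma>)"
    using dir_apply[where T = F, OF w linear_F msmooth_F s(1)] unfolding s(2) .
  then have "eta p v (dir w \<sigma>) = eta p v (dF w (\<sigma> p)) + eta p v (F p (dir w \<sigma>))"
    using linear_add[OF linear_eta[OF v]] by metis
  moreover have "eta p v (F p (dir w \<sigma>)) = 0"
    by (simp add: eta_eq[OF v] F_dF_F[OF v] GF_zero linear_0[OF linear_dG[OF v]])
  moreover have "eta p v (dF w (\<sigma> p)) = F p (dP v (dP w (\<sigma> p)))"
    by (simp add: eta_eq[OF v] G_dF[OF w] linear_0[OF linear_dG[OF v]] F_dP[OF v] dP_f1[OF w s(3)])
  ultimately show ?thesis by simp
qed

text \<open>The minus signs come from \<open>\<N>\<^sup>W\<close> being \<open>dP\<close> on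
  \<open>W\<close> and \<open>- dP\<close> on \<open>W\<^sup>\<bottom>\<close>. The two halves of
  the trace, over \<open>f1\<close> and \<open>f2\<close>, give the two quadratic differentials.
  This turns regularity of \<open>W\<close> into the non-vanishing condition on
  \<open>eta\<close>.\<close>

lemma trace_NW:
  assumes v: "v \<in> tangent_space A p" and w: "w \<in> tangent_space A p"
  shows "trace_on (W p) (NW B W p v \<circ> NW B W p w) =
      - quad_diff A f1 eta p v w - quad_diff A f1 eta p w v"
proof (rule frame[of p])
  fix a11 a12 a21 a22
  assume a: "a11 \<in> f1 p \<inter> g1 p" "a12 \<in> f1 p \<inter> g2 p" "a21 \<in> f2 p \<inter> g1 p" "a22 \<in> f2 p \<inter> g2 p"
    "B a11 a22 = 1" "B a12 a21 = 1"
    and f1: "f1 p = {s *\<^sub>R a11 + t *\<^sub>R a12 | s t. True}" and f2: "f2 p = {s *\<^sub>R a21 + t *\<^sub>R a22 | s t. True}"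
  have z: "B a11 a11 = 0" "B a11 a12 = 0" "B a12 a11 = 0" "B a12 a12 = 0"
    "B a21 a21 = 0" "B a21 a22 = 0" "B a22 a21 = 0" "B a22 a22 = 0" "B a11 a21 = 0" "B a21 a11 = 0"
    "B a12 a22 = 0" "B a22 a12 = 0"
    using a null_f1[of _ p] grid.null_f1[OF swap_f, of _ p] grid.null_f1[OF transpose, of _ p]
      grid.null_f1[OF grid.swap_f[OF transpose], of _ p] by auto
  have o: "B a22 a11 = 1" "B a21 a12 = 1" using a(5,6) sym by metis+
  have ne: "a11 \<noteq> a12" "a11 \<noteq> a21" "a11 \<noteq> a22" "a12 \<noteq> a21" "a12 \<noteq> a22" "a21 \<noteq> a22"
    using a(5,6) z by auto
  have span2: "span {c, d} = {s *\<^sub>R c + t *\<^sub>R d | s t. True}" for c d :: 'v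
    unfolding span_breakdown_eq[of _ c] span_insert by (auto simp: span_singleton algebra_simps)
  \<comment> \<open>The opposite corner of the grid, that is the dual frame.\<close>
  define d where "d e = (if e = a11 then a22 else if e = a12 then a21 else if e = a21 then a12 else a11)" for e
  have d: "d a11 = a22" "d a12 = a21" "d a21 = a12" "d a22 = a11" using ne by (auto simp: d_def)
  have dual: "B e (d e') = (if e = e' then 1 else 0)" if "e \<in> {a11, a12, a21, a22}" "e' \<in> {a11, a12, a21, a22}" for e e'
    using that d z o a(5,6) ne by auto
  have q: "quad_diff A f1 eta p v w = B (F p (dP v (dP w a11))) a22 + B (F p (dP v (dP w a12))) a21"
    if v: "v \<in> tangent_space A p" and w: "w \<in> tangent_space A p" for v w
  proof -
    have "quad_diff A f1 eta p v w = (\<Sum>e\<in>{a11, a12}. B (F p (dP v (dP w e))) (d e))"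
      unfolding quad_diff_def
    proof (rule trace_on_dual_basis)
      show "span {a11, a12} = f1 p" unfolding f1 span2 ..
      show "linear (\<lambda>u. F p (dP v (dP w u)))"
        using linear_compose[OF linear_compose[OF linear_dP[OF w] linear_dP[OF v]] linear_F] by (simp add: o_def)
      fix u assume u: "u \<in> f1 p"
      let ?\<sigma> = "SOME \<sigma>. \<sigma> \<in> sections A f1 \<and> \<sigma> p = u"
      have "?\<sigma> \<in> sections A f1 \<and> ?\<sigma> p = u"
        by (rule someI[of _ "\<lambda>x. F x u"]) (use F_section F_id[OF u] in auto)
      then show "eta p v (dir w ?\<sigma>) = F p (dP v (dP w u))" using eta_section_derivative[OF v w, of ?\<sigma>] by simp
    qed (use dual F_in in auto)
    then show ?thesis using ne d by simp
  qed
  have NW: "NW B W p v u = dP v u - 2 *\<^sub>R P p (dP v u)" if v: "v \<in> tangent_space A p" for v u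
    unfolding NW_def DW_def oproj_W oproj_perp dir_const[OF v]
      dir_diff[OF v msmooth_on_const[OF open_UNIV] msmooth_P]
    by (simp add: linear_neg[OF linear_P] scaleR_2)
  have dd: "dP v (dP w u) \<in> W p" and dp: "dP w u \<in> perp B (W p)" if "u \<in> W p" for u
    using dP_perp_W[OF v] P_dP_W[OF w that] by (auto simp: in_perp_iff)
  have inW: "e \<in> W p" if "e \<in> {a11, a12, a21, a22}" for e
    using that a f1_W[of p] grid.f1_W[OF swap_f, of p] by auto
  have "trace_on (W p) (NW B W p v \<circ> NW B W p w) = (\<Sum>e\<in>{a11, a12, a21, a22}. B (- dP v (dP w e)) (d e))"
  proof (rule trace_on_dual_basis)
    show "span {a11, a12, a21, a22} = W p"
    proof
      show "span {a11, a12, a21, a22} \<subseteq> W p" using inW subspace_W by (intro span_minimal) auto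
      show "W p \<subseteq> span {a11, a12, a21, a22}"
      proof
        fix u assume "u \<in> W p"
        then obtain x y where u: "u = x + y" "x \<in> f1 p" "y \<in> f2 p" unfolding f12(2)[symmetric] sum_space_def by auto
        have "x \<in> span {a11, a12}" "y \<in> span {a21, a22}" using u f1 f2 span2 by auto
        then have "x \<in> span {a11, a12, a21, a22}" "y \<in> span {a11, a12, a21, a22}"
          using span_mono[of "{a11, a12}" "{a11, a12, a21, a22}"] span_mono[of "{a21, a22}" "{a11, a12, a21, a22}"] by auto
        then show "u \<in> span {a11, a12, a21, a22}" using u span_add by blast
      qed
    qed
    show "linear (\<lambda>u. - dP v (dP w u))"
      using linear_compose_neg[OF linear_compose[OF linear_dP[OF w] linear_dP[OF v]]] by (simp add: o_def)
    fix u assume u: "u \<in> W p"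
    show "- dP v (dP w u) \<in> W p" using dd[OF u] subspace_W subspace_neg by blast
    show "(NW B W p v \<circ> NW B W p w) u = - dP v (dP w u)"
      using P_perp[OF dp[OF u]] P_id[OF dd[OF u]] by (simp add: NW[OF v] NW[OF w] scaleR_2)
  qed (use dual in auto)
  also have "\<dots> = - B (dP v (dP w a11)) a22 - B (dP v (dP w a12)) a21 - B (dP v (dP w a21)) a12 - B (dP v (dP w a22)) a11"
    using ne d by simp
  \<comment> \<open>Self-adjointness of \<open>dP\<close> moves the entries over \<open>f2\<close>
    to entries over \<open>f1\<close> with \<open>v\<close> and \<open>w\<close> exchanged.\<close>
  also have "B (dP v (dP w a21)) a12 = B (dP w (dP v a12)) a21"
    using dP_adj[OF v, of "dP w a21" a12] dP_adj[OF w, of a21 "dP v a12"] sym[of a21 "dP w (dP v a12)"] by simp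
  also have "B (dP v (dP w a22)) a11 = B (dP w (dP v a11)) a22"
    using dP_adj[OF v, of "dP w a22" a11] dP_adj[OF w, of a22 "dP v a11"] sym[of a22 "dP w (dP v a11)"] by simp
  finally show ?thesis
    unfolding q[OF v w] q[OF w v] F_adj using G_id[of a22 p] G_id[of a21 p] a by (simp add: o_def)
qed

text \<open>The derivative of a section of \<open>f1\<close> has no \<open>f2\<close>-component, and
  pairing with \<open>f1\<close> sees nothing else of it.\<close>

lemma legendre_f1: "legendre_map A B f1"
  unfolding legendre_map_def
proof (intro conjI ballI allI)
  show "null_subbundle A B 2 f1" using planes unfolding parallel_null_planes_def by auto
  fix \<sigma> p v assume \<sigma>: "\<sigma> \<in> sections A f1" and v: "v \<in> tangent_space A p"
  have "B (dir v \<sigma>) y = 0" if "y \<in> f1 p" for y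
    using G_adj[of p "dir v \<sigma>" y] f1_section_derivative[OF v \<sigma>] F_id[OF that] by simp
  then show "dir v \<sigma> \<in> perp B (f1 p)" unfolding perp_def by simp
qed

lemma gauge_potential_eta:
  assumes cf: "curved_flat A B W" and reg: "regular_map A B W"
  shows "gauge_potential A B f1 eta"
  unfolding gauge_potential_def
proof (intro conjI allI impI ballI)
  obtain U where U: "open U" "closure U = UNIV"
    "\<And>p. p \<in> U \<Longrightarrow> \<exists>v\<in>tangent_space A p. \<exists>w\<in>tangent_space A p. trace_on (W p) (NW B W p v \<circ> NW B W p w) \<noteq> 0"
    using reg unfolding regular_map_def nonzero_on_dense_open_def by blast
  have "\<exists>v\<in>tangent_space A p. \<exists>w\<in>tangent_space A p. quad_diff A f1 eta p v w \<noteq> 0" if p: "p \<in> U" for p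
  proof -
    obtain v w where vw: "v \<in> tangent_space A p" "w \<in> tangent_space A p"
      "trace_on (W p) (NW B W p v \<circ> NW B W p w) \<noteq> 0" using U(3)[OF p] by blast
    then have "quad_diff A f1 eta p v w \<noteq> 0 \<or> quad_diff A f1 eta p w v \<noteq> 0"
      using trace_NW[OF vw(1,2)] by linarith
    then show ?thesis using vw by blast
  qed
  then show "nonzero_on_dense_open (\<lambda>p. \<exists>v\<in>tangent_space A p. \<exists>w\<in>tangent_space A p. quad_diff A f1 eta p v w \<noteq> 0)"
    unfolding nonzero_on_dense_open_def using U by blast
qed (use eta_one_form eta_closed[OF cf] eta_bracket[OF cf] in auto)

lemma gauge_equivalent_refl: "gauge_equivalent A B f \<eta> \<eta>"
  unfolding gauge_equivalent_def
proof (intro exI[of _ "\<lambda>p u. 0"] conjI allI ballI)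
  show "(\<lambda>u. 0) \<in> wedge_span B (f p) (f p)" for p
    unfolding wedge_span_def by (rule CollectI, rule exI[of _ 0]) auto
qed (auto simp: msmooth_on_const dir_const)

lemma lie_applicable_f1:
  assumes cf: "curved_flat A B W" and reg: "regular_map A B W"
  shows "lie_applicable A B f1 (gauge_class A B f1 eta)"
  unfolding lie_applicable_def using legendre_f1 gauge_potential_eta[OF assms] by blast

lemma darboux_g1:
  shows "darboux_transform A B 1 f1 (gauge_class A B f1 eta) g1"
  unfolding darboux_transform_def
proof (rule bexI[of _ eta], rule exI[of _ "\<lambda>p. f2 p \<inter> g1 p"], intro conjI allI)
  show "eta \<in> gauge_class A B f1 eta" unfolding gauge_class_def using gauge_equivalent_refl by simp
  show "null_subbundle A B 1 (\<lambda>p. f2 p \<inter> g1 p)"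
    unfolding null_subbundle_def null_space_def using lines(3) grid.null_f1[OF swap_f] by auto
  show "parallel A (d_plus 1 eta) (\<lambda>p. f2 p \<inter> g1 p)"
    unfolding parallel_def
  proof (intro ballI allI)
    fix \<sigma> p v assume \<sigma>: "\<sigma> \<in> sections A (\<lambda>p. f2 p \<inter> g1 p)" and v: "v \<in> tangent_space A p"
    then have \<sigma>': "\<sigma> \<in> sections A f2" "\<sigma> \<in> sections A g1" "msmooth A \<sigma>" by (auto simp: sections_def)
    have W: "\<sigma> x \<in> W x" for x using \<sigma>'(1) grid.f1_W[OF swap_f, of x] by (auto simp: sections_def)
    have G: "G p (\<sigma> p) = \<sigma> p" using \<sigma>'(1) G_id by (simp add: sections_def)
    have "DW B W p v \<sigma> \<in> f2 p" "DW B W p v \<sigma> \<in> g1 p"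
      using \<sigma>' v grid.parallel_f1[OF swap_f] grid.parallel_f1[OF transpose] unfolding parallel_def by blast+
    \<comment> \<open>On \<open>f2\<close> the potential is \<open>- dG\<close>, which is
      \<open>- \<N>\<^sup>W\<close> there, so with \<open>m = 1\<close> the connection
      \<open>d + eta\<close> reduces to \<open>\<D>\<^sup>W\<close>.\<close>
    moreover have "d_plus 1 eta p v \<sigma> = DW B W p v \<sigma>"
    proof -
      have "dF v (\<sigma> p) = 0" using dF_G[OF v, of "\<sigma> p"] G by simp
      then have "eta p v (\<sigma> p) = - dG v (\<sigma> p)"
        using eta_eq[OF v, of "\<sigma> p"] G by (simp add: linear_0[OF linear_F])
      moreover have "dP v (\<sigma> p) = dG v (\<sigma> p)" using dP_eq[OF v] \<open>dF v (\<sigma> p) = 0\<close> by simp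
      ultimately show ?thesis
        using W_section_derivative[OF v \<sigma>'(3) W] DW_eq[OF v W] unfolding d_plus_def by (simp add: algebra_simps)
    qed
    ultimately show "d_plus 1 eta p v \<sigma> \<in> f2 p \<inter> g1 p" by simp
  qed
  fix p
  show "\<not> f2 p \<inter> g1 p \<subseteq> f1 p"
  proof
    assume "f2 p \<inter> g1 p \<subseteq> f1 p"
    then have "f2 p \<inter> g1 p \<subseteq> {0}" using f12(1)[of p] by blast
    moreover have "dim (f2 p \<inter> g1 p) = 1" using lines(3) unfolding subbundle_def by blast
    ultimately show False using dim_one_nonzero by blast
  qed
  have "f1 p \<inter> perp B (f2 p \<inter> g1 p) = f1 p \<inter> g1 p"
  proof (rule frame[of p])
    fix a11 a12 a21 a22
    assume a: "a11 \<in> f1 p \<inter> g1 p" "a12 \<in> f1 p \<inter> g2 p" "a21 \<in> f2 p \<inter> g1 p" "B a12 a21 = 1"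
      "f1 p = {s *\<^sub>R a11 + t *\<^sub>R a12 | s t. True}"
    have 0: "B a11 a21 = 0" using a grid.null_f1[OF transpose, of a11 p a21] by simp
    show ?thesis
    proof (intro equalityI subsetI)
      fix u assume u: "u \<in> f1 p \<inter> perp B (f2 p \<inter> g1 p)"
      then obtain s t where st: "u = s *\<^sub>R a11 + t *\<^sub>R a12" using a(5) by auto
      have "B u a21 = 0" using u a(3) by (auto intro: perpD)
      then have "u = s *\<^sub>R a11" using st a(4) 0 by simp
      then show "u \<in> f1 p \<inter> g1 p" using u a(1) grid.subspace_f1[OF transpose, of p] by (simp add: subspace_scale)
    next
      fix u assume u: "u \<in> f1 p \<inter> g1 p"
      then show "u \<in> f1 p \<inter> perp B (f2 p \<inter> g1 p)"
        using grid.null_f1[OF transpose, of u p] by (auto simp: perp_def)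
    qed
  qed
  then show "g1 p = sum_space (f1 p \<inter> perp B (f2 p \<inter> g1 p)) (f2 p \<inter> g1 p)"
    using grid.f1_decomp[OF transpose, of p] by (simp add: Int_commute)
qed

end

lemma planeproj_unique:
  assumes "grid A B W f1 f2 g1 g2" "grid A B W f1 f2 h1 h2"
  shows "planeproj B f1 f2 g1 g2 = planeproj B f1 f2 h1 h2"
proof (intro ext)
  fix p u
  interpret g: grid A B W f1 f2 g1 g2 by fact
  interpret h: grid A B W f1 f2 h1 h2 by fact
  have "u = g.F p u + g.G p u + (u - g.P p u)" by (simp add: g.P_def)
  then have "h.F p u = h.F p (g.F p u) + h.F p (g.G p u) + h.F p (u - g.P p u)"
    using linear_add[OF h.linear_F] by metis
  then show "g.F p u = h.F p u"
    by (simp add: h.F_id[OF g.F_in] h.F_f2[OF g.G_in] h.F_perp[OF g.diff_P_perp])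
qed

text \<open>One gauge class of \<open>f1\<close> has to serve for all members of the opposite
  family, while the grid has to contain the member under consideration.\<close>

lemma wedge_part_unique:
  assumes "grid A B W f1 f2 g1 g2" "grid A B W f1 f2 h1 h2"
  shows "wedge_part B f1 f2 g1 g2 = wedge_part B f1 f2 h1 h2"
  using planeproj_unique[OF assms] planeproj_unique[OF grid.swap_f[OF assms(1)] grid.swap_f[OF assms(2)]]
  by (simp add: wedge_part_def fun_eq_iff)

section \<open>From Darboux pairs to curved flats\<close>

text \<open>The members (1,0), (0,1) and (1,1) yield a linear relation between \<open>n1\<close> and
  \<open>n2\<close>. If these are independent, the factors agree; otherwise a further member
  decides.\<close>

lemma proportional_pencil:
  fixes l1 l2 n1 n2 :: "'z::real_vector"
  assumes "\<And>a b. a \<noteq> 0 \<or> b \<noteq> 0 \<Longrightarrow> \<exists>c. a *\<^sub>R l1 + b *\<^sub>R l2 = c *\<^sub>R (a *\<^sub>R n1 + b *\<^sub>R n2)"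
  obtains c where "l1 = c *\<^sub>R n1" "l2 = c *\<^sub>R n2"
proof -
  obtain c1 where c1: "l1 = c1 *\<^sub>R n1" using assms[of 1 0] by auto
  obtain c2 where c2: "l2 = c2 *\<^sub>R n2" using assms[of 0 1] by auto
  obtain c3 where c3: "l1 + l2 = c3 *\<^sub>R (n1 + n2)" using assms[of 1 1] by auto
  have e: "(c1 - c3) *\<^sub>R n1 = (c3 - c2) *\<^sub>R n2" using c1 c2 c3 by (simp add: algebra_simps)
  show thesis
  proof (cases "n1 = 0 \<or> n2 = 0 \<or> c1 = c3")
    case True
    then show thesis using c1 c2 e that[of c1] that[of c2] by auto
  next
    case False
    define t where "t = (c3 - c2) / (c1 - c3)"
    have n1: "n1 = t *\<^sub>R n2"
      using arg_cong[OF e, of "\<lambda>z. (1 / (c1 - c3)) *\<^sub>R z"] False by (simp add: t_def)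
    \<comment> \<open>With \<open>n1 = t *\<^sub>R n2\<close> the member (1,-t) of the right-hand
      pencil is 0, which forces \<open>c1 = c2\<close>.\<close>
    obtain c where "1 *\<^sub>R l1 + (- t) *\<^sub>R l2 = c *\<^sub>R (1 *\<^sub>R n1 + (- t) *\<^sub>R n2)" using assms[of 1 "- t"] by auto
    then have "(c1 - c2) *\<^sub>R n1 = 0" using c1 c2 n1 by (simp add: algebra_simps)
    then show thesis using False c1 c2 that[of c1] by simp
  qed
qed

section \<open>The pencil of opposite planes, and the \<open>W\<^sup>\<bottom>\<close>-part of a
  gauge potential\<close>

context grid
begin

lemma P_dF_W:
  assumes v: "v \<in> tangent_space A p" and u: "u \<in> W p"
  shows "P p (dF v u) = 0"
proof -
  have "u = F p u + G p u" using P_id[OF u] by (simp add: P_def)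
  then have "dF v u = dF v (F p u)" using linear_add[OF linear_dF[OF v]] dF_G[OF v] by (metis add.right_neutral)
  then show ?thesis using dF_f1_perp[OF v F_in] in_perp_iff by simp
qed

lemmas P_dG_W = grid.P_dF_W[OF swap_f, unfolded swap_P]

text \<open>The endomorphism \<open>F + t G\<close> of \<open>W\<close> is parallel and scales the form of \<open>W\<close> by \<open>t\<close>. Applied
  to a third plane \<open>k\<close> of the family of \<open>f1\<close> and \<open>f2\<close> it sweeps out the rest of that family.\<close>

lemma pencil_parallel_null_planes:
  assumes k: "k \<in> parallel_null_planes A B W" and t: "t \<noteq> 0"
  shows "(\<lambda>x. (\<lambda>u. F x u + t *\<^sub>R G x u) ` k x) \<in> parallel_null_planes A B W"
proof -
  define T where "T t x u = F x u + t *\<^sub>R G x u" for t x u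
  have linT: "linear (T t x)" for t x
    unfolding T_def by (intro linear_compose_add linear_F linear_compose[OF linear_G linear_scaleR, unfolded o_def])
  have smT: "msmooth A (\<lambda>x. T t x u)" for t u
    unfolding T_def by (intro msmooth_on_add msmooth_F msmooth_on_scaleR msmooth_on_const msmooth_G open_UNIV)
  \<comment> \<open>On \<open>W\<close> the maps \<open>T t\<close> multiply like their parameters,
    so \<open>T (1 / t)\<close> inverts \<open>T t\<close>.\<close>
  have TT: "T s x (T t x u) = u" if "s * t = 1" "u \<in> W x" for s t x u
  proof -
    have "T s x (T t x u) = F x u + (s * t) *\<^sub>R G x u"
      by (simp add: T_def linear_add[OF linear_F] linear_add[OF linear_G] linear_scale[OF linear_F]
          linear_scale[OF linear_G] FF GG FG_zero GF_zero)
    then show ?thesis using that P_id[OF that(2)] by (simp add: P_def)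
  qed
  have TW: "T t x u \<in> W x" for t x u
    unfolding T_def using F_in[of x u] G_in[of x u] f1_W[of x] grid.f1_W[OF swap_f, of x] subspace_W
    by (meson subsetD subspace_add subspace_scale)
  have TP: "T t x (P x u) = T t x u" for t x u by (simp add: T_def FP GP)
  have inv: "(1 / t) * t = 1" "t * (1 / t) = 1" using t by auto
  have kW: "k x \<subseteq> W x" and sk: "subspace (k x)" "dim (k x) = 2" for x
    using k unfolding parallel_null_planes_def null_subbundle_def subbundle_def by auto
  have nullk: "B u w = 0" if "u \<in> k x" "w \<in> k x" for u w x
    using k that unfolding parallel_null_planes_def null_subbundle_def null_space_def by auto
  let ?E = "\<lambda>x. T t x ` k x"
  have "subbundle A 2 ?E" unfolding subbundle_def
  proof (intro conjI allI)
    fix p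
    show "subspace (?E p)" by (rule linear_subspace_image[OF linT sk(1)])
    have "inj_on (T t p) (k p)"
      by (rule inj_on_inverseI[of _ "T (1 / t) p"]) (use TT[OF inv(1)] kW in auto)
    then have "inj_on (T t p) (span (k p))" by (simp add: span_eq_iff[THEN iffD2, OF sk(1)])
    then show "dim (?E p) = 2" using dim_image_eq[OF linT] sk(2) by simp
    obtain U s where U: "open U" "p \<in> U" "\<forall>i<2. msmooth_on A U (s i)" "\<forall>x\<in>U. k x = span ((\<lambda>i. s i x) ` {..<2::nat})"
      using k unfolding parallel_null_planes_def null_subbundle_def subbundle_def by blast
    have "\<forall>i<2. msmooth_on A U (\<lambda>x. T t x (s i x))"
      using U(3) msmooth_on_apply[OF U(1) linT msmooth_on_subset[OF smT]] by auto
    moreover have "\<forall>x\<in>U. ?E x = span ((\<lambda>i. T t x (s i x)) ` {..<2::nat})"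
      using U(4) by (simp add: linear_span_image[OF linT, symmetric] image_image)
    ultimately show "\<exists>U. open U \<and> p \<in> U \<and> (\<exists>s. (\<forall>i<2. msmooth_on A U (s i)) \<and>
        (\<forall>x\<in>U. ?E x = span ((\<lambda>i. s i x) ` {..<2::nat})))"
      using U(1,2) by (intro exI[of _ U] conjI exI[of _ "\<lambda>i x. T t x (s i x)"]) auto
  qed
  moreover have "null_space B (?E p)" for p
    unfolding null_space_def
  proof (intro ballI)
    fix a b assume "a \<in> ?E p" "b \<in> ?E p"
    then obtain u w where uw: "a = T t p u" "b = T t p w" "u \<in> k p" "w \<in> k p" by auto
    have FF0: "B (F p x) (F p y) = 0" "B (G p x) (G p y) = 0" for x y
      by (simp_all add: F_adj G_adj GF_zero FG_zero)
    have "B a b = t * (B (F p u) (G p w) + B (G p u) (F p w))"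
      unfolding uw T_def by (simp add: FF0 algebra_simps)
    also have "B (F p u) (G p w) + B (G p u) (F p w) = B (P p u) w"
      by (simp add: F_adj G_adj FF GG P_def)
    also have "\<dots> = 0" using P_id uw kW nullk by (metis subsetD)
    finally show "B a b = 0" by simp
  qed
  moreover have "?E p \<subseteq> W p" for p using TW by auto
  moreover have "parallel A (DW B W) ?E"
    unfolding parallel_def
  proof (intro ballI allI)
    fix \<sigma> p v assume \<sigma>: "\<sigma> \<in> sections A ?E" and v: "v \<in> tangent_space A p"
    \<comment> \<open>Pulled back by the inverse, \<open>\<sigma>\<close> is a section of
      \<open>k\<close>. The derivative of \<open>T t\<close> maps \<open>W\<close> into
      \<open>W\<^sup>\<bottom>\<close> and is invisible to \<open>P\<close>, so
      \<open>\<D>\<^sup>W \<sigma>\<close> is the image of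
      \<open>\<D>\<^sup>W \<rho>\<close>.\<close>
    define \<rho> where "\<rho> x = T (1 / t) x (\<sigma> x)" for x
    have s: "msmooth A \<sigma>" "\<And>x. \<sigma> x \<in> ?E x" using \<sigma> by (auto simp: sections_def)
    have \<rho>k: "\<rho> x \<in> k x" for x using s(2)[of x] TT[OF inv(1)] kW unfolding \<rho>_def by fastforce
    have \<rho>s: "msmooth A \<rho>" unfolding \<rho>_def by (rule msmooth_on_apply[OF open_UNIV linT smT s(1)])
    have \<sigma>\<rho>: "\<sigma> x = T t x (\<rho> x)" for x
      unfolding \<rho>_def using TT[OF inv(2), of "\<sigma> x" x] s(2)[of x] TW by fastforce
    have "dir v \<sigma> = dir v (\<lambda>x. T t x (\<rho> p)) + T t p (dir v \<rho>)"
      unfolding \<sigma>\<rho>[abs_def] by (rule dir_apply[where T = "T t", OF v linT smT \<rho>s])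
    moreover have "dir v (\<lambda>x. T t x (\<rho> p)) = dF v (\<rho> p) + t *\<^sub>R dG v (\<rho> p)"
      unfolding T_def
      by (simp add: dir_add[OF v msmooth_F msmooth_on_linear[OF open_UNIV bounded_linear_scaleR_right msmooth_G]]
          dir_linear[OF v linear_scaleR msmooth_G])
    moreover have "P p (dF v (\<rho> p) + t *\<^sub>R dG v (\<rho> p)) = 0"
      using P_dF_W[OF v subsetD[OF kW \<rho>k]] P_dG_W[OF v subsetD[OF kW \<rho>k]]
      by (simp add: linear_add[OF linear_P] linear_scale[OF linear_P])
    ultimately have "P p (dir v \<sigma>) = T t p (P p (dir v \<rho>))"
      using P_id[OF TW] by (simp add: linear_add[OF linear_P] TP)
    moreover have "DW B W p v \<sigma> = P p (dir v \<sigma>)" by (rule DW_eq[OF v]) (subst \<sigma>\<rho>, rule TW)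
    moreover have "DW B W p v \<rho> = P p (dir v \<rho>)" by (rule DW_eq[OF v]) (use \<rho>k kW in blast)
    moreover have "DW B W p v \<rho> \<in> k p"
      using k v \<rho>k \<rho>s unfolding parallel_null_planes_def parallel_def sections_def by blast
    ultimately show "DW B W p v \<sigma> \<in> ?E p" by simp
  qed
  ultimately show ?thesis
    unfolding parallel_null_planes_def null_subbundle_def T_def by blast
qed

lemma
  assumes \<eta>: "gauge_potential A B f1 \<eta>" and v: "v \<in> tangent_space A p"
  shows linear_potential: "linear (\<eta> p v)"
    and potential_skew: "B (\<eta> p v x) y = - B x (\<eta> p v y)"
    and potential_f1: "x \<in> f1 p \<Longrightarrow> \<eta> p v x = 0"
    and potential_perp: "x \<in> perp B (W p) \<Longrightarrow> \<eta> p v x \<in> f1 p"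
proof -
  have w: "\<eta> p v \<in> wedge_span B (f1 p) (perp B (f1 p))"
    using \<eta> v unfolding gauge_potential_def one_form_def by blast
  show "linear (\<eta> p v)" by (rule wedge_span_linear[OF w])
  show "B (\<eta> p v x) y = - B x (\<eta> p v y)" by (rule wedge_span_skew[OF w])
  show "\<eta> p v x = 0" if "x \<in> f1 p"
    by (rule wedge_span_annihilates[OF w _ that]) (use null_f1 in \<open>auto simp: null_space_def\<close>)
  show "\<eta> p v x \<in> f1 p" if "x \<in> perp B (W p)"
    by (rule wedge_span_perp[OF w subspace_f1 f1_perp[OF that]])
qed

text \<open>Extend \<open>\<xi>\<close> to the section \<open>\<xi> - P x \<xi>\<close> of
  \<open>W\<^sup>\<bottom>\<close>. Its image under \<open>\<eta>\<close> lies in \<open>f1\<close>,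
  hence in \<open>W\<close>, so the \<open>W\<^sup>\<bottom>\<close>-part of the derivative of that
  image is \<open>dP\<close> of its value. No derivative of \<open>\<eta>\<close> remains.\<close>

lemma potential_closed:
  assumes \<eta>: "gauge_potential A B f1 \<eta>" and X: "vector_field A X" and Y: "vector_field A Y"
    and \<xi>: "\<xi> \<in> perp B (W p)"
  defines "q \<equiv> \<lambda>z. z - P p z"
  shows "dP (X p) (\<eta> p (Y p) \<xi>) + q (\<eta> p (Y p) (dP (X p) \<xi>)) =
    dP (Y p) (\<eta> p (X p) \<xi>) + q (\<eta> p (X p) (dP (Y p) \<xi>))"
proof -
  have half: "q (dir (X p) (\<lambda>x. \<eta> x (Y x) \<xi>)) = dP (X p) (\<eta> p (Y p) \<xi>) + q (\<eta> p (Y p) (dP (X p) \<xi>))"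
    if X: "vector_field A X" and Y: "vector_field A Y" for X Y
  proof -
    note Xp = vector_field_tangent[OF X, of p] and Yx = vector_field_tangent[OF Y]
    define T where "T x u = \<eta> x (Y x) u" for x u
    have lin: "linear (T x)" for x using linear_potential[OF \<eta> Yx] unfolding T_def by simp
    have sm: "msmooth A (\<lambda>x. T x u)" for u
      using \<eta> Y unfolding gauge_potential_def one_form_def T_def by blast
    define \<sigma> where "\<sigma> x = \<xi> - P x \<xi>" for x
    have \<sigma>: "msmooth A \<sigma>" unfolding \<sigma>_def by (intro msmooth_on_diff msmooth_on_const msmooth_P open_UNIV)
    have d\<sigma>: "dir (X p) \<sigma> = - dP (X p) \<xi>"
      unfolding \<sigma>_def by (simp add: dir_diff[OF Xp msmooth_on_const msmooth_P] dir_const[OF Xp])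
    have \<sigma>p: "\<sigma> p = \<xi>" unfolding \<sigma>_def using P_perp[OF \<xi>] by simp
    have T\<sigma>: "msmooth A (\<lambda>x. T x (\<sigma> x))" by (rule msmooth_on_apply[OF open_UNIV lin sm \<sigma>])
    have d1: "dir (X p) (\<lambda>x. T x (\<sigma> x)) = dir (X p) (\<lambda>x. T x \<xi>) - T p (dP (X p) \<xi>)"
      using dir_apply[OF Xp lin sm \<sigma>] unfolding \<sigma>p d\<sigma> by (simp add: linear_neg[OF lin])
    have "T x (\<sigma> x) \<in> W x" for x
      using potential_perp[OF \<eta> Yx diff_P_perp] f1_W unfolding T_def \<sigma>_def by blast
    then have "dir (X p) (\<lambda>x. T x (\<sigma> x)) - P p (dir (X p) (\<lambda>x. T x (\<sigma> x))) = dP (X p) (T p \<xi>)"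
      using W_section_derivative[OF Xp T\<sigma>] unfolding \<sigma>p by blast
    then show ?thesis
      unfolding d1 unfolding q_def T_def by (simp add: linear_diff[OF linear_P] algebra_simps)
  qed
  have "\<eta> p (lie_bracket A X Y p) \<xi> \<in> W p"
    using potential_perp[OF \<eta> lie_bracket_tangent[OF X Y] \<xi>] f1_W by blast
  then have "q (\<eta> p (lie_bracket A X Y p) \<xi>) = 0" unfolding q_def using P_id by simp
  moreover have "dir (X p) (\<lambda>x. \<eta> x (Y x) \<xi>) - dir (Y p) (\<lambda>x. \<eta> x (X x) \<xi>) - \<eta> p (lie_bracket A X Y p) \<xi> = 0"
    using \<eta> X Y unfolding gauge_potential_def ext_deriv_def by blast
  then have "q (dir (X p) (\<lambda>x. \<eta> x (Y x) \<xi>) - dir (Y p) (\<lambda>x. \<eta> x (X x) \<xi>) - \<eta> p (lie_bracket A X Y p) \<xi>) = 0"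
    unfolding q_def by (simp add: linear_0[OF linear_P])
  ultimately have "q (dir (X p) (\<lambda>x. \<eta> x (Y x) \<xi>)) = q (dir (Y p) (\<lambda>x. \<eta> x (X x) \<xi>))"
    unfolding q_def linear_diff[OF linear_P] by (simp add: algebra_simps)
  then show ?thesis unfolding half[OF X Y] half[OF Y X] .
qed

text \<open>Moving the parallel line of a Darboux transform by the gauge transformation \<open>1 - m \<tau>\<close> keeps it
  inside \<open>h\<close> and makes a single representative \<open>\<eta>\<close> serve for all transforms.\<close>

lemma darboux_transform_point:
  assumes \<eta>: "gauge_potential A B f1 \<eta>" and dt: "darboux_transform A B m f1 (gauge_class A B f1 \<eta>) h"
    and hW: "\<And>x. h x \<subseteq> W x" and sub_h: "subspace (h p)"
  obtains u where "u \<in> h p" "u \<notin> f1 p"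
    "\<And>v. v \<in> tangent_space A p \<Longrightarrow> dP v u + m *\<^sub>R (\<eta> p v u - P p (\<eta> p v u)) = 0"
proof -
  obtain \<eta>' s where \<eta>': "gauge_equivalent A B f1 \<eta> \<eta>'" and s: "null_subbundle A B 1 s" "parallel A (d_plus m \<eta>') s"
    "\<And>p. \<not> s p \<subseteq> f1 p" "\<And>p. h p = sum_space (f1 p \<inter> perp B (s p)) (s p)"
    using dt unfolding darboux_transform_def gauge_class_def by blast
  obtain \<tau> where \<tau>: "\<And>p. \<tau> p \<in> wedge_span B (f1 p) (f1 p)" "\<And>u. msmooth A (\<lambda>p. \<tau> p u)"
    "\<And>p v u. v \<in> tangent_space A p \<Longrightarrow> \<eta>' p v u = \<eta> p v u - dir v (\<lambda>x. \<tau> x u)"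
    using \<eta>' unfolding gauge_equivalent_def by blast
  have ss: "subspace (s p)" and ds: "dim (s p) = 1" for p using s(1) unfolding null_subbundle_def subbundle_def by auto
  have sh: "s p \<subseteq> h p" for p
    unfolding s(4) sum_space_def using subspace_0[OF subspace_f1] subspace_0[OF subspace_perp] by force
  have fh: "f1 p \<inter> perp B (s p) \<subseteq> h p"
    unfolding s(4) sum_space_def using subspace_0[OF ss] by force
  obtain u where u: "u \<in> s p" "u \<notin> f1 p" using s(3) by blast
  have "u \<noteq> 0" using u subspace_0[OF subspace_f1] by auto
  then have su: "s p = span {u}" using dim_one_span[OF ss ds u(1)] by simp
  have \<tau>f: "\<tau> x w \<in> f1 x" for x w by (rule wedge_span_in[OF \<tau>(1) subspace_f1])
  have "B (\<tau> p u) u = 0" using wedge_span_skew[OF \<tau>(1), of p u u] by (simp add: sym)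
  then have "\<tau> p u \<in> perp B (s p)" unfolding su perp_def by (auto simp: span_singleton)
  then have \<tau>h: "\<tau> p u \<in> h p" using \<tau>f fh by blast
  have uW: "u \<in> W p" using u sh hW by blast
  show thesis
  proof (rule that[of "u - m *\<^sub>R \<tau> p u"])
    show "u - m *\<^sub>R \<tau> p u \<in> h p" using u sh \<tau>h sub_h by (meson subsetD subspace_diff subspace_scale)
    show "u - m *\<^sub>R \<tau> p u \<notin> f1 p"
      using u(2) \<tau>f subspace_f1 subspace_add[of "f1 p" "u - m *\<^sub>R \<tau> p u" "m *\<^sub>R \<tau> p u"] subspace_scale by fastforce
    fix v assume v: "v \<in> tangent_space A p"
    obtain \<sigma> where \<sigma>: "\<sigma> \<in> sections A s" "\<sigma> p = u"
      using line_subbundle_section[where E = s and p = p and u = u] s(1) u(1) unfolding null_subbundle_def by blast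
    have \<sigma>W: "msmooth A \<sigma>" "\<sigma> x \<in> W x" for x using \<sigma> sh hW unfolding sections_def by blast+
    have "d_plus m \<eta>' p v \<sigma> \<in> s p" using s(2) \<sigma> v unfolding parallel_def by blast
    then have "P p (dir v \<sigma> + m *\<^sub>R \<eta>' p v u) = dir v \<sigma> + m *\<^sub>R \<eta>' p v u"
      unfolding d_plus_def \<sigma>(2) using sh hW P_id by blast
    then have "(dir v \<sigma> - P p (dir v \<sigma>)) + m *\<^sub>R (\<eta>' p v u - P p (\<eta>' p v u)) = 0"
      by (simp add: linear_add[OF linear_P] linear_scale[OF linear_P] algebra_simps)
    then have 1: "dP v u + m *\<^sub>R (\<eta>' p v u - P p (\<eta>' p v u)) = 0"
      unfolding W_section_derivative[OF v \<sigma>W] \<sigma>(2) .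
    \<comment> \<open>As \<open>\<tau> x u\<close> stays in \<open>W\<close>, passing from
      \<open>\<eta>'\<close> to \<open>\<eta>\<close> changes the
      \<open>W\<^sup>\<bottom>\<close>-part by \<open>dP\<close> of
      \<open>m *\<^sub>R \<tau> p u\<close>, which the shift of \<open>u\<close>
      compensates.\<close>
    have 2: "dir v (\<lambda>x. \<tau> x u) - P p (dir v (\<lambda>x. \<tau> x u)) = dP v (\<tau> p u)"
      by (rule W_section_derivative[OF v \<tau>(2)]) (use \<tau>f f1_W in blast)
    have 3: "\<eta> p v (u - m *\<^sub>R \<tau> p u) = \<eta> p v u"
      by (simp add: linear_diff[OF linear_potential[OF \<eta> v]] linear_scale[OF linear_potential[OF \<eta> v]]
          potential_f1[OF \<eta> v \<tau>f])
    show "dP v (u - m *\<^sub>R \<tau> p u) + m *\<^sub>R (\<eta> p v (u - m *\<^sub>R \<tau> p u) - P p (\<eta> p v (u - m *\<^sub>R \<tau> p u))) = 0"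
      unfolding 3 linear_diff[OF linear_dP[OF v]] linear_scale[OF linear_dP[OF v]] 2[symmetric]
      using 1 unfolding \<tau>(3)[OF v] by (simp add: linear_diff[OF linear_P] algebra_simps)
  qed
qed

text \<open>With \<open>z1, z2\<close> spanning a null complement of \<open>f1\<close> on which \<open>m \<eta>\<close> and \<open>- \<N>\<^sup>W\<close> have the same
  \<open>W\<^sup>\<bottom>\<close>-part, \<open>d \<eta> = 0\<close> turns into the flatness of \<open>\<D>\<^sup>W\<close> on \<open>W\<^sup>\<bottom>\<close>.\<close>

lemma commute_of_null_complement:
  assumes \<eta>: "gauge_potential A B f1 \<eta>" and m: "m \<noteq> 0"
    and X: "vector_field A X" and Y: "vector_field A Y" and \<xi>: "\<xi> \<in> perp B (W p)"
    and x: "x1 \<in> f1 p" "x2 \<in> f1 p" and z: "z1 \<in> W p" "z2 \<in> W p"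
    and W: "\<And>w. w \<in> W p \<Longrightarrow> \<exists>a b c d. w = a *\<^sub>R x1 + b *\<^sub>R x2 + c *\<^sub>R z1 + d *\<^sub>R z2"
    and B: "B x1 z1 = 0" "B x2 z2 = 0" "B z1 z1 = 0" "B z1 z2 = 0" "B z2 z2 = 0" "B x1 z2 = h" "B x2 z1 = - h"
    and h: "h \<noteq> 0"
    and N: "\<And>v z. v = X p \<or> v = Y p \<Longrightarrow> z = z1 \<or> z = z2 \<Longrightarrow> dP v z + m *\<^sub>R (\<eta> p v z - P p (\<eta> p v z)) = 0"
  shows "dP (X p) (dP (Y p) \<xi>) = dP (Y p) (dP (X p) \<xi>)"
proof -
  define q where "q z = z - P p z" for z
  have linq: "linear q" unfolding q_def by (intro linear_compose_sub linear_id[unfolded id_def] linear_P)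
  \<comment> \<open>Up to the factor \<open>h\<close>, the basis dual to
    \<open>x1, x2, z1, z2\<close> is \<open>z2, - z1, - x2, x1\<close>.\<close>
  have W_eq: "h *\<^sub>R w = B w z2 *\<^sub>R x1 - B w z1 *\<^sub>R x2 + B w x1 *\<^sub>R z2 - B w x2 *\<^sub>R z1" if w: "w \<in> W p" for w
  proof -
    obtain a b c d where w: "w = a *\<^sub>R x1 + b *\<^sub>R x2 + c *\<^sub>R z1 + d *\<^sub>R z2" using W[OF w] by blast
    have "B x1 x1 = 0" "B x1 x2 = 0" "B x2 x1 = 0" "B x2 x2 = 0" using x null_f1 by auto
    then have "B w z2 = a * h" "B w z1 = - (b * h)" "B w x1 = d * h" "B w x2 = - (c * h)"
      using B unfolding w by (simp_all add: sym[of z1 x1] sym[of z1 x2] sym[of z2 x1] sym[of z2 x2] sym[of z2 z1])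
    then show ?thesis unfolding w by (simp add: algebra_simps)
  qed
  have main: "dP v (dP w \<xi>) = m *\<^sub>R (dP v (\<eta> p w \<xi>) - q (\<eta> p v (dP w \<xi>)))"
    if v': "v = X p \<or> v = Y p" and w': "w = X p \<or> w = Y p" for v w
  proof -
    have v: "v \<in> tangent_space A p" and w: "w \<in> tangent_space A p"
      using v' w' vector_field_tangent X Y by auto
    note lE = linear_dP[OF v] and l\<eta> = linear_potential[OF \<eta> v]
    have \<eta>f: "\<eta> p w \<xi> \<in> f1 p" by (rule potential_perp[OF \<eta> w \<xi>])
    \<comment> \<open>By skew-symmetry the hypothesis on \<open>z1\<close> and \<open>z2\<close>
      says that \<open>m *\<^sub>R \<eta> p w \<xi>\<close> is the component of
      \<open>dP w \<xi>\<close> in \<open>f1\<close> along \<open>z1\<close> and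
      \<open>z2\<close>.\<close>
    have \<eta>z: "m * B (\<eta> p w \<xi>) z = B \<xi> (dP w z)" if "z = z1 \<or> z = z2" for z
    proof -
      have "B \<xi> (dP w z + m *\<^sub>R (\<eta> p w z - P p (\<eta> p w z))) = 0" using N[OF w' that] by simp
      moreover have "B \<xi> (P p (\<eta> p w z)) = 0" by (rule perpD[OF \<xi> P_in])
      ultimately show ?thesis using potential_skew[OF \<eta> w, of \<xi> z] by (simp add: algebra_simps)
    qed
    have \<eta>x: "B (\<eta> p w \<xi>) x1 = 0" "B (\<eta> p w \<xi>) x2 = 0" using null_f1[OF \<eta>f] x by auto
    have "h *\<^sub>R \<eta> p w \<xi> = B (\<eta> p w \<xi>) z2 *\<^sub>R x1 - B (\<eta> p w \<xi>) z1 *\<^sub>R x2"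
      using W_eq[of "\<eta> p w \<xi>"] \<eta>f f1_W \<eta>x by auto
    then have "m *\<^sub>R h *\<^sub>R \<eta> p w \<xi> = (m * B (\<eta> p w \<xi>) z2) *\<^sub>R x1 - (m * B (\<eta> p w \<xi>) z1) *\<^sub>R x2"
      by (simp add: scaleR_diff_right)
    then have "m *\<^sub>R h *\<^sub>R \<eta> p w \<xi> = B \<xi> (dP w z2) *\<^sub>R x1 - B \<xi> (dP w z1) *\<^sub>R x2"
      using \<eta>z by simp
    from arg_cong[OF this, of "dP v"]
    have 1: "m *\<^sub>R h *\<^sub>R dP v (\<eta> p w \<xi>) = B \<xi> (dP w z2) *\<^sub>R dP v x1 - B \<xi> (dP w z1) *\<^sub>R dP v x2"
      by (simp add: linear_diff[OF lE] linear_scale[OF lE])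
    have E: "h *\<^sub>R dP w \<xi> = B \<xi> (dP w z2) *\<^sub>R x1 - B \<xi> (dP w z1) *\<^sub>R x2 + B \<xi> (dP w x1) *\<^sub>R z2 - B \<xi> (dP w x2) *\<^sub>R z1"
      using W_eq[OF dP_perp_W[OF w \<xi>]] by (simp add: dP_adj[OF w])
    from arg_cong[OF E, of "dP v"]
    have 2: "h *\<^sub>R dP v (dP w \<xi>) = B \<xi> (dP w z2) *\<^sub>R dP v x1 - B \<xi> (dP w z1) *\<^sub>R dP v x2 +
        B \<xi> (dP w x1) *\<^sub>R dP v z2 - B \<xi> (dP w x2) *\<^sub>R dP v z1"
      by (simp add: linear_diff[OF lE] linear_add[OF lE] linear_scale[OF lE])
    have qz: "m *\<^sub>R q (\<eta> p v z) = - dP v z" if "z = z1 \<or> z = z2" for z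
      using N[OF v' that] unfolding q_def by (simp add: add_eq_0_iff)
    from arg_cong[OF E, of "\<lambda>u. m *\<^sub>R q (\<eta> p v u)"]
    have "m *\<^sub>R h *\<^sub>R q (\<eta> p v (dP w \<xi>)) =
        B \<xi> (dP w x1) *\<^sub>R m *\<^sub>R q (\<eta> p v z2) - B \<xi> (dP w x2) *\<^sub>R m *\<^sub>R q (\<eta> p v z1)"
      by (simp add: linear_diff[OF l\<eta>] linear_add[OF l\<eta>] linear_scale[OF l\<eta>] potential_f1[OF \<eta> v] x
          linear_diff[OF linq] linear_scale[OF linq] scaleR_diff_right mult.commute)
    then have 3: "m *\<^sub>R h *\<^sub>R q (\<eta> p v (dP w \<xi>)) = B \<xi> (dP w x2) *\<^sub>R dP v z1 - B \<xi> (dP w x1) *\<^sub>R dP v z2"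
      using qz by simp
    have "h *\<^sub>R dP v (dP w \<xi>) = h *\<^sub>R (m *\<^sub>R (dP v (\<eta> p w \<xi>) - q (\<eta> p v (dP w \<xi>))))"
      using 1 2 3 by (simp add: scaleR_diff_right mult.commute)
    then show ?thesis by (rule scaleR_left_imp_eq[OF h])
  qed
  have "dP (X p) (\<eta> p (Y p) \<xi>) + q (\<eta> p (Y p) (dP (X p) \<xi>)) =
      dP (Y p) (\<eta> p (X p) \<xi>) + q (\<eta> p (X p) (dP (Y p) \<xi>))"
    unfolding q_def by (rule potential_closed[OF \<eta> X Y \<xi>])
  \<comment> \<open>Rearranged, closedness says that the right-hand side of \<open>main\<close> is
    symmetric in \<open>X p\<close> and \<open>Y p\<close>.\<close>
  then have "dP (X p) (\<eta> p (Y p) \<xi>) - q (\<eta> p (X p) (dP (Y p) \<xi>)) =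
      dP (Y p) (\<eta> p (X p) \<xi>) - q (\<eta> p (Y p) (dP (X p) \<xi>))"
    by (simp add: algebra_simps)
  then show ?thesis
    using main[of "X p" "Y p"] main[of "Y p" "X p"] by simp
qed


text \<open>\<open>H\<close> stands for the opposite family. Its members \<open>g1\<close> and
  \<open>g2\<close> and the images of the third plane \<open>k\<close> under the pencil supply a
  plane for every ratio of the coefficients \<open>a\<close> and \<open>b\<close>.\<close>

lemma flat_perp_of_darboux_family:
  assumes \<eta>: "gauge_potential A B f1 \<eta>" and m: "m \<noteq> 0"
    and k: "grid A B W f1 f2 g1 k" and gk: "\<And>p. g2 p \<inter> k p = {0}"
    and H: "H \<subseteq> parallel_null_planes A B W" "g1 \<in> H" "g2 \<in> H"
      "\<And>t. t \<noteq> 0 \<Longrightarrow> (\<lambda>x. (\<lambda>u. planeproj B g1 g2 f1 f2 x u + t *\<^sub>R planeproj B g2 g1 f1 f2 x u) ` k x) \<in> H"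
    and dt: "\<And>h. h \<in> H \<Longrightarrow> darboux_transform A B m f1 (gauge_class A B f1 \<eta>) h"
  shows "flat_on A (DW B W) (\<lambda>p. perp B (W p))"
  unfolding flat_perp_iff
proof (intro allI impI ballI)
  fix X Y p \<xi> assume X: "vector_field A X" and Y: "vector_field A Y" and \<xi>: "\<xi> \<in> perp B (W p)"
  note Xp = vector_field_tangent[OF X, of p] and Yp = vector_field_tangent[OF Y, of p]
  note k' = grid.transpose[OF grid.swap_g[OF k]]
  note g1' = transpose and g2' = grid.swap_f[OF transpose]
  \<comment> \<open>Splitting vectors \<open>x\<close> and \<open>y\<close> of the two lines of
    \<open>k\<close> along \<open>g1\<close> and \<open>g2\<close> scales the basis
    \<open>x1, x2\<close> of \<open>f1\<close> and the basis \<open>y1, y2\<close> of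
    \<open>f2\<close> compatibly.\<close>
  have "dim (f1 p \<inter> k p) = 1" "dim (f2 p \<inter> k p) = 1"
    using grid.lines[OF k] unfolding subbundle_def by auto
  then obtain x y where x: "x \<in> f1 p \<inter> k p" "x \<noteq> 0" and y: "y \<in> f2 p \<inter> k p" "y \<noteq> 0"
    using dim_one_nonzero by metis
  have "x \<in> sum_space (f1 p \<inter> g1 p) (f1 p \<inter> g2 p)" using x f1_decomp by blast
  then obtain x1 x2 where x12: "x = x1 + x2" "x1 \<in> f1 p \<inter> g1 p" "x2 \<in> f1 p \<inter> g2 p"
    unfolding sum_space_def by blast
  have "y \<in> sum_space (f2 p \<inter> g1 p) (f2 p \<inter> g2 p)" using y grid.f1_decomp[OF swap_f] by blast
  then obtain y1 y2 where y12: "y = y1 + y2" "y1 \<in> f2 p \<inter> g1 p" "y2 \<in> f2 p \<inter> g2 p"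
    unfolding sum_space_def by blast
  have ne: "x1 \<noteq> 0" "x2 \<noteq> 0" "y1 \<noteq> 0" "y2 \<noteq> 0"
  proof -
    have k0: "u = 0" if "u \<in> k p" "u \<in> g1 p \<or> u \<in> g2 p" for u
      using that gk[of p] grid.g12(1)[OF k, of p] by blast
    show "x1 \<noteq> 0" "x2 \<noteq> 0" using k0[of x] x x12 by auto
    show "y1 \<noteq> 0" "y2 \<noteq> 0" using k0[of y] y y12 by auto
  qed
  have spans: "f1 p \<inter> g1 p = span {x1}" "f1 p \<inter> g2 p = span {x2}" "f2 p \<inter> g1 p = span {y1}"
    "f2 p \<inter> g2 p = span {y2}" "f1 p \<inter> k p = span {x}" "f2 p \<inter> k p = span {y}"
    using line_span[OF x12(2) ne(1)] grid.line_span[OF swap_g x12(3) ne(2)] grid.line_span[OF swap_f y12(2) ne(3)]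
      grid.line_span[OF grid.swap_f[OF swap_g] y12(3) ne(4)] grid.line_span[OF grid.swap_g[OF k] x]
      grid.line_span[OF grid.swap_f[OF grid.swap_g[OF k]] y] by auto
  have ss: "sum_space (span {a}) (span {b}) = {s *\<^sub>R a + t *\<^sub>R b | s t. True}" for a b :: 'v
    unfolding sum_space_def span_singleton by blast
  have f1_eq: "f1 p = {s *\<^sub>R x1 + t *\<^sub>R x2 | s t. True}"
    using f1_decomp[of p] unfolding spans ss .
  have f2_eq: "f2 p = {s *\<^sub>R y1 + t *\<^sub>R y2 | s t. True}"
    using grid.f1_decomp[OF swap_f, of p] unfolding spans ss .
  have g1_eq: "g1 p = {s *\<^sub>R x1 + t *\<^sub>R y1 | s t. True}"
    using grid.f1_decomp[OF g1', of p] unfolding Int_commute[of "g1 p"] spans ss .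
  have g2_eq: "g2 p = {s *\<^sub>R x2 + t *\<^sub>R y2 | s t. True}"
    using grid.f1_decomp[OF g2', of p] unfolding Int_commute[of "g2 p"] spans ss .
  have k_eq: "k p = {s *\<^sub>R x + t *\<^sub>R y | s t. True}"
    using grid.f1_decomp[OF k', of p] unfolding Int_commute[of "k p"] spans ss .
  \<comment> \<open>On \<open>W\<close> this is the \<open>W\<^sup>\<bottom>\<close>-part of
    \<open>\<N>\<^sup>W + m \<eta>\<close>. \<open>L\<close> packs the directions \<open>X p\<close>
    and \<open>Y p\<close> into a pair, so that the factor \<open>c\<close> found below is common to
    both.\<close>
  let ?Q = "\<lambda>v u. dP v u + m *\<^sub>R (\<eta> p v u - P p (\<eta> p v u))"
  define L where "L u = (?Q (X p) u, ?Q (Y p) u)" for u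
  define n where "n u = (dP (X p) u, dP (Y p) u)" for u
  have lQ: "linear (?Q v)" if "v \<in> tangent_space A p" for v
    using linear_compose_add[OF linear_dP[OF that] linear_compose[OF linear_compose_sub[OF
        linear_potential[OF \<eta> that] linear_compose[OF linear_potential[OF \<eta> that] linear_P]] linear_scaleR]]
    by (simp add: o_def)
  have linL: "linear L" and linn: "linear n"
    unfolding L_def n_def
    using bounded_linear_Pair lQ[OF Xp] lQ[OF Yp] linear_dP[OF Xp] linear_dP[OF Yp]
    unfolding linear_conv_bounded_linear by blast+
  have Lf1: "L u = n u" if "u \<in> f1 p" for u
    unfolding L_def n_def using potential_f1[OF \<eta> Xp that] potential_f1[OF \<eta> Yp that]
    by (simp add: linear_0[OF linear_P])
  have cover: "\<exists>h\<in>H. h p \<subseteq> {s *\<^sub>R (a *\<^sub>R x1 + b *\<^sub>R x2) + r *\<^sub>R (a *\<^sub>R y1 + b *\<^sub>R y2) | s r. True}"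
    (is "\<exists>h\<in>H. h p \<subseteq> ?S") if ab: "a \<noteq> 0 \<or> b \<noteq> 0" for a b
  proof -
    consider "a = 0" "b \<noteq> 0" | "a \<noteq> 0" "b = 0" | "a \<noteq> 0" "b \<noteq> 0" using ab by blast
    then show ?thesis
    proof cases
      case 1
      have "s *\<^sub>R x2 + r *\<^sub>R y2 \<in> ?S" for s r
        by (rule CollectI, intro exI[of _ "s / b"] exI[of _ "r / b"]) (simp add: 1)
      then have "g2 p \<subseteq> ?S" unfolding g2_eq by blast
      then show ?thesis using H(3) by blast
    next
      case 2
      have "s *\<^sub>R x1 + r *\<^sub>R y1 \<in> ?S" for s r
        by (rule CollectI, intro exI[of _ "s / a"] exI[of _ "r / a"]) (simp add: 2)
      then have "g1 p \<subseteq> ?S" unfolding g1_eq by blast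
      then show ?thesis using H(2) by blast
    next
      case 3
      \<comment> \<open>The ratio \<open>b / a\<close> makes the image of \<open>x1 + x2\<close> a
        multiple of \<open>a *\<^sub>R x1 + b *\<^sub>R x2\<close>, and likewise for
        \<open>y1 + y2\<close>.\<close>
      let ?T = "\<lambda>x u. planeproj B g1 g2 f1 f2 x u + (b / a) *\<^sub>R planeproj B g2 g1 f1 f2 x u"
      have proj: "planeproj B g1 g2 f1 f2 p x1 = x1" "planeproj B g1 g2 f1 f2 p x2 = 0"
        "planeproj B g1 g2 f1 f2 p y1 = y1" "planeproj B g1 g2 f1 f2 p y2 = 0"
        "planeproj B g2 g1 f1 f2 p x1 = 0" "planeproj B g2 g1 f1 f2 p x2 = x2"
        "planeproj B g2 g1 f1 f2 p y1 = 0" "planeproj B g2 g1 f1 f2 p y2 = y2"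
        using x12(2,3) y12(2,3) grid.F_id[OF g1'] grid.F_f2[OF g1'] grid.F_id[OF g2'] grid.F_f2[OF g2'] by auto
      have T: "?T p (s *\<^sub>R x + r *\<^sub>R y) =
          (s / a) *\<^sub>R (a *\<^sub>R x1 + b *\<^sub>R x2) + (r / a) *\<^sub>R (a *\<^sub>R y1 + b *\<^sub>R y2)" for s r
        unfolding x12(1) y12(1) using 3
        by (simp add: linear_add[OF grid.linear_F[OF g1']] linear_add[OF grid.linear_F[OF g2']]
            linear_scale[OF grid.linear_F[OF g1']] linear_scale[OF grid.linear_F[OF g2']] proj algebra_simps)
      have "?T p ` k p \<subseteq> {s *\<^sub>R (a *\<^sub>R x1 + b *\<^sub>R x2) + r *\<^sub>R (a *\<^sub>R y1 + b *\<^sub>R y2) | s r. True}"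
        unfolding k_eq using T by blast
      then show ?thesis using H(4)[of "b / a"] 3 by (intro bexI[of _ "\<lambda>x. ?T x ` k x"]) auto
    qed
  qed
  have pencil: "\<exists>c. a *\<^sub>R L y1 + b *\<^sub>R L y2 = c *\<^sub>R (a *\<^sub>R n x1 + b *\<^sub>R n x2)" if ab: "a \<noteq> 0 \<or> b \<noteq> 0" for a b
  proof -
    obtain h where h: "h \<in> H" "h p \<subseteq> {s *\<^sub>R (a *\<^sub>R x1 + b *\<^sub>R x2) + r *\<^sub>R (a *\<^sub>R y1 + b *\<^sub>R y2) | s r. True}"
      using cover[OF ab] by blast
    have hW: "h x \<subseteq> W x" "subspace (h x)" for x
      using h(1) H(1) unfolding parallel_null_planes_def null_subbundle_def subbundle_def by auto
    obtain u where u: "u \<in> h p" "u \<notin> f1 p"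
      "\<And>v. v \<in> tangent_space A p \<Longrightarrow> ?Q v u = 0"
      using darboux_transform_point[OF \<eta> dt[OF h(1)] hW] by metis
    obtain s r where sr: "u = s *\<^sub>R (a *\<^sub>R x1 + b *\<^sub>R x2) + r *\<^sub>R (a *\<^sub>R y1 + b *\<^sub>R y2)" using u(1) h(2) by blast
    have xf: "a *\<^sub>R x1 + b *\<^sub>R x2 \<in> f1 p" using x12 subspace_f1 by (simp add: subspace_add subspace_scale)
    \<comment> \<open>The vector from the Darboux transform lies outside \<open>f1\<close>, so
      \<open>L u = 0\<close> can be solved for the part of \<open>L\<close> on \<open>f2\<close>; on
      \<open>f1\<close>, where \<open>\<eta>\<close> vanishes, \<open>L\<close> is
      \<open>n\<close>.\<close>
    then have r: "r \<noteq> 0" using u(2) sr subspace_scale[OF subspace_f1 xf] by auto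
    have "L u = 0" unfolding L_def using u(3)[OF Xp] u(3)[OF Yp] by (simp add: zero_prod_def)
    then have "s *\<^sub>R n (a *\<^sub>R x1 + b *\<^sub>R x2) + r *\<^sub>R L (a *\<^sub>R y1 + b *\<^sub>R y2) = 0"
      unfolding sr linear_add[OF linL, of "s *\<^sub>R _"] linear_scale[OF linL, of s] linear_scale[OF linL, of r] Lf1[OF xf] .
    then have "r *\<^sub>R L (a *\<^sub>R y1 + b *\<^sub>R y2) = r *\<^sub>R (- (s / r)) *\<^sub>R n (a *\<^sub>R x1 + b *\<^sub>R x2)"
      using r by (simp add: add_eq_0_iff)
    then have "L (a *\<^sub>R y1 + b *\<^sub>R y2) = (- (s / r)) *\<^sub>R n (a *\<^sub>R x1 + b *\<^sub>R x2)"
      by (rule scaleR_left_imp_eq[OF r])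
    then show ?thesis
      unfolding linear_add[OF linL] linear_add[OF linn] linear_scale[OF linL] linear_scale[OF linn] by blast
  qed
  obtain c where c: "L y1 = c *\<^sub>R n x1" "L y2 = c *\<^sub>R n x2" by (rule proportional_pencil[OF pencil])
  \<comment> \<open>Since \<open>L\<close> and \<open>n\<close> agree on \<open>f1\<close>,
    subtracting \<open>c\<close> times \<open>x1\<close> and \<open>x2\<close> makes
    \<open>L\<close> vanish.\<close>
  define z1 where "z1 = y1 - c *\<^sub>R x1"
  define z2 where "z2 = y2 - c *\<^sub>R x2"
  have Lz: "L z1 = 0" "L z2 = 0"
    unfolding z1_def z2_def linear_diff[OF linL] linear_scale[OF linL] c using Lf1 x12(2,3) by auto
  have b0: "B x1 x1 = 0" "B x1 x2 = 0" "B x2 x1 = 0" "B x2 x2 = 0" "B y1 y1 = 0" "B y1 y2 = 0" "B y2 y2 = 0"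
    "B x1 y1 = 0" "B x2 y2 = 0" "B y1 x1 = 0" "B y2 x2 = 0"
    using x12(2,3) y12(2,3) null_f1[of _ p] grid.null_f1[OF swap_f, of _ p] grid.null_f1[OF g1', of _ p]
      grid.null_f1[OF g2', of _ p] by auto
  \<comment> \<open>\<open>k\<close> is null. The resulting relation makes \<open>z1\<close> and
    \<open>z2\<close> orthogonal whatever the value of \<open>c\<close>.\<close>
  have "B x y = 0" using grid.null_f1[OF k', of x p y] x y by auto
  then have b1: "B x2 y1 = - B x1 y2" unfolding x12(1) y12(1) using b0 by simp
  have h: "B x1 y2 \<noteq> 0" using line_pairing[OF x12(2) ne(1) y12(3) ne(4)] .
  have f1x: "x1 \<in> f1 p" "x2 \<in> f1 p" using x12 by auto
  have yW: "y1 \<in> W p" "y2 \<in> W p" using y12 grid.f1_W[OF swap_f, of p] by auto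
  have "z1 \<in> W p" "z2 \<in> W p"
    unfolding z1_def z2_def using yW f1x f1_W[of p] subspace_W by (meson subsetD subspace_diff subspace_scale)+
  then show "dP (X p) (dP (Y p) \<xi>) = dP (Y p) (dP (X p) \<xi>)"
  proof (rule commute_of_null_complement[OF \<eta> m X Y \<xi> f1x, of z1 z2 "B x1 y2"])
    fix w assume "w \<in> W p"
    then obtain u1 u2 where w: "w = u1 + u2" "u1 \<in> f1 p" "u2 \<in> f2 p" unfolding f12(2)[symmetric] sum_space_def by blast
    then obtain a b d e where "u1 = a *\<^sub>R x1 + b *\<^sub>R x2" "u2 = d *\<^sub>R y1 + e *\<^sub>R y2" using f1_eq f2_eq by blast
    then have "w = (a + d * c) *\<^sub>R x1 + (b + e * c) *\<^sub>R x2 + d *\<^sub>R z1 + e *\<^sub>R z2"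
      unfolding w(1) z1_def z2_def by (simp add: algebra_simps)
    then show "\<exists>a b c d. w = a *\<^sub>R x1 + b *\<^sub>R x2 + c *\<^sub>R z1 + d *\<^sub>R z2" by blast
  next
    fix v z assume "v = X p \<or> v = Y p" "z = z1 \<or> z = z2"
    then show "dP v z + m *\<^sub>R (\<eta> p v z - P p (\<eta> p v z)) = 0"
      using Lz unfolding L_def by (auto simp: zero_prod_def)
  qed (use b0 b1 h in \<open>auto simp: z1_def z2_def sym[of y1 x2] sym[of y2 x1]\<close>)
qed

end

section \<open>Demoulin families\<close>

lemma RP1_three:
  obtains \<alpha> \<beta> \<gamma> where "\<alpha> \<in> RP1" "\<beta> \<in> RP1" "\<gamma> \<in> RP1" "\<alpha> \<noteq> \<beta>" "\<alpha> \<noteq> \<gamma>" "\<beta> \<noteq> \<gamma>"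
proof -
  define x :: "real ^ 2" where "x = axis 1 1"
  define y :: "real ^ 2" where "y = axis 2 1"
  have c: "x $ 1 = 1" "x $ 2 = 0" "y $ 1 = 0" "y $ 2 = 1" by (simp_all add: x_def y_def axis_def)
  have ne: "x \<noteq> 0" "y \<noteq> 0" "x + y \<noteq> 0" using c by (auto simp: vec_eq_iff forall_2)
  have in_RP1: "span {z} \<in> RP1" if "z \<noteq> 0" for z :: "real ^ 2"
    using that by (simp add: RP1_def dim_singleton)
  have "x \<notin> span {y}" "x \<notin> span {x + y}" "y \<notin> span {x + y}"
    using c by (auto simp: span_singleton vec_eq_iff forall_2)
  then show thesis
    using that[of "span {x}" "span {y}" "span {x + y}"] in_RP1 ne span_base[of x "{x}"] span_base[of y "{y}"]
    by auto
qed

locale demoulin = form_manifold A B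
  for A :: "('s::t2_space, 'n::finite) chart set" and B :: "'v::euclidean_space \<Rightarrow> 'v \<Rightarrow> real" +
  fixes W :: "'s \<Rightarrow> 'v set" and f fh :: "(real ^ 2) set \<Rightarrow> 's \<Rightarrow> 'v set" and r s :: nat
  assumes nondeg: "has_signature B UNIV r s" and W: "map_G22 A B W" and families: "demoulin_families A B W f fh"
begin

lemma swap_families: "demoulin A B W fh f r s"
proof unfold_locales
  show "has_signature B UNIV r s" by (rule nondeg)
  show "map_G22 A B W" by (rule W)
  show "demoulin_families A B W fh f"
    using families unfolding demoulin_families_def by (simp add: Un_commute Int_commute)
qed

lemma grid:
  assumes "\<alpha> \<in> RP1" "\<alpha>' \<in> RP1" "\<alpha> \<noteq> \<alpha>'" "\<beta> \<in> RP1" "\<beta>' \<in> RP1" "\<beta> \<noteq> \<beta>'"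
  shows "grid A B W (f \<alpha>) (f \<alpha>') (fh \<beta>) (fh \<beta>')"
proof unfold_locales
  show "x = 0" if "\<And>y. B x y = 0" for x
    by (rule has_signature_nondegenerate[OF nondeg]) (use that in auto)
  show "x = 0" if "x \<in> W p" "\<And>y. y \<in> W p \<Longrightarrow> B x y = 0" for x p
    by (rule has_signature_nondegenerate[of "W p" 2 2]) (use that W in \<open>auto simp: map_G22_def\<close>)
  show "subspace (W p)" for p using W unfolding map_G22_def subbundle_def by blast
  have l: "subbundle A 1 (\<lambda>p. f a p \<inter> fh b p)" if "a \<in> RP1" "b \<in> RP1" for a b
    using families that unfolding demoulin_families_def null_subbundle_def by blast
  show "subbundle A 1 (\<lambda>p. f \<alpha> p \<inter> fh \<beta> p)" "subbundle A 1 (\<lambda>p. f \<alpha> p \<inter> fh \<beta>' p)"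
    "subbundle A 1 (\<lambda>p. f \<alpha>' p \<inter> fh \<beta> p)" "subbundle A 1 (\<lambda>p. f \<alpha>' p \<inter> fh \<beta>' p)"
    using l assms by auto
  show "{f \<alpha>, f \<alpha>', fh \<beta>, fh \<beta>'} \<subseteq> parallel_null_planes A B W"
    using families assms unfolding demoulin_families_def by auto
  show "f \<alpha> p \<inter> f \<alpha>' p = {0}" "sum_space (f \<alpha> p) (f \<alpha>' p) = W p" "fh \<beta> p \<inter> fh \<beta>' p = {0}"
    "sum_space (fh \<beta> p) (fh \<beta>' p) = W p" for p
    using families assms unfolding demoulin_families_def by auto
qed

lemma families_eq: "parallel_null_planes A B W = f ` RP1 \<union> fh ` RP1"
  using families unfolding demoulin_families_def by (rule conjunct1)

lemma other: obtains \<alpha>' where "\<alpha>' \<in> RP1" "\<alpha> \<noteq> \<alpha>'"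
  using RP1_three by metis

lemma curved_flat_lie_applicable:
  assumes cf: "curved_flat A B W" and reg: "regular_map A B W"
  obtains C where "\<And>\<alpha>. \<alpha> \<in> RP1 \<Longrightarrow> lie_applicable A B (f \<alpha>) (C \<alpha>)"
    "\<And>\<alpha> \<beta>. \<alpha> \<in> RP1 \<Longrightarrow> \<beta> \<in> RP1 \<Longrightarrow> darboux_transform A B 1 (f \<alpha>) (C \<alpha>) (fh \<beta>)"
proof -
  obtain \<beta>1 \<beta>2 where \<beta>: "\<beta>1 \<in> RP1" "\<beta>2 \<in> RP1" "\<beta>1 \<noteq> \<beta>2" using RP1_three by metis
  have "\<exists>\<alpha>'. \<alpha>' \<in> RP1 \<and> \<alpha> \<noteq> \<alpha>'" for \<alpha> by (rule other[of \<alpha>]) blast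
  then obtain alt where alt: "\<And>\<alpha>. alt \<alpha> \<in> RP1 \<and> \<alpha> \<noteq> alt \<alpha>" by metis
  \<comment> \<open>The potential is built with two fixed members of the opposite family, so that
    its class does not vary with the transform; \<open>wedge_part_unique\<close> exchanges them for
    the member at hand.\<close>
  define \<eta> where "\<eta> \<alpha> = wedge_part B (f \<alpha>) (f (alt \<alpha>)) (fh \<beta>1) (fh \<beta>2)" for \<alpha>
  show thesis
  proof (rule that[of "\<lambda>\<alpha>. gauge_class A B (f \<alpha>) (\<eta> \<alpha>)"])
    fix \<alpha> assume \<alpha>: "\<alpha> \<in> RP1"
    have g: "grid A B W (f \<alpha>) (f (alt \<alpha>)) (fh \<beta>) (fh \<beta>')" if "\<beta> \<in> RP1" "\<beta>' \<in> RP1" "\<beta> \<noteq> \<beta>'" for \<beta> \<beta>'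
      by (rule grid[OF \<alpha> conjunct1[OF alt] conjunct2[OF alt] that])
    show "lie_applicable A B (f \<alpha>) (gauge_class A B (f \<alpha>) (\<eta> \<alpha>))"
      unfolding \<eta>_def by (rule grid.lie_applicable_f1[OF g[OF \<beta>] cf reg])
    fix b assume b: "b \<in> RP1"
    have gb: "grid A B W (f \<alpha>) (f (alt \<alpha>)) (fh b) (fh (alt b))" by (rule g[OF b conjunct1[OF alt] conjunct2[OF alt]])
    show "darboux_transform A B 1 (f \<alpha>) (gauge_class A B (f \<alpha>) (\<eta> \<alpha>)) (fh b)"
      unfolding \<eta>_def wedge_part_unique[OF g[OF \<beta>] gb] by (rule grid.darboux_g1[OF gb])
  qed
qed

text \<open>As a parallel null plane the image belongs to one of the families. It meets both
  \<open>f \<alpha>\<close> and \<open>f \<alpha>'\<close> in nonzero vectors, since the projections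
  preserve these planes, whereas a member of the \<open>f\<close> family is complementary to at
  least one of them.\<close>

lemma pencil_in_family:
  assumes \<alpha>: "\<alpha> \<in> RP1" "\<alpha>' \<in> RP1" "\<alpha> \<noteq> \<alpha>'"
    and \<beta>: "\<beta>1 \<in> RP1" "\<beta>2 \<in> RP1" "\<beta>3 \<in> RP1" "\<beta>1 \<noteq> \<beta>2" "\<beta>1 \<noteq> \<beta>3" "\<beta>2 \<noteq> \<beta>3" and t: "t \<noteq> 0"
  shows "(\<lambda>x. (\<lambda>u. planeproj B (fh \<beta>1) (fh \<beta>2) (f \<alpha>) (f \<alpha>') x u +
      t *\<^sub>R planeproj B (fh \<beta>2) (fh \<beta>1) (f \<alpha>) (f \<alpha>') x u) ` fh \<beta>3 x) \<in> fh ` RP1" (is "?E \<in> _")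
proof -
  note g = grid[OF \<alpha> \<beta>(1,2,4)] and g3 = grid[OF \<alpha> \<beta>(1,3,5)]
  note g' = grid.transpose[OF g]
  have E: "?E \<in> parallel_null_planes A B W"
    by (rule grid.pencil_parallel_null_planes[OF g' _ t]) (use grid.planes[OF g3] in auto)
  have nonzero: "\<exists>u \<in> ?E p. u \<noteq> 0 \<and> u \<in> f a p" if a: "a = \<alpha> \<or> a = \<alpha>'" for a p
  proof -
    let ?H1 = "planeproj B (fh \<beta>1) (fh \<beta>2) (f \<alpha>) (f \<alpha>') p" and ?H2 = "planeproj B (fh \<beta>2) (fh \<beta>1) (f \<alpha>) (f \<alpha>') p"
    have "dim (f a p \<inter> fh \<beta>3 p) = 1" using a grid.lines[OF g3] unfolding subbundle_def by auto
    then obtain x where x: "x \<in> f a p" "x \<in> fh \<beta>3 p" "x \<noteq> 0" by (rule dim_one_nonzero) auto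
    have H1: "?H1 x \<in> f a p"
      using a x grid.F_g1[OF g', of x p] grid.F_g1[OF grid.swap_g[OF g'], of x p]
        planeproj_unique[OF g' g'] by (auto simp: planeproj_def add.commute)
    have H2: "?H2 x \<in> f a p"
      using a x grid.F_g1[OF grid.swap_f[OF g'], of x p] grid.F_g1[OF grid.swap_f[OF grid.swap_g[OF g']], of x p]
      by (auto simp: planeproj_def add.commute)
    have sa: "subspace (f a p)" using a grid.subspace_f1[OF g] grid.subspace_f1[OF grid.swap_f[OF g]] by auto
    have "?H1 x + t *\<^sub>R ?H2 x \<noteq> 0"
    proof
      assume 0: "?H1 x + t *\<^sub>R ?H2 x = 0"
      have "?H1 (?H1 x + t *\<^sub>R ?H2 x) = ?H1 x"
        by (simp add: linear_add[OF grid.linear_F[OF g']] linear_scale[OF grid.linear_F[OF g']]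
            grid.FF[OF g'] grid.FG_zero[OF g'])
      then have "?H1 x = 0" using 0 linear_0[OF grid.linear_F[OF g']] by metis
      then have "x \<in> fh \<beta>2 p"
        using 0 t grid.P_id[OF g', of x p] x a grid.f1_W[OF g, of p] grid.f1_W[OF grid.swap_f[OF g], of p]
        unfolding grid.P_def[OF g'] by auto
      moreover have "fh \<beta>2 p \<inter> fh \<beta>3 p = {0}" using grid.g12(1)[OF grid[OF \<alpha> \<beta>(2,3,6)]] .
      ultimately show False using x by blast
    qed
    moreover have "?H1 x + t *\<^sub>R ?H2 x \<in> f a p" using H1 H2 sa by (simp add: subspace_add subspace_scale)
    ultimately show ?thesis using x(2) by blast
  qed
  have "?E \<notin> f ` RP1"
  proof
    assume "?E \<in> f ` RP1"
    then obtain c where c: "c \<in> RP1" "?E = f c" by blast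
    obtain a where a: "a = \<alpha> \<or> a = \<alpha>'" "a \<noteq> c" using \<alpha>(3) by blast
    then have "a \<in> RP1" using \<alpha> by blast
    then have "f a p \<inter> f c p = {0}" for p
      by (rule grid.f12(1)[OF grid[OF _ c(1) a(2) \<beta>(1,2,4)]])
    \<comment> \<open>Any point of the manifold serves; \<open>undefined\<close> names one.\<close>
    moreover obtain u where "u \<in> f c undefined" "u \<noteq> 0" "u \<in> f a undefined"
      using nonzero[OF a(1), of undefined] fun_cong[OF c(2), of undefined] by blast
    ultimately show False by blast
  qed
  then show ?thesis using E unfolding families_eq Un_iff by argo
qed

lemma flat_perp_of_darboux:
  assumes la: "lie_applicable A B (f \<alpha>) C" and \<alpha>: "\<alpha> \<in> RP1" and m: "m \<noteq> 0"
    and dt: "\<And>\<beta>. \<beta> \<in> RP1 \<Longrightarrow> darboux_transform A B m (f \<alpha>) C (fh \<beta>)"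
  shows "flat_on A (DW B W) (\<lambda>p. perp B (W p))"
proof -
  obtain \<beta>1 \<beta>2 \<beta>3 where \<beta>: "\<beta>1 \<in> RP1" "\<beta>2 \<in> RP1" "\<beta>3 \<in> RP1" "\<beta>1 \<noteq> \<beta>2" "\<beta>1 \<noteq> \<beta>3" "\<beta>2 \<noteq> \<beta>3"
    by (rule RP1_three)
  obtain \<alpha>' where \<alpha>': "\<alpha>' \<in> RP1" "\<alpha> \<noteq> \<alpha>'" using other .
  obtain \<eta> where \<eta>: "gauge_potential A B (f \<alpha>) \<eta>" "C = gauge_class A B (f \<alpha>) \<eta>"
    using la unfolding lie_applicable_def by blast
  show ?thesis
  proof (rule grid.flat_perp_of_darboux_family[OF grid[OF \<alpha> \<alpha>' \<beta>(1,2,4)] \<eta>(1) m, where k = "fh \<beta>3" and H = "fh ` RP1"])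
    show "grid A B W (f \<alpha>) (f \<alpha>') (fh \<beta>1) (fh \<beta>3)" by (rule grid[OF \<alpha> \<alpha>' \<beta>(1,3,5)])
    show "fh \<beta>2 p \<inter> fh \<beta>3 p = {0}" for p using grid.g12(1)[OF grid[OF \<alpha> \<alpha>' \<beta>(2,3,6)]] .
    show "fh ` RP1 \<subseteq> parallel_null_planes A B W" unfolding families_eq by (rule Un_upper2)
    show "(\<lambda>x. (\<lambda>u. planeproj B (fh \<beta>1) (fh \<beta>2) (f \<alpha>) (f \<alpha>') x u +
      t *\<^sub>R planeproj B (fh \<beta>2) (fh \<beta>1) (f \<alpha>) (f \<alpha>') x u) ` fh \<beta>3 x) \<in> fh ` RP1" if "t \<noteq> 0" for t
      by (rule pencil_in_family[OF \<alpha> \<alpha>' \<beta> that])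
    show "darboux_transform A B m (f \<alpha>) (gauge_class A B (f \<alpha>) \<eta>) h" if "h \<in> fh ` RP1" for h
      using dt that unfolding \<eta>(2) by blast
  qed (use \<beta> in auto)
qed

end

theorem theorem3p9:
  fixes A :: "('s::{t2_space, second_countable_topology}, 'n::finite) chart set"
    and B :: "'v::euclidean_space \<Rightarrow> 'v \<Rightarrow> real"
    and W :: "'s \<Rightarrow> 'v set"
    and f fh :: "(real ^ 2) set \<Rightarrow> 's \<Rightarrow> 'v set"
  assumes "CARD('n) \<ge> 2"
    and "smooth_atlas A"
    and "simply_connected (UNIV :: 's set)"
    and "DIM('v) = CARD('n) + 4"
    and "bilinear B" and "\<And>x y. B x y = B y x"
    and "has_signature B UNIV (CARD('n) + 2) 2"
    and "map_G22 A B W"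
    and "regular_map A B W"
    and "flat_on A (DW B W) W"
    and "demoulin_families A B W f fh"
  shows "curved_flat A B W \<longleftrightarrow>
    (\<exists>C Ch.
       (\<forall>\<alpha>\<in>RP1. lie_applicable A B (f \<alpha>) (C \<alpha>)) \<and>
       (\<forall>\<beta>\<in>RP1. lie_applicable A B (fh \<beta>) (Ch \<beta>)) \<and>
       (\<exists>m::real. m \<noteq> 0 \<and>
          (\<forall>\<alpha>\<in>RP1. \<forall>\<beta>\<in>RP1. darboux_pair A B m (f \<alpha>) (C \<alpha>) (fh \<beta>) (Ch \<beta>))))"
proof -
  interpret demoulin A B W f fh "CARD('n) + 2" 2
    by unfold_locales (use assms in auto)
  show ?thesis
  proof
    assume cf: "curved_flat A B W"
    obtain C where C: "\<And>\<alpha>. \<alpha> \<in> RP1 \<Longrightarrow> lie_applicable A B (f \<alpha>) (C \<alpha>)"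
      "\<And>\<alpha> \<beta>. \<alpha> \<in> RP1 \<Longrightarrow> \<beta> \<in> RP1 \<Longrightarrow> darboux_transform A B 1 (f \<alpha>) (C \<alpha>) (fh \<beta>)"
      by (rule curved_flat_lie_applicable[OF cf assms(9)]) (rule that)
    \<comment> \<open>The same construction with the families exchanged gives the transforms back,
      again with \<open>m = 1\<close>.\<close>
    obtain Ch where Ch: "\<And>\<beta>. \<beta> \<in> RP1 \<Longrightarrow> lie_applicable A B (fh \<beta>) (Ch \<beta>)"
      "\<And>\<beta> \<alpha>. \<beta> \<in> RP1 \<Longrightarrow> \<alpha> \<in> RP1 \<Longrightarrow> darboux_transform A B 1 (fh \<beta>) (Ch \<beta>) (f \<alpha>)"
      by (rule demoulin.curved_flat_lie_applicable[OF swap_families cf assms(9)]) (rule that)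
    show "\<exists>C Ch. (\<forall>\<alpha>\<in>RP1. lie_applicable A B (f \<alpha>) (C \<alpha>)) \<and>
       (\<forall>\<beta>\<in>RP1. lie_applicable A B (fh \<beta>) (Ch \<beta>)) \<and>
       (\<exists>m::real. m \<noteq> 0 \<and>
          (\<forall>\<alpha>\<in>RP1. \<forall>\<beta>\<in>RP1. darboux_pair A B m (f \<alpha>) (C \<alpha>) (fh \<beta>) (Ch \<beta>)))"
      using C Ch unfolding darboux_pair_def
      by (intro exI[of _ C] exI[of _ Ch] conjI ballI exI[of _ 1]) auto
  next
    assume "\<exists>C Ch. (\<forall>\<alpha>\<in>RP1. lie_applicable A B (f \<alpha>) (C \<alpha>)) \<and>
       (\<forall>\<beta>\<in>RP1. lie_applicable A B (fh \<beta>) (Ch \<beta>)) \<and>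
       (\<exists>m::real. m \<noteq> 0 \<and>
          (\<forall>\<alpha>\<in>RP1. \<forall>\<beta>\<in>RP1. darboux_pair A B m (f \<alpha>) (C \<alpha>) (fh \<beta>) (Ch \<beta>)))"
    then obtain C Ch m where C: "\<And>\<alpha>. \<alpha> \<in> RP1 \<Longrightarrow> lie_applicable A B (f \<alpha>) (C \<alpha>)" and m: "m \<noteq> 0"
      and dp: "\<And>\<alpha> \<beta>. \<alpha> \<in> RP1 \<Longrightarrow> \<beta> \<in> RP1 \<Longrightarrow> darboux_pair A B m (f \<alpha>) (C \<alpha>) (fh \<beta>) (Ch \<beta>)"
      by blast
    \<comment> \<open>Flatness on \<open>W\<close> is a hypothesis; flatness on
      \<open>W\<^sup>\<bottom>\<close> follows from the transforms of a single
      \<open>f \<alpha>\<close>.\<close>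
    obtain \<alpha> where \<alpha>: "\<alpha> \<in> RP1" using RP1_three by metis
    have "flat_on A (DW B W) (\<lambda>p. perp B (W p))"
      using flat_perp_of_darboux[OF C[OF \<alpha>] \<alpha> m] dp[OF \<alpha>] unfolding darboux_pair_def by blast
    then show "curved_flat A B W" unfolding curved_flat_def using assms(10) by blast
  qed
qed

end
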